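(* For each $r \ge 5$, there exists $\gamma > 0$ such that if $p=p(n) \le n^{-2/r+\gamma}$ and $\mu_r \to \infty$ as $n\to\infty$, then the following holds. There exists a collection $\mathcal{G}$ of $r$-uniform hypergraphs (on the vertex set of $K_n$), with $\mathbb{P}\big( H_r(G(n,p)) \in \mathcal{G} \big) \to 1$ as $n \to \infty$, such that $$\mathbb{P}\big( H_r(G(n,p)) = H \big) = \pi^{e(H)} (1-\pi)^{\binom{n}{r} - e(H)} \, p^{-t(H)} \, e^{ - \Lambda(n,r) + O(\omega \mu_{r+1} + n^{-\gamma})}$$ for every $H \in \mathcal{G}$.
   Context: $G(n,p)$ is the binomial random graph on $n$ labelled vertices. For a graph $G$, $H_r(G)$ is the $r$-uniform hypergraph on $V(G)$ whose hyperedges are the $r$-sets $S$ with $G[S]\cong K_r$. For each $k$, $\mu_k = \binom{n}{k} p^{\binom{k}{2}}$, and $\pi = p^{\binom{r}{2}}$. Define $$\Lambda(n,r) = \frac{1}{2} \sum_{s = 2}^{r-1} \binom{n}{r}\binom{r}{s}\binom{n-r}{r-s} p^{2\binom{r}{2}} \Big( p^{-\binom{s}{2}} - 1 \Big).$$ For an $r$-uniform hypergraph $H$, $e(H)$ is its number of hyperedges, $G(H)$ is the graph whose edges are all pairs of vertices contained in some hyperedge of $H$, and $t(H) = \binom{r}{2} e(H) - e(G(H))$. Here $\omega = \omega(n)$ is a function with $\omega(n) \to \infty$ as $n \to \infty$ arbitrarily slowly; the collection $\mathcal{G}$ and the rate at which $\mathbb{P}(H_r(G(n,p)) \in \mathcal{G})\to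 1$ may depend on $\omega$. The constant implicit in $O(\cdot)$ is independent of $n$ and of $H\in\mathcal{G}$. *)

theory Defs
  imports "HOL-Probability.Product_PMF" "HOL-Library.Ramsey"
begin

text \<open>A graph or hypergraph is a pair of a vertex set and a set of (hyper)edges; graphs are
  the 2-uniform ones. The set \<open>nsets V k\<close> consists of the \<open>k\<close>-element subsets of \<open>V\<close>.\<close>

type_synonym 'a hypergraph = "'a set \<times> 'a set set"

abbreviation verts :: "'a hypergraph \<Rightarrow> 'a set" where
  "verts H \<equiv> fst H"

abbreviation edges :: "'a hypergraph \<Rightarrow> 'a set set" where
  "edges H \<equiv> snd H"

definition uniform_hypergraph :: "nat \<Rightarrow> 'a hypergraph \<Rightarrow> bool" where
  "uniform_hypergraph r H \<longleftrightarrow> edges H \<subseteq> nsets (verts H) r"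

definition num_edges :: "'a hypergraph \<Rightarrow> nat" where
  "num_edges H = card (edges H)"

definition complete_graph :: "nat \<Rightarrow> nat hypergraph" where
  "complete_graph n = ({1..n}, nsets {1..n} 2)"

definition induced :: "'a hypergraph \<Rightarrow> 'a set \<Rightarrow> 'a hypergraph" where
  "induced G S = (S, {e \<in> edges G. e \<subseteq> S})"

definition isomorphic :: "'a hypergraph \<Rightarrow> 'b hypergraph \<Rightarrow> bool" where
  "isomorphic G G' \<longleftrightarrow>
    (\<exists>f. bij_betw f (verts G) (verts G') \<and> edges G' = (\<lambda>e. f ` e) ` edges G)"

definition clique_hypergraph :: "nat \<Rightarrow> 'a hypergraph \<Rightarrow> 'a hypergraph" where
  "clique_hypergraph r G =
    (verts G, {S \<in> nsets (verts G) r. isomorphic (induced G S) (complete_graph r)})"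

definition shadow_graph :: "'a hypergraph \<Rightarrow> 'a hypergraph" where
  "shadow_graph H = (verts H, {e \<in> nsets (verts H) 2. \<exists>h \<in> edges H. e \<subseteq> h})"

definition edge_overlap :: "nat \<Rightarrow> 'a hypergraph \<Rightarrow> int" where
  "edge_overlap r H =
    int (r choose 2) * int (num_edges H) - int (num_edges (shadow_graph H))"

definition random_graph :: "nat \<Rightarrow> real \<Rightarrow> nat hypergraph pmf" where
  "random_graph n p =
    map_pmf (\<lambda>f. ({1..n}, {e \<in> edges (complete_graph n). f e}))
      (Pi_pmf (edges (complete_graph n)) False (\<lambda>_. bernoulli_pmf p))"

definition mu :: "nat \<Rightarrow> real \<Rightarrow> nat \<Rightarrow> real" where
  "mu n p k = real (n choose k) * p ^ (k choose 2)"

definition Lambda :: "nat \<Rightarrow> nat \<Rightarrow> real \<Rightarrow> real" where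
  "Lambda n r p =
    1 / 2 * (\<Sum>s = 2..r - 1.
      real (n choose r) * real (r choose s) * real ((n - r) choose (r - s))
        * p ^ (2 * (r choose 2)) * (p powi (- int (s choose 2)) - 1))"

end

theory Submission
  imports Defs
begin

text \<open>Let \<open>F\<close> be the set of pairs covered by \<open>H\<close>. The event that the clique hypergraph is \<open>H\<close>
  means that \<open>F\<close> is present and no further \<open>r\<close>-set becomes a clique. Conditioning on \<open>F\<close> leaves
  the problem of avoiding the events ``all pairs of \<open>S\<close> outside \<open>F\<close> are present'', and a Janson
  argument (exposing the \<open>r\<close>-sets one at a time) gives the logarithm of this probability as
  minus the sum of the probabilities plus half the sum of the pair covariances, up to a sum over
  triples of overlapping \<open>r\<close>-sets. Conditioning on \<open>F\<close> raises the first sum by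
  \<open>2 * Lambda\<close> and the covariance term equals \<open>Lambda\<close>, again up to triples and the
  fluctuation of \<open>e(H)\<close>; this leaves \<open>- Lambda\<close>.

  If \<open>F\<close> is contained in the random graph \<open>A\<close> itself, then \<open>p ^ card (Y - F)\<close> is at most
  \<open>p ^ card (Y - A)\<close>, whose mean is at most \<open>(2 * p) ^ card Y\<close>. So all error terms are typically
  as small as in the unconditioned model, where a triple spanning \<open>r + 1\<close> vertices contributes
  to \<open>mu n p (r + 1)\<close> and every other triple is polynomially rare; Markov's inequality
  then defines the collection of typical \<open>H\<close>.\<close>

section \<open>Product Bernoulli measures\<close>

text \<open>Call 2m - rv the excess of a configuration with v vertices and m edges. One r-clique has
  excess -r, and attaching a clique along s vertices, 2 \<le> s \<le> r - 1, adds s(r + 1 - s) - r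
  \<ge> r - 2. Three chained cliques that each bring new vertices thus have excess at least r - 4,
  positive exactly from r = 5 on; this margin becomes the power of n in the error. The exception is
  a triple inside r + 1 vertices: it covers all of K_{r+1}, whose excess is 0, so no power of n is
  gained and \<open>mu n p (r + 1)\<close> stays in the error. The obstacle is that conditioning
  distorts all probabilities near \<open>\<H>\<close>. No separate estimates are needed, because the
  pairs of a member of \<open>\<H>\<close> lie in \<open>F\<close> and cost nothing: the conditional
  probability for one or two sets next to members of \<open>\<H>\<close> equals the
  \<open>triple_weight\<close> of a triple completed by those members. Hence one sum over triples
  controls both the Janson error and the comparison with the unconditioned model. The fluctuation of
  e(H), multiplied by \<open>kappa\<close>, is controlled through its second moment, which involves
  mu_r kappa^2: again one clique with two cliques attached.\<close>

definition expec :: "real \<Rightarrow> 'e set \<Rightarrow> ('e set \<Rightarrow> real) \<Rightarrow> real" where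
  "expec p E \<phi> = (\<Sum>A\<in>Pow E. p ^ card A * (1 - p) ^ card (E - A) * \<phi> A)"

lemma expec_cmult: "expec p E (\<lambda>A. c * \<phi> A) = c * expec p E \<phi>"
  by (simp add: expec_def sum_distrib_left mult_ac)

lemma expec_diff: "expec p E (\<lambda>A. \<phi> A - \<psi> A) = expec p E \<phi> - expec p E \<psi>"
  by (simp add: expec_def sum_subtractf right_diff_distrib)

lemma expec_sum: "expec p E (\<lambda>A. \<Sum>i\<in>I. \<phi> i A) = (\<Sum>i\<in>I. expec p E (\<phi> i))"
  unfolding expec_def by (simp add: sum_distrib_left) (rule sum.swap)

lemma expec_cong: "(\<And>A. A \<subseteq> E \<Longrightarrow> \<phi> A = \<psi> A) \<Longrightarrow> expec p E \<phi> = expec p E \<psi>"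
  unfolding expec_def by (rule sum.cong) auto

lemma expec_mono:
  assumes "0 \<le> p" "p \<le> 1" "\<And>A. A \<subseteq> E \<Longrightarrow> \<phi> A \<le> \<psi> A"
  shows "expec p E \<phi> \<le> expec p E \<psi>"
  unfolding expec_def using assms by (intro sum_mono mult_left_mono) auto

lemma expec_nonneg:
  assumes "0 \<le> p" "p \<le> 1" "\<And>A. A \<subseteq> E \<Longrightarrow> 0 \<le> \<phi> A"
  shows "0 \<le> expec p E \<phi>"
  unfolding expec_def using assms by (intro sum_nonneg mult_nonneg_nonneg) auto

text \<open>Conditioning on whether \<open>e\<close> is chosen. The inductions below that peel off
  elements of \<open>E\<close> go through this recursion.\<close>

lemma expec_split:
  assumes "finite E" "e \<in> E"
  shows "expec p E \<phi> = p * expec p (E - {e}) (\<lambda>A. \<phi> (insert e A)) + (1 - p) * expec p (E - {e}) \<phi>"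
proof -
  let ?E = "E - {e}"
  let ?w = "\<lambda>E A. p ^ card A * (1 - p) ^ card (E - A)"
  have PE: "Pow E = insert e ` Pow ?E \<union> Pow ?E"
    using Pow_insert[of e ?E] assms(2) by (simp add: insert_absorb Un_commute)
  have inj: "inj_on (insert e) (Pow ?E)"
    by (rule inj_onI) (metis DiffE Pow_iff insert_ident insertI1 subsetD)
  have "expec p E \<phi> = (\<Sum>A\<in>insert e ` Pow ?E. ?w E A * \<phi> A) + (\<Sum>A\<in>Pow ?E. ?w E A * \<phi> A)"
    unfolding expec_def PE by (rule sum.union_disjoint) (use assms in auto)
  also have "(\<Sum>A\<in>insert e ` Pow ?E. ?w E A * \<phi> A) = (\<Sum>A\<in>Pow ?E. ?w E (insert e A) * \<phi> (insert e A))"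
    using inj by (simp add: sum.reindex)
  also have "\<dots> = p * expec p ?E (\<lambda>A. \<phi> (insert e A))"
    unfolding expec_def sum_distrib_left
  proof (rule sum.cong[OF refl])
    fix A assume A: "A \<in> Pow ?E"
    then have "finite A" "e \<notin> A" "E - insert e A = ?E - A"
      using assms by (auto intro: finite_subset)
    then show "?w E (insert e A) * \<phi> (insert e A) = p * (?w ?E A * \<phi> (insert e A))"
      by simp
  qed
  also have "(\<Sum>A\<in>Pow ?E. ?w E A * \<phi> A) = (1 - p) * expec p ?E \<phi>"
    unfolding expec_def sum_distrib_left
  proof (rule sum.cong[OF refl])
    fix A assume A: "A \<in> Pow ?E"
    then have "E - A = insert e (?E - A)" using assms by auto
    moreover have "card (insert e (?E - A)) = Suc (card (?E - A))"
      using assms by (intro card_insert_disjoint) auto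
    ultimately show "?w E A * \<phi> A = (1 - p) * (?w ?E A * \<phi> A)"
      by simp
  qed
  finally show ?thesis .
qed

lemma expec_const: "finite E \<Longrightarrow> expec p E (\<lambda>_. c) = c"
proof (induction E rule: finite_induct)
  case empty
  then show ?case by (simp add: expec_def)
next
  case (insert e E)
  have "expec p (insert e E) (\<lambda>_. c) = p * c + (1 - p) * c"
    using insert by (subst expec_split[of _ e]) auto
  then show ?case by (simp add: algebra_simps)
qed

lemma markov_expec:
  assumes "0 \<le> p" "p \<le> 1" "0 < z" "\<And>A. A \<subseteq> E \<Longrightarrow> 0 \<le> \<phi> A"
  shows "expec p E (\<lambda>A. of_bool (z < \<phi> A)) \<le> expec p E \<phi> / z"
proof -
  have "expec p E (\<lambda>A. of_bool (z < \<phi> A)) \<le> expec p E (\<lambda>A. (1 / z) * \<phi> A)"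
    using assms by (intro expec_mono) (auto simp: field_simps)
  also have "\<dots> = (1 / z) * expec p E \<phi>" by (rule expec_cmult)
  finally show ?thesis by simp
qed

text \<open>The elements of \<open>Y\<close> contribute independent factors, each of mean p * 1 + (1
  - p) * p, at most 2 * p. So replacing the covered pairs by the whole random graph costs only a
  constant factor per edge.\<close>

lemma expec_power_card_diff_le:
  assumes "finite E" "Y \<subseteq> E" "0 \<le> p" "p \<le> 1"
  shows "expec p E (\<lambda>A. p ^ card (Y - A)) \<le> (2 * p) ^ card Y"
proof -
  have fY: "finite Y" using assms finite_subset by blast
  from fY assms(1,2) show ?thesis
  proof (induction Y arbitrary: E rule: finite_induct)
    case empty
    then show ?case by (simp add: expec_const)
  next
    case (insert e Y)
    have e: "e \<in> E" and Y: "Y \<subseteq> E - {e}" using insert by auto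
    have 1: "expec p (E - {e}) (\<lambda>A. p ^ card (insert e Y - insert e A))
        = expec p (E - {e}) (\<lambda>A. p ^ card (Y - A))"
      using insert(2) by (intro expec_cong) (metis Diff_insert Diff_insert0 Diff_insert2 Diff_insert_absorb insert_Diff_single insert_absorb2 insert_Diff1 insertI1)
    have 2: "expec p (E - {e}) (\<lambda>A. p ^ card (insert e Y - A))
        = expec p (E - {e}) (\<lambda>A. p * p ^ card (Y - A))"
    proof (rule expec_cong)
      fix A assume "A \<subseteq> E - {e}"
      then have "insert e Y - A = insert e (Y - A)" by auto
      then show "p ^ card (insert e Y - A) = p * p ^ card (Y - A)"
        using insert by simp
    qed
    have IH: "expec p (E - {e}) (\<lambda>A. p ^ card (Y - A)) \<le> (2 * p) ^ card Y" (is "?x \<le> _")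
      using insert Y by auto
    have "expec p E (\<lambda>A. p ^ card (insert e Y - A)) = (p + (1 - p) * p) * ?x"
      using e insert by (subst expec_split[of _ e]) (auto simp: 1 2 expec_cmult algebra_simps)
    also have "\<dots> \<le> (2 * p) * (2 * p) ^ card Y"
      using assms IH by (intro mult_mono expec_nonneg) (auto simp: algebra_simps)
    finally show ?case using insert by simp
  qed
qed

text \<open>A case of Harris' inequality: containing \<open>Y\<close> is negatively correlated with
  a property that survives deletion of elements of \<open>Y\<close>. When one element is peeled off,
  its present branch is at most its absent branch, hence at most their average.\<close>

lemma expec_superset_le:
  assumes "finite E" "Y \<subseteq> E" "0 \<le> p" "p \<le> 1"
    and "\<And>e A. e \<in> Y \<Longrightarrow> e \<notin> A \<Longrightarrow> Q (insert e A) \<Longrightarrow> Q A"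
  shows "expec p E (\<lambda>A. of_bool (Y \<subseteq> A \<and> Q A)) \<le> p ^ card Y * expec p E (\<lambda>A. of_bool (Q A))"
proof -
  have fY: "finite Y" using assms finite_subset by blast
  from fY assms(2,5) show ?thesis
  proof (induction Y rule: finite_induct)
    case empty
    then show ?case by simp
  next
    case (insert e Y)
    let ?P = "\<lambda>A. Y \<subseteq> A \<and> Q A"
    have e: "e \<in> E" using insert by auto
    have "expec p E (\<lambda>A. of_bool (insert e Y \<subseteq> A \<and> Q A))
       = p * expec p (E - {e}) (\<lambda>A. of_bool (?P (insert e A)))
        + (1 - p) * expec p (E - {e}) (\<lambda>A. 0)"
      unfolding expec_split[OF assms(1) e, of p "\<lambda>A. of_bool (insert e Y \<subseteq> A \<and> Q A)"]
      by (intro arg_cong2[of _ _ _ _ "(+)"] arg_cong2[of _ _ _ _ "(*)"] refl expec_cong) auto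
    also have "\<dots> = p * expec p (E - {e}) (\<lambda>A. of_bool (?P (insert e A)))"
      using assms by (simp add: expec_const)
    also have "\<dots> \<le> p * expec p E (\<lambda>A. of_bool (?P A))"
    proof (rule mult_left_mono[OF _ assms(3)])
      have "expec p (E - {e}) (\<lambda>A. of_bool (?P (insert e A)))
          \<le> expec p (E - {e}) (\<lambda>A. of_bool (?P A))"
      proof (rule expec_mono[OF assms(3,4)])
        fix A assume "A \<subseteq> E - {e}"
        then have "e \<notin> A" by auto
        then have "?P (insert e A) \<Longrightarrow> ?P A"
          using insert(2) insert(5)[of e A] by auto
        then show "of_bool (?P (insert e A)) \<le> (of_bool (?P A) :: real)" by (simp add: of_bool_def)
      qed
      then have "(1 - p) * expec p (E - {e}) (\<lambda>A. of_bool (?P (insert e A)))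
          \<le> (1 - p) * expec p (E - {e}) (\<lambda>A. of_bool (?P A))"
        using assms by (intro mult_left_mono) auto
      then show "expec p (E - {e}) (\<lambda>A. of_bool (?P (insert e A))) \<le> expec p E (\<lambda>A. of_bool (?P A))"
        unfolding expec_split[OF assms(1) e, of p "\<lambda>A. of_bool (?P A)"]
        by (simp add: algebra_simps)
    qed
    also have "\<dots> \<le> p * (p ^ card Y * expec p E (\<lambda>A. of_bool (Q A)))"
      using insert assms by (intro mult_left_mono insert.IH) auto
    finally show ?case using insert by simp
  qed
qed

text \<open>Independence: \<open>Q\<close> ignores the elements of \<open>Y\<close>, so in the
  previous argument both branches agree.\<close>

lemma expec_superset_eq:
  assumes "finite E" "Y \<subseteq> E"
    and "\<And>e A. e \<in> Y \<Longrightarrow> Q (insert e A) \<longleftrightarrow> Q A"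
  shows "expec p E (\<lambda>A. of_bool (Y \<subseteq> A \<and> Q A)) = p ^ card Y * expec p E (\<lambda>A. of_bool (Q A))"
proof -
  have fY: "finite Y" using assms finite_subset by blast
  from fY assms(2,3) show ?thesis
  proof (induction Y rule: finite_induct)
    case empty
    then show ?case by simp
  next
    case (insert e Y)
    let ?P = "\<lambda>A. Y \<subseteq> A \<and> Q A"
    have e: "e \<in> E" using insert by auto
    have P: "?P (insert e A) \<longleftrightarrow> ?P A" for A using insert by auto
    have "expec p E (\<lambda>A. of_bool (insert e Y \<subseteq> A \<and> Q A))
       = p * expec p (E - {e}) (\<lambda>A. of_bool (?P A))
        + (1 - p) * expec p (E - {e}) (\<lambda>A. 0)"
      unfolding expec_split[OF assms(1) e, of p "\<lambda>A. of_bool (insert e Y \<subseteq> A \<and> Q A)"]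
      by (intro arg_cong2[of _ _ _ _ "(+)"] arg_cong2[of _ _ _ _ "(*)"] refl expec_cong)
         (use P in auto)
    also have "\<dots> = p * expec p (E - {e}) (\<lambda>A. of_bool (?P A))"
      using assms by (simp add: expec_const)
    also have "\<dots> = p * expec p E (\<lambda>A. of_bool (?P A))"
      unfolding expec_split[OF assms(1) e, of p "\<lambda>A. of_bool (?P A)"] P
      by (simp add: algebra_simps)
    also have "\<dots> = p * (p ^ card Y * expec p E (\<lambda>A. of_bool (Q A)))"
      using insert by (intro arg_cong2[of _ _ _ _ "(*)"] refl insert.IH) auto
    finally show ?case using insert by simp
  qed
qed

lemma prob_random_graph:
  assumes "0 \<le> p" "p \<le> 1"
  shows "measure_pmf.prob (random_graph n p) {G. Q G}
    = expec p (nsets {1..n} 2) (\<lambda>A. of_bool (Q ({1..n}, A)))"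
proof -
  define E :: "nat set set" where "E = nsets {1..n} 2"
  have E: "finite E" unfolding E_def by (simp add: finite_imp_finite_nsets)
  let ?M = "Pi_pmf E False (\<lambda>_. bernoulli_pmf p)"
  let ?c = "\<lambda>A::nat set set. (\<lambda>e. e \<in> A)"
  let ?R = "{A\<in>Pow E. Q ({1..n}, A)}"
  have "measure_pmf.prob (random_graph n p) {G. Q G} = measure_pmf.prob ?M {f. Q ({1..n}, {e\<in>E. f e})}"
    by (simp add: random_graph_def complete_graph_def E_def vimage_def)
  \<comment> \<open>The two events differ only in functions that are true somewhere outside
    \<open>E\<close>, and these have mass 0.\<close>
  also have "\<dots> = measure_pmf.prob ?M (?c ` ?R)"
  proof (rule measure_prob_cong_0)
    fix f assume "f \<in> {f. Q ({1..n}, {e\<in>E. f e})} - ?c ` ?R"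
    then have f: "Q ({1..n}, {e\<in>E. f e})" "f \<notin> ?c ` ?R" by auto
    have "\<not> (\<forall>x. x \<notin> E \<longrightarrow> f x = False)"
    proof
      assume "\<forall>x. x \<notin> E \<longrightarrow> f x = False"
      then have "f = ?c {e\<in>E. f e}" by auto
      then show False using f by blast
    qed
    then show "pmf ?M f = 0" by (intro pmf_Pi_outside[OF E]) auto
  next
    fix f assume "f \<in> ?c ` ?R - {f. Q ({1..n}, {e\<in>E. f e})}"
    then obtain A where "A \<in> ?R" "f = ?c A" "\<not> Q ({1..n}, {e\<in>E. f e})" by auto
    moreover from this have "{e\<in>E. f e} = A" by auto
    ultimately show "pmf ?M f = 0" by auto
  qed
  also have "\<dots> = (\<Sum>f\<in>?c ` ?R. pmf ?M f)"
    using E by (intro measure_measure_pmf_finite) auto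
  also have "\<dots> = (\<Sum>A\<in>?R. pmf ?M (?c A))"
    by (intro sum.reindex_cong[of ?c]) (auto intro!: inj_onI simp: fun_eq_iff)
  also have "\<dots> = (\<Sum>A\<in>?R. p ^ card A * (1 - p) ^ card (E - A))"
  proof (rule sum.cong[OF refl])
    fix A assume "A \<in> ?R"
    then have A: "A \<subseteq> E" by auto
    have "pmf ?M (?c A) = (\<Prod>x\<in>E. pmf (bernoulli_pmf p) (x \<in> A))"
      using E A by (subst pmf_Pi') auto
    also have "\<dots> = (\<Prod>x\<in>E - A. pmf (bernoulli_pmf p) (x \<in> A)) * (\<Prod>x\<in>A. pmf (bernoulli_pmf p) (x \<in> A))"
      by (rule prod.subset_diff[OF A E])
    also have "\<dots> = (1 - p) ^ card (E - A) * p ^ card A"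
      using assms by simp
    finally show "pmf ?M (?c A) = p ^ card A * (1 - p) ^ card (E - A)" by simp
  qed
  also have "\<dots> = expec p E (\<lambda>A. of_bool (Q ({1..n}, A)))"
    unfolding expec_def using E by (intro sum.mono_neutral_cong_left) auto
  finally show ?thesis unfolding E_def .
qed

section \<open>Avoiding up-sets: a two-sided Janson estimate\<close>

locale product_events =
  fixes p :: real and E :: "'e set" and X :: "'i \<Rightarrow> 'e set" and I :: "'i set"
  assumes fin_E: "finite E" and fin_I: "finite I"
    and p_nonneg: "0 \<le> p" and p_le_1: "p \<le> 1"
    and X_subset: "i \<in> I \<Longrightarrow> X i \<subseteq> E"
begin

text \<open>The forced set \<open>Y\<close> is a parameter so that inclusion-exclusion over
  \<open>J\<close> stays within this family, as in \<open>avoid_insert\<close>.\<close>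

definition avoid :: "'e set \<Rightarrow> 'i set \<Rightarrow> real" where
  "avoid Y J = expec p E (\<lambda>A. of_bool (Y \<subseteq> A \<and> (\<forall>j\<in>J. \<not> X j \<subseteq> A)))"

definition pr1 :: "'i \<Rightarrow> real" where "pr1 i = p ^ card (X i)"
definition pr2 :: "'i \<Rightarrow> 'i \<Rightarrow> real" where "pr2 i j = p ^ card (X i \<union> X j)"
definition pr3 :: "'i \<Rightarrow> 'i \<Rightarrow> 'i \<Rightarrow> real" where "pr3 i j k = p ^ card (X i \<union> X j \<union> X k)"

definition meets :: "'i \<Rightarrow> 'i \<Rightarrow> bool" where
  "meets i j \<longleftrightarrow> i \<noteq> j \<and> X i \<inter> X j \<noteq> {}"

text \<open>Paths with centre \<open>j\<close> in the dependency graph \<open>meets\<close>; whether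
  the ends \<open>i\<close> and \<open>k\<close> meet each other is left open.\<close>

definition chain3 :: "'i \<Rightarrow> 'i \<Rightarrow> 'i \<Rightarrow> real" where
  "chain3 i j k = of_bool (meets i j \<and> meets j k \<and> i \<noteq> k) * pr3 i j k"

lemma fin_X: "i \<in> I \<Longrightarrow> finite (X i)"
  using X_subset fin_E finite_subset by blast

lemma pr_nonneg [simp]: "0 \<le> pr1 i" "0 \<le> pr2 i j" "0 \<le> pr3 i j k" "0 \<le> chain3 i j k"
  using p_nonneg by (auto simp: pr1_def pr2_def pr3_def chain3_def)

lemma meets_commute: "meets i j = meets j i"
  by (auto simp: meets_def)

lemma pr2_commute: "pr2 i j = pr2 j i"
  by (simp add: pr2_def Un_commute)

lemma pr2_not_meets:
  assumes "i \<in> I" "j \<in> I" "i \<noteq> j" "\<not> meets i j"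
  shows "pr2 i j = pr1 i * pr1 j"
  using assms fin_X by (auto simp: meets_def pr1_def pr2_def card_Un_disjoint power_add)

lemma power_card_mono_union:
  assumes "finite A" "finite B"
  shows "p ^ card A * p ^ card B \<le> p ^ card (A \<union> B)"
proof -
  have "p ^ (card A + card B) \<le> p ^ card (A \<union> B)"
    using p_nonneg p_le_1 card_Un_le by (intro power_decreasing) auto
  then show ?thesis by (simp add: power_add)
qed

lemma pr1_pr2_le: "i \<in> I \<Longrightarrow> j \<in> I \<Longrightarrow> k \<in> I \<Longrightarrow> pr1 i * pr2 j k \<le> pr3 i j k"
  using power_card_mono_union[of "X i" "X j \<union> X k"] fin_X
  by (auto simp: pr1_def pr2_def pr3_def Un_assoc)

section \<open>Correlation and Bonferroni inequalities for avoidance probabilities\<close>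

lemma avoid_nonneg: "0 \<le> avoid Y J"
  unfolding avoid_def using p_nonneg p_le_1 by (intro expec_nonneg) auto

lemma avoid_mono: "K \<subseteq> J \<Longrightarrow> avoid Y J \<le> avoid Y K"
  unfolding avoid_def using p_nonneg p_le_1 by (intro expec_mono) (auto simp: of_bool_def)

lemma avoid_empty: "avoid {} {} = 1"
  unfolding avoid_def using fin_E by (simp add: expec_const)

lemma avoid_insert: "avoid Y (insert k J) = avoid Y J - avoid (Y \<union> X k) J"
  unfolding avoid_def expec_diff[symmetric] by (intro expec_cong) auto

text \<open>Harris' inequality: avoidance is a decreasing event, and only elements of
  \<open>Z\<close> not yet forced cost a factor \<open>p\<close>.\<close>

lemma avoid_Un_le:
  assumes "Z \<subseteq> E"
  shows "avoid (Y \<union> Z) J \<le> p ^ card (Z - Y) * avoid Y J"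
proof -
  have "avoid (Y \<union> Z) J
      = expec p E (\<lambda>A. of_bool (Z - Y \<subseteq> A \<and> (Y \<subseteq> A \<and> (\<forall>j\<in>J. \<not> X j \<subseteq> A))))"
    unfolding avoid_def by (intro expec_cong arg_cong[of _ _ of_bool]) auto
  also have "\<dots> \<le> p ^ card (Z - Y) * avoid Y J"
    unfolding avoid_def using assms p_nonneg p_le_1 fin_E by (intro expec_superset_le) auto
  finally show ?thesis .
qed

lemma avoid_Un_eq:
  assumes "Z \<subseteq> E" "\<And>j. j \<in> J \<Longrightarrow> X j \<inter> Z = {}"
  shows "avoid (Y \<union> Z) J = p ^ card (Z - Y) * avoid Y J"
proof -
  have "avoid (Y \<union> Z) J
      = expec p E (\<lambda>A. of_bool (Z - Y \<subseteq> A \<and> (Y \<subseteq> A \<and> (\<forall>j\<in>J. \<not> X j \<subseteq> A))))"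
    unfolding avoid_def by (intro expec_cong arg_cong[of _ _ of_bool]) auto
  also have "\<dots> = p ^ card (Z - Y) * avoid Y J"
    unfolding avoid_def
  proof (rule expec_superset_eq[OF fin_E])
    show "Z - Y \<subseteq> E" using assms by auto
    fix e A assume e: "e \<in> Z - Y"
    then have "X j \<subseteq> insert e A \<longleftrightarrow> X j \<subseteq> A" if "j \<in> J" for j
      using assms(2)[OF that] by auto
    then show "(Y \<subseteq> insert e A \<and> (\<forall>j\<in>J. \<not> X j \<subseteq> insert e A)) \<longleftrightarrow> (Y \<subseteq> A \<and> (\<forall>j\<in>J. \<not> X j \<subseteq> A))"
      using e by auto
  qed
  finally show ?thesis .
qed

lemma avoid_le: "Z \<subseteq> E \<Longrightarrow> avoid Z J \<le> p ^ card Z * avoid {} J"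
  using avoid_Un_le[of Z "{}" J] by simp

lemma avoid_eq: "Z \<subseteq> E \<Longrightarrow> (\<And>j. j \<in> J \<Longrightarrow> X j \<inter> Z = {}) \<Longrightarrow> avoid Z J = p ^ card Z * avoid {} J"
  using avoid_Un_eq[of Z J "{}"] by simp

lemma avoid_union_bound:
  assumes "finite D"
  shows "avoid Y K - (\<Sum>j\<in>D. avoid (Y \<union> X j) K) \<le> avoid Y (K \<union> D)"
  using assms
proof (induction D rule: finite_induct)
  case (insert d D)
  have "avoid (Y \<union> X d) (K \<union> D) \<le> avoid (Y \<union> X d) K" by (intro avoid_mono) auto
  with insert show ?case by (simp add: avoid_insert)
qed simp

text \<open>Adding \<open>d\<close> removes a term that the union bound estimates from below. The
  double sum runs over ordered pairs and so counts each pair twice; this is harmless, since it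
  enters only the error.\<close>

lemma avoid_bonferroni:
  assumes "finite D"
  shows "avoid Y (K \<union> D) \<le> avoid Y K - (\<Sum>j\<in>D. avoid (Y \<union> X j) K)
    + (\<Sum>j\<in>D. \<Sum>k\<in>D. of_bool (j \<noteq> k) * avoid (Y \<union> X j \<union> X k) K)"
  using assms
proof (induction D rule: finite_induct)
  case (insert d D)
  let ?g = "\<lambda>j k. of_bool (j \<noteq> k) * avoid (Y \<union> X j \<union> X k) K"
  have "avoid (Y \<union> X d) K - (\<Sum>j\<in>D. avoid (Y \<union> X d \<union> X j) K) \<le> avoid (Y \<union> X d) (K \<union> D)"
    by (rule avoid_union_bound) fact
  moreover have "(\<Sum>j\<in>D. avoid (Y \<union> X d \<union> X j) K) = (\<Sum>k\<in>D. ?g d k)"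
    using insert by (intro sum.cong) auto
  moreover have "(\<Sum>j\<in>D. \<Sum>k\<in>D. ?g j k) + (\<Sum>k\<in>D. ?g d k) \<le> (\<Sum>j\<in>insert d D. \<Sum>k\<in>insert d D. ?g j k)"
    using insert by (simp add: sum.distrib sum_nonneg avoid_nonneg del: sum_of_bool_mult_eq)
  ultimately show ?case using insert by (simp add: avoid_insert)
qed simp

text \<open>A converse to \<open>avoid_le\<close>. Events of \<open>K\<close> that do not meet
  \<open>X j\<close> are disjoint from \<open>Z\<close>, hence independent of it; the remaining ones
  are paid for by the union bound.\<close>

lemma avoid_ge_of_few_meets:
  assumes "finite K" "K \<subseteq> I" "Z \<subseteq> E" "j \<in> I" "X j \<subseteq> Z"
    and "\<And>k. k \<in> K \<Longrightarrow> X k \<inter> (Z - X j) = {}" "\<And>k. k \<in> K \<Longrightarrow> k \<noteq> j"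
  shows "(p ^ card Z - (\<Sum>k\<in>K. of_bool (meets j k) * p ^ card (Z \<union> X k))) * avoid {} K \<le> avoid Z K"
    (is "(_ - ?S) * _ \<le> _")
proof -
  let ?K1 = "{k\<in>K. meets j k}"
  let ?K0 = "{k\<in>K. \<not> meets j k}"
  have K: "K = ?K0 \<union> ?K1" by auto
  have S: "?S = (\<Sum>k\<in>?K1. p ^ card (Z \<union> X k))"
    using assms(1) by (intro sum.mono_neutral_cong_right) auto
  have Z0: "X k \<inter> Z = {}" if "k \<in> ?K0" for k
    using that assms(6,7)[of k] by (auto simp: meets_def)
  have "avoid Z ?K0 - (\<Sum>k\<in>?K1. avoid (Z \<union> X k) ?K0) \<le> avoid Z K"
    using avoid_union_bound[of ?K1 Z ?K0] assms(1) K by simp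
  moreover have "avoid Z ?K0 = p ^ card Z * avoid {} ?K0"
    using Z0 assms by (intro avoid_eq) auto
  moreover have "(\<Sum>k\<in>?K1. avoid (Z \<union> X k) ?K0) \<le> ?S * avoid {} ?K0"
    unfolding S sum_distrib_right using assms X_subset by (intro sum_mono avoid_le) blast
  ultimately have 1: "(p ^ card Z - ?S) * avoid {} ?K0 \<le> avoid Z K"
    by (simp add: algebra_simps)
  have 2: "avoid {} K \<le> avoid {} ?K0" by (intro avoid_mono) auto
  \<comment> \<open>The bound is known with \<open>avoid {} ?K0\<close>, which is at least
    \<open>avoid {} K\<close>. Passing to the latter needs a nonnegative coefficient; with a
    negative one the claim is trivial.\<close>
  show ?thesis
  proof (cases "0 \<le> p ^ card Z - ?S")
    case True
    then show ?thesis using 1 2 mult_left_mono order_trans by blast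
  next
    case False
    then show ?thesis using avoid_nonneg[of Z K] avoid_nonneg[of "{}" K]
      by (meson linear mult_nonpos_nonneg order_trans)
  qed
qed

text \<open>\<open>\<rho>\<close> is the conditional probability of event \<open>i\<close> when all
  events of \<open>J\<close> fail. With \<open>J\<close> split into the events \<open>D\<close>
  meeting \<open>i\<close> and the rest \<open>K\<close>, of which event \<open>i\<close> is
  independent, numerator and denominator are both compared with \<open>avoid {} K\<close>. This
  gives a linear equation for \<open>\<rho>\<close> with leading part \<open>m\<close>.\<close>

lemma step_bounds:
  assumes J: "J \<subseteq> I" and i: "i \<in> I" "i \<notin> J" and pos: "0 < avoid {} J"
  defines "m \<equiv> pr1 i - (\<Sum>j\<in>J. pr2 i j - pr1 i * pr1 j)"
    and "t \<equiv> 2 * (\<Sum>j\<in>J. \<Sum>k\<in>J. chain3 i j k) + 2 * (\<Sum>j\<in>J. \<Sum>k\<in>J. chain3 j i k)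
      + (\<Sum>j\<in>J. of_bool (meets i j) * (pr2 i j * pr1 j))"
    and "\<rho> \<equiv> avoid (X i) J / avoid {} J"
  shows "0 \<le> \<rho>" "\<rho> \<le> pr1 i" "\<rho> \<le> m + t" "m - t \<le> \<rho>"
proof -
  define D where "D = {j\<in>J. meets i j}"
  define K where "K = {j\<in>J. \<not> meets i j}"
  have fJ: "finite J" using J fin_I finite_subset by blast
  have fin: "finite D" "finite K" and JKD: "J = K \<union> D" and sub: "D \<subseteq> J" "K \<subseteq> J"
    using fJ by (auto simp: D_def K_def)
  have I: "j \<in> I" if "j \<in> J" for j using that J by auto
  define N B g where "N = avoid {} J" and "B = avoid {} K" and "g = avoid (X i) J"
  have NB: "N \<le> B" unfolding N_def B_def using sub by (rule_tac avoid_mono)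
  have Npos: "0 < N" and Bpos: "0 < B" using pos NB by (auto simp: N_def)
  have XE: "X i \<subseteq> E" using i X_subset by auto
  have iK: "avoid (X i) K = pr1 i * B"
    unfolding pr1_def B_def using XE i by (intro avoid_eq) (auto simp: K_def meets_def)
  define S1 where "S1 = (\<Sum>j\<in>D. pr2 i j)"
  define S0 where "S0 = (\<Sum>j\<in>D. pr1 j)"
  define R where "R = (\<Sum>j\<in>D. \<Sum>k\<in>K. chain3 i j k)"
  define Q where "Q = (\<Sum>j\<in>D. \<Sum>k\<in>D. chain3 j i k)"
  define W where "W = (\<Sum>j\<in>D. pr2 i j * pr1 j)"
  have nn: "0 \<le> S1" "0 \<le> S0" "0 \<le> R" "0 \<le> Q" "0 \<le> W"
    by (auto simp: S1_def S0_def R_def Q_def W_def intro!: sum_nonneg)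
  have c1: "g \<le> pr1 i * N"
    unfolding g_def N_def pr1_def using XE by (rule avoid_le)
  have pair: "avoid (X i \<union> X j) K \<le> pr2 i j * B" if "j \<in> D" for j
    unfolding pr2_def B_def using that XE X_subset I sub by (intro avoid_le) blast
  have c2: "pr1 i * B - g \<le> S1 * B"
  proof -
    have "pr1 i * B - (\<Sum>j\<in>D. avoid (X i \<union> X j) K) \<le> g"
      using avoid_union_bound[OF fin(1), of "X i" K] by (simp add: iK g_def JKD)
    moreover have "(\<Sum>j\<in>D. avoid (X i \<union> X j) K) \<le> S1 * B"
      unfolding S1_def sum_distrib_right using pair by (rule sum_mono)
    ultimately show ?thesis by linarith
  qed
  \<comment> \<open>The pair terms of Bonferroni are chains centred at \<open>i\<close>
    (\<open>Q\<close>); the loss in the single terms consists of chains \<open>i\<close>,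
    \<open>j\<close>, \<open>k\<close> that leave the neighbourhood of \<open>i\<close>
    (\<open>R\<close>).\<close>
  have c3: "(S1 - R - Q) * B \<le> pr1 i * B - g"
  proof -
    have "g \<le> pr1 i * B - (\<Sum>j\<in>D. avoid (X i \<union> X j) K)
        + (\<Sum>j\<in>D. \<Sum>k\<in>D. of_bool (j \<noteq> k) * avoid (X i \<union> X j \<union> X k) K)"
      using avoid_bonferroni[OF fin(1), of "X i" K] by (simp add: iK g_def JKD)
    moreover have "(\<Sum>j\<in>D. \<Sum>k\<in>D. of_bool (j \<noteq> k) * avoid (X i \<union> X j \<union> X k) K) \<le> Q * B"
      unfolding Q_def sum_distrib_right
    proof (intro sum_mono)
      fix j k assume jk: "j \<in> D" "k \<in> D"
      have "avoid (X i \<union> X j \<union> X k) K \<le> pr3 j i k * B"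
        unfolding pr3_def B_def Un_commute[of "X j"] using jk XE X_subset I sub
        by (intro avoid_le) blast
      then show "of_bool (j \<noteq> k) * avoid (X i \<union> X j \<union> X k) K \<le> chain3 j i k * B"
        using jk by (auto simp: chain3_def D_def meets_commute)
    qed
    moreover have "(S1 - R) * B \<le> (\<Sum>j\<in>D. avoid (X i \<union> X j) K)"
      unfolding S1_def R_def sum_subtractf[symmetric] sum_distrib_right
    proof (rule sum_mono)
      fix j assume j: "j \<in> D"
      have "(p ^ card (X i \<union> X j) - (\<Sum>k\<in>K. of_bool (meets j k) * p ^ card (X i \<union> X j \<union> X k))) * avoid {} K
          \<le> avoid (X i \<union> X j) K"
        using j i sub J XE X_subset fin i
        by (intro avoid_ge_of_few_meets) (auto simp: D_def K_def meets_def)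
      also have "(\<Sum>k\<in>K. of_bool (meets j k) * p ^ card (X i \<union> X j \<union> X k)) = (\<Sum>k\<in>K. chain3 i j k)"
        using j i sub by (intro sum.cong) (auto simp: chain3_def pr3_def D_def K_def)
      finally show "(pr2 i j - (\<Sum>k\<in>K. chain3 i j k)) * B \<le> avoid (X i \<union> X j) K"
        by (simp add: pr2_def B_def)
    qed
    ultimately show ?thesis by (simp add: algebra_simps)
  qed
  have c4: "B - N \<le> S0 * B"
  proof -
    have "B - (\<Sum>j\<in>D. avoid (X j) K) \<le> N"
      using avoid_union_bound[OF fin(1), of "{}" K] by (simp add: N_def B_def JKD)
    moreover have "(\<Sum>j\<in>D. avoid (X j) K) \<le> S0 * B"
      unfolding S0_def sum_distrib_right pr1_def B_def using I sub X_subset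
      by (intro sum_mono avoid_le) blast
    ultimately show ?thesis by linarith
  qed
  \<comment> \<open>The denominator is estimated only after multiplication by \<open>pr1 i\<close>:
    then \<open>pr1_pr2_le\<close> turns its pair terms into triples containing
    \<open>i\<close>.\<close>
  have c5: "(pr1 i * S0 - R - Q) * B \<le> pr1 i * (B - N)"
  proof -
    have "N \<le> B - (\<Sum>j\<in>D. avoid (X j) K)
        + (\<Sum>j\<in>D. \<Sum>k\<in>D. of_bool (j \<noteq> k) * avoid (X j \<union> X k) K)"
      using avoid_bonferroni[OF fin(1), of "{}" K] by (simp add: N_def B_def JKD)
    then have 1: "pr1 i * (\<Sum>j\<in>D. avoid (X j) K)
        \<le> pr1 i * (B - N + (\<Sum>j\<in>D. \<Sum>k\<in>D. of_bool (j \<noteq> k) * avoid (X j \<union> X k) K))"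
      by (intro mult_left_mono) auto
    have 2: "pr1 i * (\<Sum>j\<in>D. \<Sum>k\<in>D. of_bool (j \<noteq> k) * avoid (X j \<union> X k) K) \<le> Q * B"
      unfolding Q_def sum_distrib_right sum_distrib_left
    proof (intro sum_mono)
      fix j k assume jk: "j \<in> D" "k \<in> D"
      have "avoid (X j \<union> X k) K \<le> pr2 j k * B"
        unfolding pr2_def B_def using jk XE X_subset I sub
        by (intro avoid_le) blast
      then have "pr1 i * avoid (X j \<union> X k) K \<le> pr1 i * (pr2 j k * B)"
        by (intro mult_left_mono) auto
      also have "\<dots> \<le> pr3 i j k * B"
        using pr1_pr2_le[of i j k] jk I i sub Bpos by (auto simp: mult.assoc[symmetric] intro!: mult_right_mono)
      finally have "pr1 i * avoid (X j \<union> X k) K \<le> pr3 j i k * B"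
        by (simp add: pr3_def Un_commute[of "X i"])
      then show "pr1 i * (of_bool (j \<noteq> k) * avoid (X j \<union> X k) K) \<le> chain3 j i k * B"
        using jk by (auto simp: chain3_def D_def meets_commute)
    qed
    have 3: "(pr1 i * S0 - R) * B \<le> pr1 i * (\<Sum>j\<in>D. avoid (X j) K)"
      unfolding S0_def R_def sum_subtractf[symmetric] sum_distrib_right sum_distrib_left
    proof (rule sum_mono)
      fix j assume j: "j \<in> D"
      have "(p ^ card (X j) - (\<Sum>k\<in>K. of_bool (meets j k) * p ^ card (X j \<union> X k))) * avoid {} K
          \<le> avoid (X j) K"
        using j i sub J XE X_subset fin i
        by (intro avoid_ge_of_few_meets) (auto simp: D_def K_def meets_def)
      then have 4: "pr1 i * ((pr1 j - (\<Sum>k\<in>K. of_bool (meets j k) * pr2 j k)) * B) \<le> pr1 i * avoid (X j) K"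
        unfolding pr1_def[of j] pr2_def B_def by (rule mult_left_mono) simp
      have "pr1 i * (\<Sum>k\<in>K. of_bool (meets j k) * pr2 j k) \<le> (\<Sum>k\<in>K. chain3 i j k)"
        unfolding sum_distrib_left
      proof (rule sum_mono)
        fix k assume k: "k \<in> K"
        then have "pr1 i * pr2 j k \<le> pr3 i j k"
          using pr1_pr2_le[of i j k] j I i sub by auto
        moreover have "i \<noteq> k" "meets i j" using k i j sub by (auto simp: D_def)
        ultimately show "pr1 i * (of_bool (meets j k) * pr2 j k) \<le> chain3 i j k"
          by (auto simp: chain3_def)
      qed
      then have "(pr1 i * pr1 j - (\<Sum>k\<in>K. chain3 i j k)) * B
         \<le> (pr1 i * pr1 j - pr1 i * (\<Sum>k\<in>K. of_bool (meets j k) * pr2 j k)) * B"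
        using Bpos by (intro mult_right_mono) auto
      also have "\<dots> = pr1 i * ((pr1 j - (\<Sum>k\<in>K. of_bool (meets j k) * pr2 j k)) * B)"
        by (simp add: algebra_simps)
      finally show "(pr1 i * pr1 j - (\<Sum>k\<in>K. chain3 i j k)) * B \<le> pr1 i * avoid (X j) K"
        using 4 by linarith
    qed
    from 1 2 3 show ?thesis by (simp add: algebra_simps)
  qed
  \<comment> \<open>In the product of the two first-order sums the diagonal is \<open>W\<close>, and
    every other term is bounded by a chain centred at \<open>i\<close>.\<close>
  have c6: "S1 * S0 \<le> W + Q"
  proof -
    have "S1 * S0 = (\<Sum>j\<in>D. \<Sum>k\<in>D. pr2 i j * pr1 k)"
      by (simp add: S1_def S0_def sum_product)
    also have "\<dots> \<le> (\<Sum>j\<in>D. \<Sum>k\<in>D. of_bool (k = j) * (pr2 i j * pr1 k) + chain3 j i k)"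
    proof (intro sum_mono)
      fix j k assume jk: "j \<in> D" "k \<in> D"
      have "pr1 k * pr2 i j \<le> pr3 k i j" using pr1_pr2_le[of k i j] jk I i sub by auto
      then have "pr2 i j * pr1 k \<le> pr3 j i k" by (simp add: pr3_def Un_ac mult.commute)
      then show "pr2 i j * pr1 k \<le> of_bool (k = j) * (pr2 i j * pr1 k) + chain3 j i k"
        using jk by (auto simp: chain3_def D_def meets_commute)
    qed
    also have "\<dots> = W + Q"
      using fin by (simp add: sum.distrib W_def Q_def)
    finally show ?thesis .
  qed
  define x where "x = (B - N) / B"
  define u where "u = (pr1 i * B - g) / B"
  have x: "0 \<le> x" "x \<le> S0" "pr1 i * S0 - R - Q \<le> pr1 i * x"
    using c4 c5 NB Bpos by (auto simp: x_def pos_divide_le_eq pos_le_divide_eq)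
  have u: "S1 - R - Q \<le> u" "u \<le> S1"
    using c2 c3 Bpos by (auto simp: u_def pos_divide_le_eq pos_le_divide_eq)
  have \<rho>g: "\<rho> = g / N" by (simp add: \<rho>_def g_def N_def)
  show r0: "0 \<le> \<rho>" using Npos by (simp add: \<rho>g g_def avoid_nonneg)
  show r1: "\<rho> \<le> pr1 i" using c1 Npos by (simp add: \<rho>g pos_divide_le_eq)
  \<comment> \<open>By definition g = (pr1 i - u) * B and N = (1 - x) * B, so the quotient satisfies
    \<rho> * (1 - x) = pr1 i - u.\<close>
  have rec: "\<rho> = pr1 i - u + \<rho> * x"
    using Npos Bpos by (simp add: \<rho>g u_def x_def field_simps)
  have m: "m = pr1 i - S1 + pr1 i * S0"
  proof -
    have "(\<Sum>j\<in>J. pr2 i j - pr1 i * pr1 j) = (\<Sum>j\<in>D. pr2 i j - pr1 i * pr1 j)"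
      using fJ sub i I by (intro sum.mono_neutral_right) (auto simp: D_def intro!: pr2_not_meets)
    then show ?thesis by (simp add: m_def S1_def S0_def sum_subtractf sum_distrib_left)
  qed
  have "(\<Sum>k\<in>K. chain3 i j k) \<le> (\<Sum>k\<in>J. chain3 i j k)" for j
    using fJ sub by (intro sum_mono2) auto
  then have "R \<le> (\<Sum>j\<in>D. \<Sum>k\<in>J. chain3 i j k)"
    unfolding R_def by (intro sum_mono)
  also have "\<dots> \<le> (\<Sum>j\<in>J. \<Sum>k\<in>J. chain3 i j k)"
    using fJ sub by (intro sum_mono2 sum_nonneg) auto
  finally have R: "R \<le> (\<Sum>j\<in>J. \<Sum>k\<in>J. chain3 i j k)" .
  have "(\<Sum>k\<in>D. chain3 j i k) \<le> (\<Sum>k\<in>J. chain3 j i k)" for j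
    using fJ sub by (intro sum_mono2) auto
  then have "Q \<le> (\<Sum>j\<in>D. \<Sum>k\<in>J. chain3 j i k)"
    unfolding Q_def by (intro sum_mono)
  also have "\<dots> \<le> (\<Sum>j\<in>J. \<Sum>k\<in>J. chain3 j i k)"
    using fJ sub by (intro sum_mono2 sum_nonneg) auto
  finally have Q: "Q \<le> (\<Sum>j\<in>J. \<Sum>k\<in>J. chain3 j i k)" .
  have W: "W = (\<Sum>j\<in>J. of_bool (meets i j) * (pr2 i j * pr1 j))"
    unfolding W_def using fJ sub by (intro sum.mono_neutral_cong_left) (auto simp: D_def)
  have t: "2 * R + 2 * Q + W \<le> t"
    using R Q W by (simp add: t_def)
  have "\<rho> * x \<le> pr1 i * x" using r1 x by (intro mult_right_mono)
  also have "\<dots> \<le> pr1 i * S0" using x by (intro mult_left_mono) auto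
  finally show "\<rho> \<le> m + t" using rec u m t nn by linarith
  \<comment> \<open>The recursion is inserted into itself: \<rho> * x is nonnegative, so \<rho>
    \<ge> pr1 i - u, and the product term is at least pr1 i * x - u * x.\<close>
  have "(pr1 i - u) * x \<le> \<rho> * x" using rec x mult_nonneg_nonneg[OF r0 x(1)]
    by (intro mult_right_mono) linarith+
  moreover have "u * x \<le> S1 * S0" using u x nn by (meson mult_mono order_trans mult_left_mono mult_right_mono)
  ultimately show "m - t \<le> \<rho>" using rec u m t nn c6 x by (simp add: left_diff_distrib)
qed

text \<open>The first two terms of the cumulant expansion of minus the logarithm of the avoidance
  probability. The factor 1/2 compensates for ordered pairs.\<close>

definition main_term :: "'i set \<Rightarrow> real" where
  "main_term J = (\<Sum>i\<in>J. pr1 i)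
    - (\<Sum>i\<in>J. \<Sum>j\<in>J. of_bool (i \<noteq> j) * (pr2 i j - pr1 i * pr1 j)) / 2"

definition error_term :: "'i set \<Rightarrow> real" where
  "error_term J = 2 * (\<Sum>i\<in>J. \<Sum>j\<in>J. \<Sum>k\<in>J. chain3 i j k)
    + (\<Sum>i\<in>J. \<Sum>j\<in>J. of_bool (meets i j) * (pr2 i j * pr1 j)) + 2 * (\<Sum>i\<in>J. (pr1 i)\<^sup>2)"

text \<open>By the chain rule the avoidance probability is a product of factors 1 - \<rho>, each
  estimated by \<open>step_bounds\<close>. The bound 1/2 gives ln (1 - \<rho>) \<ge> - \<rho> - 2 *
  \<rho>^2, the source of the squares in \<open>error_term\<close>.\<close>

theorem avoid_estimate:
  assumes "J \<subseteq> I" "\<And>i. i \<in> J \<Longrightarrow> pr1 i \<le> 1 / 2"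
  shows "exp (- main_term J - error_term J) \<le> avoid {} J \<and> avoid {} J \<le> exp (- main_term J + error_term J)"
proof -
  have "finite J" using assms(1) fin_I finite_subset by blast
  then show ?thesis using assms
  proof (induction J rule: finite_induct)
    case empty
    then show ?case by (simp add: main_term_def error_term_def avoid_empty)
  next
    case (insert i J)
    have i: "i \<in> I" "i \<notin> J" and J: "J \<subseteq> I" and fJ: "finite J" and half: "pr1 i \<le> 1 / 2"
      using insert by auto
    have IH: "exp (- main_term J - error_term J) \<le> avoid {} J" "avoid {} J \<le> exp (- main_term J + error_term J)"
      using insert by auto
    have pos: "0 < avoid {} J" using IH(1) by (meson exp_gt_zero less_le_trans)
    define m where "m = pr1 i - (\<Sum>j\<in>J. pr2 i j - pr1 i * pr1 j)"
    define t where "t = 2 * (\<Sum>j\<in>J. \<Sum>k\<in>J. chain3 i j k) + 2 * (\<Sum>j\<in>J. \<Sum>k\<in>J. chain3 j i k)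
      + (\<Sum>j\<in>J. of_bool (meets i j) * (pr2 i j * pr1 j))"
    define \<rho> where "\<rho> = avoid (X i) J / avoid {} J"
    have \<rho>: "0 \<le> \<rho>" "\<rho> \<le> pr1 i" "\<rho> \<le> m + t" "m - t \<le> \<rho>"
      using step_bounds[OF J i pos] by (auto simp: m_def t_def \<rho>_def)
    have eq: "avoid {} (insert i J) = avoid {} J * (1 - \<rho>)"
      using pos by (simp add: avoid_insert \<rho>_def right_diff_distrib)
    have main: "main_term (insert i J) = main_term J + m"
    proof -
      let ?g = "\<lambda>i j. of_bool (i \<noteq> j) * (pr2 i j - pr1 i * pr1 j)"
      have 1: "(\<Sum>j\<in>J. ?g i j) = (\<Sum>j\<in>J. pr2 i j - pr1 i * pr1 j)"
        using i by (intro sum.cong) auto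
      have 2: "(\<Sum>j\<in>J. ?g j i) = (\<Sum>j\<in>J. pr2 i j - pr1 i * pr1 j)"
        using i by (intro sum.cong) (auto simp: pr2_commute)
      have "(\<Sum>a\<in>insert i J. \<Sum>b\<in>insert i J. ?g a b)
          = (\<Sum>a\<in>J. \<Sum>b\<in>J. ?g a b) + 2 * (\<Sum>j\<in>J. pr2 i j - pr1 i * pr1 j)"
        using i fJ by (simp only: sum.insert sum.distrib 1 2 finite_insert not_False_eq_True) simp
      then show ?thesis using i fJ by (simp add: main_term_def m_def add_divide_distrib)
    qed
    \<comment> \<open>Of the new chains only those with \<open>i\<close> in first or middle position
      are charged, which is exactly what \<open>t\<close> contains; the others are slack.\<close>
    have err: "error_term J + t + 2 * (pr1 i)\<^sup>2 \<le> error_term (insert i J)"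
    proof -
      have "(\<Sum>a\<in>J. \<Sum>b\<in>J. \<Sum>c\<in>J. chain3 a b c) + (\<Sum>b\<in>J. \<Sum>c\<in>J. chain3 i b c) + (\<Sum>a\<in>J. \<Sum>c\<in>J. chain3 a i c)
          \<le> (\<Sum>a\<in>insert i J. \<Sum>b\<in>insert i J. \<Sum>c\<in>insert i J. chain3 a b c)"
        using i fJ by (simp add: sum.distrib sum_nonneg add_nonneg_nonneg)
      moreover have "(\<Sum>a\<in>J. \<Sum>b\<in>J. of_bool (meets a b) * (pr2 a b * pr1 b))
          + (\<Sum>b\<in>J. of_bool (meets i b) * (pr2 i b * pr1 b))
          \<le> (\<Sum>a\<in>insert i J. \<Sum>b\<in>insert i J. of_bool (meets a b) * (pr2 a b * pr1 b))"
        using i fJ by (simp add: sum.distrib sum_nonneg add_nonneg_nonneg del: sum_of_bool_mult_eq)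
      ultimately show ?thesis using i fJ by (simp add: error_term_def t_def)
    qed
    have t0: "0 \<le> t" unfolding t_def by (intro add_nonneg_nonneg mult_nonneg_nonneg sum_nonneg) auto
    have "1 - \<rho> \<le> exp (- \<rho>)" using exp_ge_add_one_self[of "- \<rho>"] by simp
    also have "\<dots> \<le> exp (- m + t)" using \<rho> by simp
    finally have up: "1 - \<rho> \<le> exp (- m + t)" .
    have \<rho>2: "\<rho> \<le> 1 / 2" using \<rho> half by linarith
    have "\<rho>\<^sup>2 \<le> (pr1 i)\<^sup>2" using \<rho> by (intro power_mono) auto
    then have "exp (- m - t - 2 * (pr1 i)\<^sup>2) \<le> exp (- \<rho> - 2 * \<rho>\<^sup>2)"
      unfolding exp_le_cancel_iff using \<rho> by linarith
    also have "\<dots> \<le> exp (ln (1 - \<rho>))"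
      unfolding exp_le_cancel_iff using ln_one_minus_pos_lower_bound[of \<rho>] \<rho> \<rho>2 by simp
    also have "\<dots> = 1 - \<rho>" using \<rho>2 by simp
    finally have lo: "exp (- m - t - 2 * (pr1 i)\<^sup>2) \<le> 1 - \<rho>" .
    have "avoid {} (insert i J) \<le> exp (- main_term J + error_term J) * exp (- m + t)"
      unfolding eq using IH up \<rho>2 by (intro mult_mono) auto
    also have "\<dots> \<le> exp (- main_term (insert i J) + error_term (insert i J))"
      unfolding exp_add[symmetric] exp_le_cancel_iff main using err zero_le_power2[of "pr1 i"] by linarith
    finally have A: "avoid {} (insert i J) \<le> exp (- main_term (insert i J) + error_term (insert i J))" .
    have "exp (- main_term (insert i J) - error_term (insert i J))
        \<le> exp (- main_term J - error_term J) * exp (- m - t - 2 * (pr1 i)\<^sup>2)"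
      unfolding exp_add[symmetric] exp_le_cancel_iff main using err zero_le_power2[of "pr1 i"] by linarith
    also have "\<dots> \<le> avoid {} (insert i J)"
      unfolding eq using IH lo pos by (intro mult_mono) auto
    finally show ?case using A by blast
  qed
qed

end

section \<open>Conditioning on the cliques of the hypergraph\<close>

text \<open>Sharing two vertices is sharing a pair. Unlike \<open>meets\<close>, which sees only
  pairs outside \<open>F\<close>, this relation does not depend on \<open>F\<close>.\<close>

definition share_pair :: "'a set \<Rightarrow> 'a set \<Rightarrow> bool" where
  "share_pair i j \<longleftrightarrow> i \<noteq> j \<and> 2 \<le> card (i \<inter> j)"

text \<open>The conditional probability, given that \<open>F\<close> is present, that all three
  cliques of a chain centred at \<open>j\<close> appear. \<open>F\<close> is an argument because the
  same weight is later evaluated at the whole random edge set.\<close>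

definition triple_weight :: "real \<Rightarrow> 'a set set \<Rightarrow> 'a set \<Rightarrow> 'a set \<Rightarrow> 'a set \<Rightarrow> real" where
  "triple_weight p F i j k = of_bool (share_pair i j \<and> share_pair j k \<and> i \<noteq> k)
    * p ^ card (nsets i 2 \<union> nsets j 2 \<union> nsets k 2 - F)"

definition pair_weight :: "real \<Rightarrow> 'a set set \<Rightarrow> 'a set \<Rightarrow> 'a set \<Rightarrow> real" where
  "pair_weight p F i j = of_bool (share_pair i j) * p ^ card (nsets i 2 \<union> nsets j 2 - F)"

definition triple_sum :: "'a set \<Rightarrow> nat \<Rightarrow> real \<Rightarrow> 'a set set \<Rightarrow> real" where
  "triple_sum V r p F = (\<Sum>i\<in>nsets V r. \<Sum>j\<in>nsets V r. \<Sum>k\<in>nsets V r. triple_weight p F i j k)"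

definition pair_sum :: "'a set \<Rightarrow> nat \<Rightarrow> real \<Rightarrow> 'a set set \<Rightarrow> real" where
  "pair_sum V r p F = (\<Sum>i\<in>nsets V r. \<Sum>j\<in>nsets V r. pair_weight p F i j)"

definition single_sum :: "'a set \<Rightarrow> nat \<Rightarrow> real \<Rightarrow> 'a set set \<Rightarrow> real" where
  "single_sum V r p F = (\<Sum>i\<in>nsets V r. p ^ card (nsets i 2 - F))"

text \<open>The increase in the expected number of other \<open>r\<close>-cliques caused by one given \<open>r\<close>-clique.\<close>

definition kappa :: "nat \<Rightarrow> nat \<Rightarrow> real \<Rightarrow> real" where
  "kappa n r p = (\<Sum>s = 2..r - 1. real (r choose s) * real ((n - r) choose (r - s))
      * (p ^ ((r choose 2) - (s choose 2)) - p ^ (r choose 2)))"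

lemma share_pair_commute: "share_pair i j = share_pair j i"
  by (auto simp: share_pair_def Int_commute)

lemma nsets2_Int: "nsets i 2 \<inter> nsets j 2 = nsets (i \<inter> j) 2"
  by (auto simp: nsets_def)

lemma nsets2_disjoint:
  assumes "finite i" "card (i \<inter> j) < 2"
  shows "nsets i 2 \<inter> nsets j 2 = {}"
  unfolding nsets2_Int using assms by (intro nsets_eq_empty) auto

lemma choose_two_mono: "m \<le> n \<Longrightarrow> m choose 2 \<le> n choose 2"
  unfolding choose_two by (intro div_le_mono mult_le_mono) auto

lemma choose_two_pred:
  assumes "1 \<le> r" shows "(r choose 2) = (r - 1 choose 2) + (r - 1)"
  using assms by (cases r) (auto simp: numeral_2_eq_2)

text \<open>The extreme overlap is \<open>s = r - 1\<close>, where a clique still needs the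
  \<open>r - 1\<close> pairs at its one new vertex. This is the source of the factors
  \<open>p ^ (r - 1)\<close> below.\<close>

lemma choose_two_gap:
  assumes "s < r" shows "r - 1 + (s choose 2) \<le> r choose 2"
proof -
  have "s choose 2 \<le> r - 1 choose 2" using assms by (intro choose_two_mono) auto
  moreover have "r choose 2 = (r - 1 choose 2) + (r - 1)" using assms by (intro choose_two_pred) auto
  ultimately show ?thesis by linarith
qed

lemma card_Int_less:
  assumes "i \<in> nsets V r" "h \<in> nsets V r" "i \<noteq> h"
  shows "card (i \<inter> h) < r"
proof (rule ccontr)
  assume "\<not> ?thesis"
  then have c: "card h \<le> card (i \<inter> h)" "card i \<le> card (i \<inter> h)" using assms by (auto simp: nsets_def)
  have "i \<inter> h = h" by (rule card_seteq) (use c assms in \<open>auto simp: nsets_def\<close>)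
  moreover have "i \<inter> h = i" by (rule card_seteq) (use c assms in \<open>auto simp: nsets_def\<close>)
  ultimately show False using assms by auto
qed

lemma card_nsets_Int_eq:
  assumes "finite V" "h \<subseteq> V" "s \<le> r"
  shows "card {i\<in>nsets V r. card (i \<inter> h) = s} = (card h choose s) * ((card V - card h) choose (r - s))"
proof -
  have fh: "finite h" using assms finite_subset by blast
  have "bij_betw (\<lambda>(x, y). x \<union> y) (nsets h s \<times> nsets (V - h) (r - s)) {i\<in>nsets V r. card (i \<inter> h) = s}"
  proof (rule bij_betwI[where g = "\<lambda>i. (i \<inter> h, i - h)"])
    show "(\<lambda>(x, y). x \<union> y) \<in> nsets h s \<times> nsets (V - h) (r - s) \<rightarrow> {i\<in>nsets V r. card (i \<inter> h) = s}"
    proof clarsimp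
      fix x y assume x: "x \<in> nsets h s" and y: "y \<in> nsets (V - h) (r - s)"
      have "card (x \<union> y) = card x + card y"
        using x y by (intro card_Un_disjoint) (auto simp: nsets_def)
      moreover have "(x \<union> y) \<inter> h = x" using x y by (auto simp: nsets_def)
      ultimately show "x \<union> y \<in> nsets V r \<and> card ((x \<union> y) \<inter> h) = s"
        using x y assms by (auto simp: nsets_def)
    qed
    show "(\<lambda>i. (i \<inter> h, i - h)) \<in> {i\<in>nsets V r. card (i \<inter> h) = s} \<rightarrow> nsets h s \<times> nsets (V - h) (r - s)"
    proof clarsimp
      fix i assume i: "i \<in> nsets V r" and s: "s = card (i \<inter> h)"
      have "card (i - h) = card i - card (i \<inter> h)"
        using i by (intro card_Diff_subset_Int) (auto simp: nsets_def)
      then show "i \<inter> h \<in> nsets h (card (i \<inter> h)) \<and> i - h \<in> nsets (V - h) (r - card (i \<inter> h))"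
        using i by (auto simp: nsets_def)
    qed
  qed (auto simp: nsets_def)
  from bij_betw_same_card[OF this] show ?thesis
    using assms fh by (simp add: card_cartesian_product card_nsets card_Diff_subset)
qed

lemma card_nsets2_diff:
  assumes "finite i"
  shows "card (nsets i 2 - nsets h 2) = (card i choose 2) - (card (i \<inter> h) choose 2)"
proof -
  have "card (nsets i 2 - nsets h 2) = card (nsets i 2) - card (nsets i 2 \<inter> nsets h 2)"
    using assms by (intro card_Diff_subset_Int) (auto simp: finite_imp_finite_nsets)
  then show ?thesis by (simp add: nsets2_Int card_nsets)
qed

text \<open>Distinct \<open>r\<close>-sets overlap in at most \<open>r - 1\<close> vertices, and the
  summand depends only on the overlap size, so grouping by that size gives the terms of
  \<open>kappa\<close>.\<close>

lemma sum_excess_eq_kappa: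
  assumes "finite V" "h \<in> nsets V r"
  shows "(\<Sum>i\<in>nsets V r. of_bool (share_pair i h) * (p ^ card (nsets i 2 - nsets h 2) - p ^ (r choose 2)))
    = kappa (card V) r p"
proof -
  let ?N = "nsets V r"
  let ?S = "{i\<in>?N. share_pair i h}"
  let ?\<psi> = "\<lambda>i. p ^ card (nsets i 2 - nsets h 2) - p ^ (r choose 2)"
  have fN: "finite ?N" using assms by (simp add: finite_imp_finite_nsets)
  have h: "finite h" "card h = r" "h \<subseteq> V" using assms by (auto simp: nsets_def)
  have lt: "card (i \<inter> h) < r" if "i \<in> ?N" "i \<noteq> h" for i
    using card_Int_less that assms by blast
  have "(\<Sum>i\<in>?N. of_bool (share_pair i h) * ?\<psi> i) = (\<Sum>i\<in>?S. ?\<psi> i)"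
    using fN by (intro sum.mono_neutral_cong_right) auto
  also have "\<dots> = (\<Sum>s\<in>{2..r - 1}. \<Sum>i\<in>{i\<in>?S. card (i \<inter> h) = s}. ?\<psi> i)"
    using fN lt by (intro sum.group[symmetric]) (fastforce simp: share_pair_def)+
  also have "\<dots> = kappa (card V) r p"
    unfolding kappa_def
  proof (rule sum.cong[OF refl])
    fix s assume s: "s \<in> {2..r - 1}"
    have "{i\<in>?S. card (i \<inter> h) = s} = {i\<in>?N. card (i \<inter> h) = s}"
      using s h by (auto simp: share_pair_def)
    moreover have "?\<psi> i = p ^ ((r choose 2) - (s choose 2)) - p ^ (r choose 2)"
      if "i \<in> {i\<in>?N. card (i \<inter> h) = s}" for i
      using that card_nsets2_diff[of i h] by (auto simp: nsets_def)
    ultimately show "(\<Sum>i\<in>{i\<in>?S. card (i \<inter> h) = s}. ?\<psi> i) = real (r choose s) * real ((card V - r) choose (r - s))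
      * (p ^ ((r choose 2) - (s choose 2)) - p ^ (r choose 2))"
      using s h card_nsets_Int_eq[OF assms(1) h(3), of s r] by auto
  qed
  finally show ?thesis .
qed

text \<open>The covariance of two cliques is the probability of one times the conditional excess of
  the other. This identity is why the first-order shift caused by about \<open>mu n p r\<close>
  cliques is a multiple of \<open>Lambda\<close>.\<close>

lemma Lambda_eq_kappa:
  assumes "0 < p"
  shows "2 * Lambda n r p = mu n p r * kappa n r p"
  unfolding Lambda_def mu_def kappa_def sum_distrib_left
proof (simp, rule sum.cong[OF refl])
  fix s assume "s \<in> {2..r - Suc 0}"
  then have "s choose 2 \<le> r choose 2" by (intro choose_two_mono) auto
  then have "p ^ (2 * (r choose 2)) * (p powi (- int (s choose 2)) - 1)
      = p ^ (r choose 2) * (p ^ ((r choose 2) - (s choose 2)) - p ^ (r choose 2))"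
    using assms by (simp add: power_int_minus power_diff mult_2 power_add field_simps)
  then show "real (n choose r) * real (r choose s) * real ((n - r) choose (r - s))
        * p ^ (2 * (r choose 2)) * (p powi (- int (s choose 2)) - 1)
      = real (n choose r) * p ^ (r choose 2) * (real (r choose s) * real ((n - r) choose (r - s))
        * (p ^ ((r choose 2) - (s choose 2)) - p ^ (r choose 2)))"
    by (simp add: mult_ac)
qed

text \<open>An isomorphism is needed only for its edge count: an induced graph with as many edges as
  the complete graph contains every pair. Conversely any bijection of vertices works.\<close>

lemma clique_hypergraph_eq:
  assumes "finite V" "A \<subseteq> nsets V 2"
  shows "clique_hypergraph r (V, A) = (V, {S\<in>nsets V r. nsets S 2 \<subseteq> A})"
proof -
  have "isomorphic (induced (V, A) S) (complete_graph r) \<longleftrightarrow> nsets S 2 \<subseteq> A" if S: "S \<in> nsets V r" for S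
  proof
    have fS: "finite S" "card S = r" using S by (auto simp: nsets_def)
    {
      assume "isomorphic (induced (V, A) S) (complete_graph r)"
      then obtain f where f: "bij_betw f S {1..r}" "nsets {1..r} 2 = (\<lambda>e. f ` e) ` {e\<in>A. e \<subseteq> S}"
        by (auto simp: isomorphic_def induced_def complete_graph_def)
      have sub: "{e\<in>A. e \<subseteq> S} \<subseteq> nsets S 2" using assms by (auto simp: nsets_def)
      have fin: "finite (nsets S 2)" using fS by (simp add: finite_imp_finite_nsets)
      have "card (nsets S 2) = card (nsets {1..r} 2)" using fS by (simp add: card_nsets)
      also have "\<dots> \<le> card {e\<in>A. e \<subseteq> S}"
        unfolding f(2) using fin sub finite_subset by (intro card_image_le) blast
      finally have "{e\<in>A. e \<subseteq> S} = nsets S 2" by (intro card_seteq fin sub)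
      then show "nsets S 2 \<subseteq> A" by auto
    next
      assume sub: "nsets S 2 \<subseteq> A"
      obtain f where f: "bij_betw f S {1..r}"
        using fS finite_same_card_bij[of S "{1..r}"] by auto
      have "{e\<in>A. e \<subseteq> S} = nsets S 2" using sub assms by (auto simp: nsets_def)
      moreover have "nsets {1..r} 2 = (`) f ` nsets S 2"
        using bij_betw_nsets[OF f, of 2] by (simp add: bij_betw_def)
      ultimately show "isomorphic (induced (V, A) S) (complete_graph r)"
        using f by (auto simp: isomorphic_def induced_def complete_graph_def intro!: exI[of _ f])
    }
  qed
  then show ?thesis by (auto simp: clique_hypergraph_def)
qed

lemma edges_shadow_graph:
  assumes "uniform_hypergraph r H"
  shows "edges (shadow_graph H) = (\<Union>h\<in>edges H. nsets h 2)"
  using assms by (auto simp: shadow_graph_def uniform_hypergraph_def nsets_def)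

text \<open>\<open>closed\<close> holds because \<open>\<H>\<close> arises as a clique hypergraph:
  an \<open>r\<close>-set with all pairs covered is a member. Hence every event still to be avoided
  requires some pair outside \<open>F\<close>.\<close>

locale clique_config =
  fixes V :: "'a set" and r :: nat and p :: real and \<H> :: "'a set set" and F :: "'a set set"
  assumes fin_V: "finite V" and r_ge: "3 \<le> r" and p_pos: "0 < p" and p_le: "p \<le> 1 / 2"
    and H_sub: "\<H> \<subseteq> nsets V r"
    and F_eq: "F = (\<Union>h\<in>\<H>. nsets h 2)"
    and closed: "i \<in> nsets V r \<Longrightarrow> nsets i 2 \<subseteq> F \<Longrightarrow> i \<in> \<H>"
begin

abbreviation "N \<equiv> nsets V r"
abbreviation "J \<equiv> N - \<H>"
abbreviation "q \<equiv> p ^ (r choose 2)"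
abbreviation "tw \<equiv> triple_weight p F"
abbreviation "T \<equiv> triple_sum V r p F"
abbreviation "U1 \<equiv> single_sum V r p F"
abbreviation "U2 \<equiv> pair_sum V r p F"
abbreviation "\<kappa> \<equiv> kappa (card V) r p"
abbreviation "\<Lambda> \<equiv> Lambda (card V) r p"
abbreviation "\<mu> \<equiv> mu (card V) p r"

sublocale product_events p "nsets V 2" "\<lambda>i. nsets i 2 - F" J
  using fin_V p_pos p_le by unfold_locales (auto simp: finite_imp_finite_nsets nsets_def)

lemma fin_N: "finite N" using fin_V by (simp add: finite_imp_finite_nsets)

lemma fin_H: "finite \<H>" using fin_N H_sub finite_subset by blast

lemma N_D: "i \<in> N \<Longrightarrow> finite i" "i \<in> N \<Longrightarrow> card i = r" "i \<in> N \<Longrightarrow> i \<subseteq> V"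
  by (auto simp: nsets_def)

lemma fin_pairs: "i \<in> N \<Longrightarrow> finite (nsets i 2)"
  by (simp add: finite_imp_finite_nsets N_D)

lemma card_pairs: "i \<in> N \<Longrightarrow> card (nsets i 2) = r choose 2"
  by (simp add: card_nsets N_D)

lemma H_N: "h \<in> \<H> \<Longrightarrow> h \<in> N" using H_sub by auto

lemma H_F: "h \<in> \<H> \<Longrightarrow> nsets h 2 \<subseteq> F" using F_eq by auto

lemma pw_mono: "m \<le> k \<Longrightarrow> p ^ k \<le> p ^ m"
  using p_pos p_le by (intro power_decreasing) auto

lemma tw_nonneg: "0 \<le> tw i j k"
  using p_pos by (simp add: triple_weight_def)

lemma pw_nonneg: "0 \<le> pair_weight p F i j"
  using p_pos by (simp add: pair_weight_def)

lemma tw_sum_le: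
  assumes "A \<subseteq> N" "B \<subseteq> N" "C \<subseteq> N"
  shows "(\<Sum>i\<in>A. \<Sum>j\<in>B. \<Sum>k\<in>C. tw i j k) \<le> T"
proof -
  have 1: "(\<Sum>k\<in>C. tw i j k) \<le> (\<Sum>k\<in>N. tw i j k)" for i j
    using assms fin_N tw_nonneg by (intro sum_mono2) auto
  have "(\<Sum>j\<in>B. \<Sum>k\<in>C. tw i j k) \<le> (\<Sum>j\<in>B. \<Sum>k\<in>N. tw i j k)" for i
    by (intro sum_mono 1)
  also have "\<dots> i \<le> (\<Sum>j\<in>N. \<Sum>k\<in>N. tw i j k)" for i
    using assms fin_N tw_nonneg by (intro sum_mono2) (auto intro!: sum_nonneg)
  finally have 2: "(\<Sum>j\<in>B. \<Sum>k\<in>C. tw i j k) \<le> (\<Sum>j\<in>N. \<Sum>k\<in>N. tw i j k)" for i .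
  have "(\<Sum>i\<in>A. \<Sum>j\<in>B. \<Sum>k\<in>C. tw i j k) \<le> (\<Sum>i\<in>A. \<Sum>j\<in>N. \<Sum>k\<in>N. tw i j k)"
    by (intro sum_mono 2)
  also have "\<dots> \<le> T"
    unfolding triple_sum_def using assms fin_N tw_nonneg by (intro sum_mono2) (auto intro!: sum_nonneg)
  finally show ?thesis .
qed

lemma pair_sum_le:
  assumes "A \<subseteq> N" "B \<subseteq> N"
  shows "(\<Sum>i\<in>A. \<Sum>j\<in>B. pair_weight p F i j) \<le> U2"
proof -
  have 1: "(\<Sum>j\<in>B. pair_weight p F i j) \<le> (\<Sum>j\<in>N. pair_weight p F i j)" for i
    using assms fin_N pw_nonneg by (intro sum_mono2) auto
  have "(\<Sum>i\<in>A. \<Sum>j\<in>B. pair_weight p F i j) \<le> (\<Sum>i\<in>A. \<Sum>j\<in>N. pair_weight p F i j)"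
    by (intro sum_mono 1)
  also have "\<dots> \<le> U2"
    unfolding pair_sum_def using assms fin_N pw_nonneg by (intro sum_mono2) (auto intro!: sum_nonneg)
  finally show ?thesis .
qed

lemma T_nonneg: "0 \<le> T" and U1_nonneg: "0 \<le> U1" and U2_nonneg: "0 \<le> U2"
  using p_pos tw_nonneg pw_nonneg
  by (auto simp: triple_sum_def single_sum_def pair_sum_def intro!: sum_nonneg)

lemma not_share_disjoint:
  assumes "i \<in> N" "i \<noteq> h" "\<not> share_pair i h"
  shows "nsets i 2 \<inter> nsets h 2 = {}"
  using assms N_D by (intro nsets2_disjoint) (auto simp: share_pair_def)

lemma meets_imp_share: "i \<in> J \<Longrightarrow> meets i j \<Longrightarrow> share_pair i j"
  using not_share_disjoint[of i j] by (auto simp: meets_def)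

lemma card_pairs_diff_ge:
  assumes "i \<in> N" "h \<in> N" "i \<noteq> h"
  shows "r - 1 \<le> card (nsets i 2 - nsets h 2)"
  using card_nsets2_diff[OF N_D(1)[OF assms(1)], of h] choose_two_gap[OF card_Int_less[OF assms]]
    N_D(2)[OF assms(1)] by auto

text \<open>The pairs of a member of \<open>\<H>\<close> lie in \<open>F\<close> and leave the
  exponent unchanged, so a member can be appended to a pair of sets for free. The next two lemmas
  prepend a member, or surround a single set by two members.\<close>

lemma tw_H_right:
  assumes "share_pair i j" "share_pair j h" "i \<in> J" "h \<in> \<H>"
  shows "tw i j h = pr2 i j"
proof -
  have "nsets i 2 \<union> nsets j 2 \<union> nsets h 2 - F = nsets i 2 - F \<union> (nsets j 2 - F)"
    using H_F[of h] assms by auto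
  then show ?thesis using assms by (auto simp: triple_weight_def pr2_def)
qed

lemma tw_H_left:
  assumes "share_pair h i" "share_pair i j" "j \<in> J" "h \<in> \<H>"
  shows "tw h i j = pr2 i j"
proof -
  have "nsets h 2 \<union> nsets i 2 \<union> nsets j 2 - F = nsets i 2 - F \<union> (nsets j 2 - F)"
    using H_F[of h] assms by auto
  then show ?thesis using assms by (auto simp: triple_weight_def pr2_def)
qed

lemma tw_H_both:
  assumes "share_pair h i" "share_pair i h'" "h \<noteq> h'" "h \<in> \<H>" "h' \<in> \<H>"
  shows "tw h i h' = pr1 i"
proof -
  have "nsets h 2 \<union> nsets i 2 \<union> nsets h' 2 - F = nsets i 2 - F"
    using H_F[of h] H_F[of h'] assms by auto
  then show ?thesis using assms by (auto simp: triple_weight_def pr1_def)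
qed

text \<open>A set outside \<open>\<H>\<close> meets \<open>F\<close> in no pair, in the pairs of a single member of \<open>\<H>\<close>, or in
  pairs of several members; the last case is absorbed by \<open>triple_sum\<close>.\<close>

lemma F_cases:
  assumes i: "i \<in> J"
  obtains (none) "\<And>h. h \<in> \<H> \<Longrightarrow> \<not> share_pair i h" "nsets i 2 - F = nsets i 2"
  | (one) h where "h \<in> \<H>" "share_pair i h" "\<And>h'. h' \<in> \<H> \<Longrightarrow> share_pair i h' \<Longrightarrow> h' = h"
      "nsets i 2 - F = nsets i 2 - nsets h 2"
  | (many) h h' where "h \<in> \<H>" "h' \<in> \<H>" "h \<noteq> h'" "share_pair i h" "share_pair i h'"
proof -
  have iN: "i \<in> N" using i by auto
  have ne: "h \<noteq> i" if "h \<in> \<H>" for h using i that by auto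
  have dis: "nsets i 2 \<inter> nsets h 2 = {}" if "h \<in> \<H>" "\<not> share_pair i h" for h
    using not_share_disjoint[OF iN] ne[OF that(1)] that by auto
  consider "\<forall>h\<in>\<H>. \<not> share_pair i h" | h where "h \<in> \<H>" "share_pair i h" "\<forall>h'\<in>\<H>. share_pair i h' \<longrightarrow> h' = h"
    | h h' where "h \<in> \<H>" "h' \<in> \<H>" "h \<noteq> h'" "share_pair i h" "share_pair i h'"
    by metis
  then show thesis
  proof cases
    case 1
    then have "nsets i 2 - F = nsets i 2" using dis F_eq by blast
    with 1 none show thesis by blast
  next
    case 2
    have "nsets i 2 \<inter> F = nsets i 2 \<inter> nsets h 2"
      unfolding F_eq using 2 dis by blast
    then have "nsets i 2 - F = nsets i 2 - nsets h 2" by blast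
    with 2 one show thesis by blast
  next
    case 3
    with many show thesis by blast
  qed
qed

lemma q_le_pr1: "i \<in> J \<Longrightarrow> q \<le> pr1 i"
  unfolding pr1_def using card_pairs[of i] fin_pairs[of i]
  by (intro pw_mono) (metis DiffD1 Diff_subset card_mono)

lemma q_le: "q \<le> p ^ (r - 1)"
  using choose_two_pred[of r] r_ge by (intro pw_mono) auto

text \<open>By \<open>closed\<close> at least one pair of \<open>i\<close> is outside
  \<open>F\<close>.\<close>

lemma pr1_le_half: "i \<in> J \<Longrightarrow> pr1 i \<le> 1 / 2"
proof -
  assume i: "i \<in> J"
  then have "nsets i 2 - F \<noteq> {}" using closed by auto
  then have "1 \<le> card (nsets i 2 - F)"
    using fin_pairs[of i] i by (simp add: Suc_leI card_gt_0_iff)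
  then have "pr1 i \<le> p ^ 1" unfolding pr1_def by (rule pw_mono)
  then show ?thesis using p_le by simp
qed

lemma tw_le_sum_H:
  assumes "h \<in> \<H>"
  shows "tw i j h \<le> (\<Sum>h\<in>\<H>. tw i j h)" "tw h i j \<le> (\<Sum>h\<in>\<H>. tw h i j)"
  using assms fin_H tw_nonneg by (auto intro!: member_le_sum)

lemma tw_le_sum_HH:
  assumes "h \<in> \<H>" "h' \<in> \<H>"
  shows "tw h i h' \<le> (\<Sum>h\<in>\<H>. \<Sum>h'\<in>\<H>. tw h i h')"
proof -
  have "tw h i h' \<le> (\<Sum>h'\<in>\<H>. tw h i h')" using tw_le_sum_H assms by auto
  also have "\<dots> \<le> (\<Sum>h\<in>\<H>. \<Sum>h'\<in>\<H>. tw h i h')"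
    using assms fin_H tw_nonneg sum_nonneg by (intro member_le_sum) (auto intro!: sum_nonneg)
  finally show ?thesis .
qed

lemma sum_J_HH_le: "(\<Sum>i\<in>J. \<Sum>h\<in>\<H>. \<Sum>h'\<in>\<H>. tw h i h') \<le> T"
proof -
  have "(\<Sum>i\<in>J. \<Sum>h\<in>\<H>. \<Sum>h'\<in>\<H>. tw h i h') = (\<Sum>h\<in>\<H>. \<Sum>i\<in>J. \<Sum>h'\<in>\<H>. tw h i h')"
    by (rule sum.swap)
  also have "\<dots> \<le> T" using H_sub by (intro tw_sum_le) auto
  finally show ?thesis .
qed

text \<open>With at most one neighbour in \<open>\<H>\<close>, at least \<open>r - 1\<close> pairs
  remain uncovered. With more, \<open>i\<close> is the centre of a triple with both ends in
  \<open>\<H>\<close>.\<close>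

lemma pr1_cases:
  assumes "i \<in> J"
  shows "pr1 i \<le> p ^ (r - 1) \<or> (\<exists>h\<in>\<H>. \<exists>h'\<in>\<H>. h \<noteq> h' \<and> share_pair i h \<and> share_pair i h')"
  using assms
proof (cases rule: F_cases)
  case none
  then show ?thesis using q_le card_pairs[of i] assms by (auto simp: pr1_def)
next
  case (one h)
  have "pr1 i \<le> p ^ (r - 1)"
    unfolding pr1_def one(4) using one(1,2) assms H_N
    by (intro pw_mono card_pairs_diff_ge) (auto simp: share_pair_def)
  then show ?thesis by blast
qed blast

lemma error_term_le: "error_term J \<le> 5 * T + p ^ (r - 1) * (2 * U1 + U2)"
proof -
  have 1: "(\<Sum>i\<in>J. \<Sum>j\<in>J. \<Sum>k\<in>J. chain3 i j k) \<le> T"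
  proof -
    have "chain3 i j k \<le> tw i j k" if "i \<in> J" "j \<in> J" "k \<in> J" for i j k
    proof -
      have "nsets i 2 - F \<union> (nsets j 2 - F) \<union> (nsets k 2 - F) = nsets i 2 \<union> nsets j 2 \<union> nsets k 2 - F"
        by auto
      then show ?thesis
        using that meets_imp_share p_pos by (auto simp: chain3_def triple_weight_def pr3_def)
    qed
    then have "(\<Sum>i\<in>J. \<Sum>j\<in>J. \<Sum>k\<in>J. chain3 i j k) \<le> (\<Sum>i\<in>J. \<Sum>j\<in>J. \<Sum>k\<in>J. tw i j k)"
      by (intro sum_mono)
    also have "\<dots> \<le> T" by (intro tw_sum_le) auto
    finally show ?thesis .
  qed
  have 2: "(\<Sum>i\<in>J. \<Sum>j\<in>J. of_bool (meets i j) * (pr2 i j * pr1 j)) \<le> p ^ (r - 1) * U2 + T"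
  proof -
    have "of_bool (meets i j) * (pr2 i j * pr1 j)
        \<le> p ^ (r - 1) * pair_weight p F i j + (\<Sum>h\<in>\<H>. tw i j h)" if ij: "i \<in> J" "j \<in> J" for i j
    proof (cases "meets i j")
      case True
      then have sh: "share_pair i j" using meets_imp_share ij by auto
      have "nsets i 2 - F \<union> (nsets j 2 - F) = nsets i 2 \<union> nsets j 2 - F" by auto
      then have pw: "pair_weight p F i j = pr2 i j" using sh by (simp add: pair_weight_def pr2_def)
      show ?thesis
      proof (cases "pr1 j \<le> p ^ (r - 1)")
        case True
        then have "pr2 i j * pr1 j \<le> pr2 i j * p ^ (r - 1)" by (intro mult_left_mono) auto
        moreover have "0 \<le> (\<Sum>h\<in>\<H>. tw i j h)" using tw_nonneg by (intro sum_nonneg)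
        ultimately show ?thesis using \<open>meets i j\<close> pw by (simp add: mult.commute)
      next
        case False
        then obtain h where h: "h \<in> \<H>" "share_pair j h" using pr1_cases ij by blast
        have "pr2 i j * pr1 j \<le> pr2 i j * 1" using pr1_le_half[of j] ij by (intro mult_left_mono) auto
        also have "\<dots> \<le> (\<Sum>h\<in>\<H>. tw i j h)"
          using tw_H_right[OF sh h(2) ij(1) h(1)] tw_le_sum_H(1)[OF h(1), of i j] by simp
        finally show ?thesis using \<open>meets i j\<close> pw_nonneg p_pos by (simp add: add_increasing)
      qed
    next
      case False
      then show ?thesis using tw_nonneg pw_nonneg p_pos by (simp add: sum_nonneg)
    qed
    then have "(\<Sum>i\<in>J. \<Sum>j\<in>J. of_bool (meets i j) * (pr2 i j * pr1 j))
        \<le> (\<Sum>i\<in>J. \<Sum>j\<in>J. p ^ (r - 1) * pair_weight p F i j + (\<Sum>h\<in>\<H>. tw i j h))"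
      by (intro sum_mono)
    also have "\<dots> = p ^ (r - 1) * (\<Sum>i\<in>J. \<Sum>j\<in>J. pair_weight p F i j) + (\<Sum>i\<in>J. \<Sum>j\<in>J. \<Sum>h\<in>\<H>. tw i j h)"
      by (simp add: sum.distrib sum_distrib_left)
    also have "\<dots> \<le> p ^ (r - 1) * U2 + T"
      using H_sub p_pos by (intro add_mono mult_left_mono pair_sum_le tw_sum_le) auto
    finally show ?thesis .
  qed
  have 3: "(\<Sum>i\<in>J. (pr1 i)\<^sup>2) \<le> p ^ (r - 1) * U1 + T"
  proof -
    have "(pr1 i)\<^sup>2 \<le> p ^ (r - 1) * pr1 i + (\<Sum>h\<in>\<H>. \<Sum>h'\<in>\<H>. tw h i h')" if i: "i \<in> J" for i
    proof (cases "pr1 i \<le> p ^ (r - 1)")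
      case True
      then have "pr1 i * pr1 i \<le> p ^ (r - 1) * pr1 i" by (intro mult_right_mono) auto
      moreover have "0 \<le> (\<Sum>h\<in>\<H>. \<Sum>h'\<in>\<H>. tw h i h')" using tw_nonneg by (intro sum_nonneg)
      ultimately show ?thesis by (simp add: power2_eq_square)
    next
      case False
      then obtain h h' where h: "h \<in> \<H>" "h' \<in> \<H>" "h \<noteq> h'" "share_pair i h" "share_pair i h'"
        using pr1_cases i by blast
      have "(pr1 i)\<^sup>2 \<le> pr1 i * 1" unfolding power2_eq_square
        using pr1_le_half[OF i] by (intro mult_left_mono) auto
      also have "\<dots> = tw h i h'"
        using h by (simp add: tw_H_both share_pair_commute)
      also have "\<dots> \<le> (\<Sum>h\<in>\<H>. \<Sum>h'\<in>\<H>. tw h i h')" using tw_le_sum_HH h by blast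
      finally show ?thesis using p_pos by (simp add: add_increasing)
    qed
    then have "(\<Sum>i\<in>J. (pr1 i)\<^sup>2) \<le> (\<Sum>i\<in>J. p ^ (r - 1) * pr1 i + (\<Sum>h\<in>\<H>. \<Sum>h'\<in>\<H>. tw h i h'))"
      by (intro sum_mono)
    also have "\<dots> = p ^ (r - 1) * (\<Sum>i\<in>J. pr1 i) + (\<Sum>i\<in>J. \<Sum>h\<in>\<H>. \<Sum>h'\<in>\<H>. tw h i h')"
      by (simp add: sum.distrib sum_distrib_left)
    also have "\<dots> \<le> p ^ (r - 1) * U1 + T"
      using p_pos sum_J_HH_le fin_N
      by (intro add_mono mult_left_mono) (auto simp: single_sum_def pr1_def intro!: sum_mono2)
    finally show ?thesis .
  qed
  show ?thesis unfolding error_term_def using 1 2 3 by (simp add: algebra_simps)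
qed

lemma excess_bounds:
  assumes "i \<in> N" "h \<in> N"
  shows "0 \<le> p ^ card (nsets i 2 - nsets h 2) - q"
    and "q * (p ^ card (nsets i 2 - nsets h 2) - q) = p ^ card (nsets i 2 \<union> nsets h 2) - q\<^sup>2"
proof -
  have "card (nsets i 2 - nsets h 2) \<le> r choose 2"
    using card_mono[of "nsets i 2" "nsets i 2 - nsets h 2"] fin_pairs card_pairs assms by auto
  then show "0 \<le> p ^ card (nsets i 2 - nsets h 2) - q" using pw_mono by simp
  have "card (nsets h 2 \<union> (nsets i 2 - nsets h 2)) = card (nsets h 2) + card (nsets i 2 - nsets h 2)"
    using fin_pairs assms by (intro card_Un_disjoint) auto
  then have "p ^ card (nsets i 2 \<union> nsets h 2) = q * p ^ card (nsets i 2 - nsets h 2)"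
    using card_pairs[of h] assms by (simp add: power_add Un_commute)
  then show "q * (p ^ card (nsets i 2 - nsets h 2) - q) = p ^ card (nsets i 2 \<union> nsets h 2) - q\<^sup>2"
    by (simp add: right_diff_distrib power2_eq_square)
qed

text \<open>The shift of \<open>pr1 i\<close> above \<open>q\<close> is additive over the neighbours
  in \<open>\<H>\<close> if there is at most one, and otherwise is absorbed by triples. For a fixed
  member the shifts sum to \<open>\<kappa>\<close>; having \<open>card \<H>\<close> members instead
  of \<open>\<mu>\<close> gives the fluctuation term.\<close>

lemma first_order:
  "\<bar>(\<Sum>i\<in>J. pr1 i) - real (card J) * q - 2 * \<Lambda>\<bar> \<le> T + p ^ (r - 1) * U2 + \<bar>real (card \<H>) - \<mu>\<bar> * \<kappa>"
proof -
  let ?\<psi> = "\<lambda>i h. of_bool (share_pair i h) * (p ^ card (nsets i 2 - nsets h 2) - q)"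
  have \<psi>0: "0 \<le> ?\<psi> i h" if "i \<in> N" "h \<in> N" for i h
    using excess_bounds(1)[OF that] by simp
  have local: "\<bar>pr1 i - q - (\<Sum>h\<in>\<H>. ?\<psi> i h)\<bar> \<le> (\<Sum>h\<in>\<H>. \<Sum>h'\<in>\<H>. tw h i h')" (is "_ \<le> ?R i") if i: "i \<in> J" for i
  proof -
    have R0: "0 \<le> ?R i" using tw_nonneg by (intro sum_nonneg)
    from i show ?thesis
    proof (cases rule: F_cases)
      case none
      then have "(\<Sum>h\<in>\<H>. ?\<psi> i h) = 0" by (intro sum.neutral) auto
      moreover have "pr1 i = q" using none card_pairs i by (simp add: pr1_def)
      ultimately show ?thesis using R0 by simp
    next
      case (one h)
      have "(\<Sum>h\<in>\<H>. ?\<psi> i h) = (\<Sum>h'\<in>{h}. ?\<psi> i h')"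
      proof (rule sum.mono_neutral_right[OF fin_H])
        show "\<forall>h'\<in>\<H> - {h}. ?\<psi> i h' = 0" using one(3) by fastforce
      qed (use one(1) in simp)
      also have "\<dots> = pr1 i - q" using one(2) by (simp add: pr1_def one(4))
      finally show ?thesis using R0 by simp
    next
      case (many h h')
      \<comment> \<open>With several neighbours, each shift is at most \<open>pr1 i\<close>, the
        weight of the triple formed with another neighbour \<open>g'\<close>.\<close>
      have le: "?\<psi> i g \<le> (\<Sum>g'\<in>\<H>. tw g i g')" if g: "g \<in> \<H>" for g
      proof (cases "share_pair i g")
        case True
        obtain g' where g': "g' \<in> \<H>" "g' \<noteq> g" "share_pair i g'" using many by metis
        have "?\<psi> i g \<le> p ^ card (nsets i 2 - nsets g 2)" using p_pos True by simp
        also have "\<dots> \<le> pr1 i"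
          unfolding pr1_def using H_F[OF g] fin_pairs[of i] i by (intro pw_mono card_mono) auto
        also have "\<dots> = tw g i g'" using tw_H_both[of g i g'] g g' True by (simp add: share_pair_commute)
        also have "\<dots> \<le> (\<Sum>g'\<in>\<H>. tw g i g')" using tw_le_sum_H g' by blast
        finally show ?thesis .
      next
        case False
        then show ?thesis using tw_nonneg by (simp add: sum_nonneg)
      qed
      have "(\<Sum>h\<in>\<H>. ?\<psi> i h) \<le> ?R i" by (intro sum_mono le)
      moreover have "0 \<le> (\<Sum>h\<in>\<H>. ?\<psi> i h)" using \<psi>0 i H_N by (intro sum_nonneg) auto
      moreover have "pr1 i \<le> ?R i"
        using tw_H_both[of h i h'] tw_le_sum_HH[of h h' i] many by (simp add: share_pair_commute)
      moreover have "q \<le> pr1 i" "0 \<le> q" using q_le_pr1 i p_pos by auto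
      ultimately show ?thesis by linarith
    qed
  qed
  have "\<bar>\<Sum>i\<in>J. pr1 i - q - (\<Sum>h\<in>\<H>. ?\<psi> i h)\<bar> \<le> (\<Sum>i\<in>J. ?R i)"
    using local by (intro order_trans[OF sum_abs] sum_mono)
  also have "\<dots> \<le> T" by (rule sum_J_HH_le)
  finally have 1: "\<bar>(\<Sum>i\<in>J. pr1 i) - real (card J) * q - (\<Sum>i\<in>J. \<Sum>h\<in>\<H>. ?\<psi> i h)\<bar> \<le> T"
    by (simp add: sum_subtractf)
  \<comment> \<open>The sum is completed from \<open>J\<close> to \<open>N\<close>, where each
    member contributes exactly \<open>\<kappa>\<close>. The added part, with both sets in
    \<open>\<H>\<close>, is the correction estimated below.\<close>
  have "(\<Sum>i\<in>J. \<Sum>h\<in>\<H>. ?\<psi> i h) + (\<Sum>i\<in>\<H>. \<Sum>h\<in>\<H>. ?\<psi> i h) = (\<Sum>i\<in>N. \<Sum>h\<in>\<H>. ?\<psi> i h)"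
    using sum.subset_diff[OF H_sub fin_N, of "\<lambda>i. \<Sum>h\<in>\<H>. ?\<psi> i h"] by simp
  also have "\<dots> = (\<Sum>h\<in>\<H>. \<Sum>i\<in>N. ?\<psi> i h)" by (rule sum.swap)
  also have "\<dots> = (\<Sum>h\<in>\<H>. \<kappa>)"
    using sum_excess_eq_kappa[OF fin_V] H_N by (intro sum.cong) auto
  also have "\<dots> = real (card \<H>) * \<kappa>" by simp
  finally have 2: "(\<Sum>i\<in>J. \<Sum>h\<in>\<H>. ?\<psi> i h) = real (card \<H>) * \<kappa> - (\<Sum>i\<in>\<H>. \<Sum>h\<in>\<H>. ?\<psi> i h)" by simp
  have 3: "0 \<le> (\<Sum>i\<in>\<H>. \<Sum>h\<in>\<H>. ?\<psi> i h)" using \<psi>0 H_N by (intro sum_nonneg) auto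
  have "?\<psi> i h \<le> p ^ (r - 1) * pair_weight p F i h" if "i \<in> \<H>" "h \<in> \<H>" for i h
  proof (cases "share_pair i h")
    case True
    \<comment> \<open>Both sets lie inside \<open>F\<close>, so the pair weight is 1; the small
      factor comes from the pairs of \<open>i\<close> that are not pairs of
      \<open>h\<close>.\<close>
    have "nsets i 2 \<union> nsets h 2 - F = {}" using H_F that by auto
    then have "card (nsets i 2 \<union> nsets h 2 - F) = 0" by (simp only: card.empty)
    then have "pair_weight p F i h = 1" unfolding pair_weight_def using True by (simp only:) simp
    moreover have "p ^ card (nsets i 2 - nsets h 2) \<le> p ^ (r - 1)"
      using that True H_N by (intro pw_mono card_pairs_diff_ge) (auto simp: share_pair_def)
    moreover have "0 \<le> q" using p_pos by simp
    ultimately show ?thesis using True by simp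
  next
    case False
    then show ?thesis using pw_nonneg p_pos by simp
  qed
  then have "(\<Sum>i\<in>\<H>. \<Sum>h\<in>\<H>. ?\<psi> i h) \<le> p ^ (r - 1) * (\<Sum>i\<in>\<H>. \<Sum>h\<in>\<H>. pair_weight p F i h)"
    unfolding sum_distrib_left by (intro sum_mono)
  also have "\<dots> \<le> p ^ (r - 1) * U2"
    using H_sub p_pos by (intro mult_left_mono pair_sum_le) auto
  finally have 4: "(\<Sum>i\<in>\<H>. \<Sum>h\<in>\<H>. ?\<psi> i h) \<le> p ^ (r - 1) * U2" .
  have "0 \<le> \<kappa>"
    unfolding kappa_def using pw_mono
    by (intro sum_nonneg mult_nonneg_nonneg) auto
  then have "\<bar>real (card \<H>) * \<kappa> - 2 * \<Lambda>\<bar> = \<bar>real (card \<H>) - \<mu>\<bar> * \<kappa>"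
    using Lambda_eq_kappa[OF p_pos, of "card V" r]
    by (simp add: left_diff_distrib[symmetric] abs_mult)
  then show ?thesis using 1 2 3 4 by linarith
qed

lemma Lambda_eq_sum:
  "2 * \<Lambda> = (\<Sum>i\<in>N. \<Sum>j\<in>N. of_bool (share_pair i j) * (p ^ card (nsets i 2 \<union> nsets j 2) - q\<^sup>2))"
proof -
  have "(\<Sum>i\<in>N. \<Sum>j\<in>N. of_bool (share_pair i j) * (p ^ card (nsets i 2 \<union> nsets j 2) - q\<^sup>2))
      = (\<Sum>j\<in>N. q * (\<Sum>i\<in>N. of_bool (share_pair i j) * (p ^ card (nsets i 2 - nsets j 2) - q)))"
    unfolding sum_distrib_left
    by (subst sum.swap, intro sum.cong refl) (simp add: excess_bounds(2))
  also have "\<dots> = (\<Sum>j\<in>N. q * \<kappa>)"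
    using sum_excess_eq_kappa[OF fin_V] by (intro sum.cong) auto
  also have "\<dots> = \<mu> * \<kappa>" by (simp add: mu_def card_nsets)
  finally show ?thesis using Lambda_eq_kappa[OF p_pos] by simp
qed

text \<open>Away from \<open>\<H>\<close> the conditioned covariances equal the unconditioned ones.
  Next to a member of \<open>\<H>\<close> both are at most \<open>pr2 i j\<close>, the weight of the
  triple with that member. The pairs of sets with an entry in \<open>\<H>\<close>, present only in
  \<open>\<Lambda>\<close>, are charged to \<open>U2\<close>.\<close>

lemma second_order:
  "\<bar>(\<Sum>i\<in>J. \<Sum>j\<in>J. of_bool (i \<noteq> j) * (pr2 i j - pr1 i * pr1 j)) - 2 * \<Lambda>\<bar>
    \<le> 2 * T + 2 * p ^ (r - 1) * U2"
proof -
  let ?\<phi> = "\<lambda>i j. of_bool (share_pair i j) * (p ^ card (nsets i 2 \<union> nsets j 2) - q\<^sup>2)"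
  let ?R = "\<lambda>i j. (\<Sum>h\<in>\<H>. tw h i j) + (\<Sum>h\<in>\<H>. tw i j h)"
  have \<phi>0: "0 \<le> ?\<phi> i j" if "i \<in> N" "j \<in> N" for i j
  proof -
    have "0 \<le> p ^ card (nsets i 2 \<union> nsets j 2) - q\<^sup>2"
      unfolding excess_bounds(2)[OF that, symmetric]
      using excess_bounds(1)[OF that] p_pos by simp
    then show ?thesis by simp
  qed
  have local: "\<bar>of_bool (i \<noteq> j) * (pr2 i j - pr1 i * pr1 j) - ?\<phi> i j\<bar> \<le> ?R i j" if ij: "i \<in> J" "j \<in> J" for i j
  proof -
    have R0: "0 \<le> ?R i j" using tw_nonneg by (intro add_nonneg_nonneg sum_nonneg)
    show ?thesis
    proof (cases "share_pair i j")
      case False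
      then have z: "of_bool (i \<noteq> j) * (pr2 i j - pr1 i * pr1 j) = 0"
        using pr2_not_meets[of i j] ij meets_imp_share by auto
      show ?thesis unfolding z using False R0 by simp
    next
      case sh: True
      then have ne: "i \<noteq> j" by (simp add: share_pair_def)
      have un: "nsets i 2 - F \<union> (nsets j 2 - F) = nsets i 2 \<union> nsets j 2 - F" by auto
      consider h where "h \<in> \<H>" "share_pair i h" | h where "h \<in> \<H>" "share_pair j h"
        | "\<forall>h\<in>\<H>. \<not> share_pair i h \<and> \<not> share_pair j h" by blast
      then show ?thesis
      proof cases
        case 3
        have "nsets i 2 - F = nsets i 2" using ij(1) by (cases rule: F_cases) (use 3 in blast)+
        moreover have "nsets j 2 - F = nsets j 2" using ij(2) by (cases rule: F_cases) (use 3 in blast)+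
        ultimately have "pr1 i = q" "pr1 j = q" "pr2 i j = p ^ card (nsets i 2 \<union> nsets j 2)"
          using card_pairs ij by (auto simp: pr1_def pr2_def)
        then show ?thesis using sh ne R0 by (simp add: power2_eq_square)
      next
        case ass: 1
        have "pr2 i j = tw h i j" using tw_H_left[of h i j] ass sh ij by (simp add: share_pair_commute)
        then have "pr2 i j \<le> ?R i j"
          using tw_le_sum_H(2)[OF ass(1), of i j] tw_nonneg by (simp add: add_increasing2 sum_nonneg)
        moreover have "pr1 i * pr1 j \<le> pr2 i j"
          using power_card_mono_union[of "nsets i 2 - F" "nsets j 2 - F"] fin_pairs ij
          by (auto simp: pr1_def pr2_def)
        moreover have "0 \<le> pr1 i * pr1 j" by simp
        moreover have "p ^ card (nsets i 2 \<union> nsets j 2) \<le> pr2 i j"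
          unfolding pr2_def un using fin_pairs ij by (intro pw_mono card_mono) auto
        moreover have "0 \<le> q\<^sup>2" by simp
        moreover have "0 \<le> p ^ card (nsets i 2 \<union> nsets j 2) - q\<^sup>2" using \<phi>0[of i j] ij sh by simp
        ultimately show ?thesis
          by (simp only: sh ne of_bool_eq mult_1_left not_False_eq_True)
      next
        case ass: 2
        have "pr2 i j = tw i j h" using tw_H_right[of i j h] ass sh ij by simp
        then have "pr2 i j \<le> ?R i j"
          using tw_le_sum_H(1)[OF ass(1), of i j] tw_nonneg by (simp add: add_increasing sum_nonneg)
        moreover have "pr1 i * pr1 j \<le> pr2 i j"
          using power_card_mono_union[of "nsets i 2 - F" "nsets j 2 - F"] fin_pairs ij
          by (auto simp: pr1_def pr2_def)
        moreover have "0 \<le> pr1 i * pr1 j" by simp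
        moreover have "p ^ card (nsets i 2 \<union> nsets j 2) \<le> pr2 i j"
          unfolding pr2_def un using fin_pairs ij by (intro pw_mono card_mono) auto
        moreover have "0 \<le> q\<^sup>2" by simp
        moreover have "0 \<le> p ^ card (nsets i 2 \<union> nsets j 2) - q\<^sup>2" using \<phi>0[of i j] ij sh by simp
        ultimately show ?thesis
          by (simp only: sh ne of_bool_eq mult_1_left not_False_eq_True)
      qed
    qed
  qed
  have "\<bar>\<Sum>i\<in>J. \<Sum>j\<in>J. of_bool (i \<noteq> j) * (pr2 i j - pr1 i * pr1 j) - ?\<phi> i j\<bar> \<le> (\<Sum>i\<in>J. \<Sum>j\<in>J. ?R i j)"
    using local by (intro order_trans[OF sum_abs] sum_mono order_trans[OF sum_abs]) auto
  also have "\<dots> = (\<Sum>h\<in>\<H>. \<Sum>i\<in>J. \<Sum>j\<in>J. tw h i j) + (\<Sum>i\<in>J. \<Sum>j\<in>J. \<Sum>h\<in>\<H>. tw i j h)"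
  proof -
    have "(\<Sum>i\<in>J. \<Sum>j\<in>J. \<Sum>h\<in>\<H>. tw h i j) = (\<Sum>i\<in>J. \<Sum>h\<in>\<H>. \<Sum>j\<in>J. tw h i j)"
      by (intro sum.cong refl sum.swap)
    also have "\<dots> = (\<Sum>h\<in>\<H>. \<Sum>i\<in>J. \<Sum>j\<in>J. tw h i j)" by (rule sum.swap)
    finally show ?thesis by (simp add: sum.distrib)
  qed
  also have "\<dots> \<le> T + T"
    using H_sub by (intro add_mono tw_sum_le) auto
  finally have 1: "\<bar>(\<Sum>i\<in>J. \<Sum>j\<in>J. of_bool (i \<noteq> j) * (pr2 i j - pr1 i * pr1 j)) - (\<Sum>i\<in>J. \<Sum>j\<in>J. ?\<phi> i j)\<bar> \<le> 2 * T"
    by (simp only: sum_subtractf)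
  have \<phi>H: "?\<phi> i j \<le> p ^ (r - 1) * pair_weight p F i j" if ij: "i \<in> N" "j \<in> N" "i \<in> \<H> \<or> j \<in> \<H>" for i j
  proof -
    let ?U = "nsets i 2 \<union> nsets j 2"
    have fU: "finite ?U" using fin_pairs ij by auto
    \<comment> \<open>Here \<open>h\<close> is \<open>i\<close> or \<open>j\<close>. All its
      \<open>r choose 2\<close> pairs lie in \<open>F\<close>, and of this saving only
      \<open>r - 1\<close> factors are kept.\<close>
    obtain h where h: "h \<in> \<H>" "nsets h 2 \<subseteq> ?U" using ij(3) by blast
    have "card (nsets h 2 \<union> (?U - F)) = card (nsets h 2) + card (?U - F)"
      using h H_F fU fin_pairs H_N by (intro card_Un_disjoint) auto
    moreover have "card (nsets h 2 \<union> (?U - F)) \<le> card ?U"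
      using h fU by (intro card_mono) auto
    ultimately have "r - 1 + card (?U - F) \<le> card ?U"
      using choose_two_pred[of r] r_ge card_pairs[OF H_N[OF h(1)]] by auto
    then have "p ^ card ?U \<le> p ^ (r - 1) * p ^ card (?U - F)"
      unfolding power_add[symmetric] by (rule pw_mono)
    moreover have "p ^ card ?U - q\<^sup>2 \<le> p ^ card ?U" by simp
    ultimately have "p ^ card ?U - q\<^sup>2 \<le> p ^ (r - 1) * p ^ card (?U - F)" by linarith
    then show ?thesis by (simp add: pair_weight_def)
  qed
  have split: "(\<Sum>i\<in>N. \<Sum>j\<in>N. ?\<phi> i j)
      = (\<Sum>i\<in>J. \<Sum>j\<in>J. ?\<phi> i j) + (\<Sum>i\<in>J. \<Sum>j\<in>\<H>. ?\<phi> i j) + (\<Sum>i\<in>\<H>. \<Sum>j\<in>N. ?\<phi> i j)"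
  proof -
    have "(\<Sum>i\<in>N. \<Sum>j\<in>N. ?\<phi> i j) = (\<Sum>i\<in>J. \<Sum>j\<in>N. ?\<phi> i j) + (\<Sum>i\<in>\<H>. \<Sum>j\<in>N. ?\<phi> i j)"
      by (rule sum.subset_diff[OF H_sub fin_N])
    also have "(\<Sum>i\<in>J. \<Sum>j\<in>N. ?\<phi> i j) = (\<Sum>i\<in>J. (\<Sum>j\<in>J. ?\<phi> i j) + (\<Sum>j\<in>\<H>. ?\<phi> i j))"
      by (intro sum.cong refl sum.subset_diff[OF H_sub fin_N])
    finally show ?thesis by (simp add: sum.distrib)
  qed
  have "(\<Sum>i\<in>J. \<Sum>j\<in>\<H>. ?\<phi> i j) \<le> p ^ (r - 1) * (\<Sum>i\<in>J. \<Sum>j\<in>\<H>. pair_weight p F i j)"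
    unfolding sum_distrib_left using H_N by (intro sum_mono \<phi>H) auto
  also have "\<dots> \<le> p ^ (r - 1) * U2" using H_sub p_pos by (intro mult_left_mono pair_sum_le) auto
  finally have 2: "(\<Sum>i\<in>J. \<Sum>j\<in>\<H>. ?\<phi> i j) \<le> p ^ (r - 1) * U2" .
  have "(\<Sum>i\<in>\<H>. \<Sum>j\<in>N. ?\<phi> i j) \<le> p ^ (r - 1) * (\<Sum>i\<in>\<H>. \<Sum>j\<in>N. pair_weight p F i j)"
    unfolding sum_distrib_left using H_N by (intro sum_mono \<phi>H) auto
  also have "\<dots> \<le> p ^ (r - 1) * U2" using H_sub p_pos by (intro mult_left_mono pair_sum_le) auto
  finally have 3: "(\<Sum>i\<in>\<H>. \<Sum>j\<in>N. ?\<phi> i j) \<le> p ^ (r - 1) * U2" .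
  have 4: "0 \<le> (\<Sum>i\<in>J. \<Sum>j\<in>\<H>. ?\<phi> i j)" using \<phi>0 H_N by (intro sum_nonneg) auto
  have 5: "0 \<le> (\<Sum>i\<in>\<H>. \<Sum>j\<in>N. ?\<phi> i j)" using \<phi>0 H_N by (intro sum_nonneg) auto
  show ?thesis
    unfolding Lambda_eq_sum using 1 2 3 4 5 split by linarith
qed

text \<open>Exchanges the Poisson factor exp (- card J * q) for the binomial factor of the claimed
  formula, at a loss of at most 2 * q^2 in the exponent per set.\<close>

lemma power_one_minus_q:
  obtains \<epsilon> where "0 \<le> \<epsilon>" "\<epsilon> \<le> 2 * p ^ (r - 1) * U1" "(1 - q) ^ card J = exp (- real (card J) * q - \<epsilon>)"
proof
  define \<epsilon> where "\<epsilon> = real (card J) * (- q - ln (1 - q))"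
  have "q \<le> p ^ 1" using choose_two_pred[of r] r_ge by (intro pw_mono) auto
  then have q: "0 \<le> q" "q \<le> 1 / 2" using p_pos p_le by auto
  have l: "ln (1 - q) \<le> - q" using ln_le_minus_one[of "1 - q"] q by simp
  then show "0 \<le> \<epsilon>" unfolding \<epsilon>_def by (intro mult_nonneg_nonneg) auto
  have "- q - ln (1 - q) \<le> 2 * (q * q)"
    using ln_one_minus_pos_lower_bound[of q] q by (simp add: power2_eq_square)
  then have "\<epsilon> \<le> real (card J) * (2 * (q * q))" unfolding \<epsilon>_def by (intro mult_left_mono) auto
  also have "\<dots> = 2 * q * (\<Sum>i\<in>J. q)" by simp
  also have "\<dots> \<le> 2 * p ^ (r - 1) * U1"
  proof (intro mult_mono)
    show "(\<Sum>i\<in>J. q) \<le> U1"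
    proof -
      have "(\<Sum>i\<in>J. q) \<le> (\<Sum>i\<in>J. pr1 i)" using q_le_pr1 by (intro sum_mono)
      also have "\<dots> \<le> U1" using fin_N p_pos by (auto simp: single_sum_def pr1_def intro!: sum_mono2)
      finally show ?thesis .
    qed
  qed (use q q_le p_pos in \<open>auto intro!: sum_nonneg\<close>)
  finally show "\<epsilon> \<le> 2 * p ^ (r - 1) * U1" .
  have "(1 - q) ^ card J = exp (ln (1 - q)) ^ card J" using q by simp
  also have "\<dots> = exp (real (card J) * ln (1 - q))" by (simp add: exp_of_nat_mult)
  also have "real (card J) * ln (1 - q) = - real (card J) * q - \<epsilon>" by (simp add: \<epsilon>_def algebra_simps)
  finally show "(1 - q) ^ card J = exp (- real (card J) * q - \<epsilon>)" .
qed

text \<open>The constant 7 is the total coefficient of \<open>T\<close>: 5 from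
  \<open>error_term_le\<close>, 1 from \<open>first_order\<close>, and 1 from half of
  \<open>second_order\<close>. The other coefficients are smaller.\<close>

theorem avoid_J_estimate:
  obtains \<delta> where "\<bar>\<delta>\<bar> \<le> 7 * (T + p ^ (r - 1) * (U1 + U2) + \<bar>real (card \<H>) - \<mu>\<bar> * \<kappa>)"
    "avoid {} J = (1 - q) ^ card J * exp (- \<Lambda> + \<delta>)"
proof -
  obtain \<epsilon> where \<epsilon>: "0 \<le> \<epsilon>" "\<epsilon> \<le> 2 * p ^ (r - 1) * U1" "(1 - q) ^ card J = exp (- real (card J) * q - \<epsilon>)"
    by (rule power_one_minus_q)
  have est: "exp (- main_term J - error_term J) \<le> avoid {} J" "avoid {} J \<le> exp (- main_term J + error_term J)"
    using avoid_estimate[of J] pr1_le_half by auto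
  have pos: "0 < avoid {} J" using est(1) by (meson exp_gt_zero less_le_trans)
  define L where "L = ln (avoid {} J)"
  have avL: "avoid {} J = exp L" using pos by (simp add: L_def)
  have L: "- main_term J - error_term J \<le> L" "L \<le> - main_term J + error_term J"
    using est by (auto simp: avL)
  define \<delta> where "\<delta> = L + real (card J) * q + \<epsilon> + \<Lambda>"
  have eq: "avoid {} J = (1 - q) ^ card J * exp (- \<Lambda> + \<delta>)"
    unfolding avL \<epsilon>(3) exp_add[symmetric] by (simp add: \<delta>_def)
  have \<kappa>: "0 \<le> \<bar>real (card \<H>) - \<mu>\<bar> * \<kappa>"
    unfolding kappa_def using pw_mono
    by (intro sum_nonneg mult_nonneg_nonneg) auto
  have U: "0 \<le> p ^ (r - 1) * U1" "0 \<le> p ^ (r - 1) * U2" using p_pos U1_nonneg U2_nonneg by auto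
  have m: "main_term J = (\<Sum>i\<in>J. pr1 i) - (\<Sum>i\<in>J. \<Sum>j\<in>J. of_bool (i \<noteq> j) * (pr2 i j - pr1 i * pr1 j)) / 2"
    by (rule main_term_def)
  have d: "7 * (T + p ^ (r - 1) * (U1 + U2) + \<bar>real (card \<H>) - \<mu>\<bar> * \<kappa>)
      = 7 * T + 7 * (p ^ (r - 1) * U1) + 7 * (p ^ (r - 1) * U2) + 7 * (\<bar>real (card \<H>) - \<mu>\<bar> * \<kappa>)"
    by (simp add: algebra_simps)
  have e: "error_term J \<le> 5 * T + 2 * (p ^ (r - 1) * U1) + p ^ (r - 1) * U2"
    using error_term_le by (simp add: algebra_simps)
  have "\<bar>\<delta>\<bar> \<le> 7 * (T + p ^ (r - 1) * (U1 + U2) + \<bar>real (card \<H>) - \<mu>\<bar> * \<kappa>)"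
    unfolding d using first_order second_order e \<epsilon>(1,2) L \<kappa> U T_nonneg
    unfolding \<delta>_def m mult.assoc by linarith
  then show thesis using that eq by blast
qed

end

section \<open>Clique hypergraphs and densities of overlapping cliques\<close>

text \<open>The sets to be avoided are disjoint from \<open>F\<close>, so the presence of
  \<open>F\<close> is an independent factor \<open>p ^ card F\<close>. Since card F is
  \<open>r choose 2\<close> times e(H) minus t(H), it supplies the powers of \<open>q\<close> and of
  \<open>p\<close> in the formula.\<close>

theorem prob_clique_hypergraph_eq:
  assumes p: "0 < p" "p \<le> 1 / 2" and r: "3 \<le> r"
    and A0: "A0 \<subseteq> nsets {1..n} 2" "H = clique_hypergraph r ({1..n}, A0)"
  defines "F \<equiv> edges (shadow_graph H)" and "V \<equiv> {1..n}"
  obtains \<delta> where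
    "\<bar>\<delta>\<bar> \<le> 7 * (triple_sum V r p F + p ^ (r - 1) * (single_sum V r p F + pair_sum V r p F)
      + \<bar>real (num_edges H) - mu n p r\<bar> * kappa n r p)"
    "measure_pmf.prob (random_graph n p) {G. clique_hypergraph r G = H}
      = (let q = p ^ (r choose 2) in
          q ^ num_edges H * (1 - q) ^ ((n choose r) - num_edges H) * p powi (- edge_overlap r H)
            * exp (- Lambda n r p + \<delta>))"
proof -
  have fV: "finite V" and cV: "card V = n" by (auto simp: V_def)
  have H: "H = (V, {S\<in>nsets V r. nsets S 2 \<subseteq> A0})"
    using A0 clique_hypergraph_eq[OF fV, of A0 r] by (simp add: V_def)
  have unif: "uniform_hypergraph r H" by (auto simp: H uniform_hypergraph_def)
  have F: "F = (\<Union>h\<in>edges H. nsets h 2)"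
    unfolding F_def by (rule edges_shadow_graph[OF unif])
  have FA0: "F \<subseteq> A0" unfolding F by (auto simp: H)
  have FE: "F \<subseteq> nsets V 2" using FA0 A0 by (simp add: V_def)
  interpret clique_config V r p "edges H" F
  proof
    \<comment> \<open>Covered pairs are edges of \<open>A0\<close>, so a set with all its pairs
      covered is a clique of \<open>A0\<close>.\<close>
    show "i \<in> edges H" if "i \<in> nsets V r" "nsets i 2 \<subseteq> F" for i
      using that FA0 by (auto simp: H)
  qed (use fV r p F in \<open>auto simp: H\<close>)
  have fE: "finite (nsets V 2)" using fV by (simp add: finite_imp_finite_nsets)
  have ev: "clique_hypergraph r ({1..n}, A) = H \<longleftrightarrow> F \<subseteq> A \<and> (\<forall>j\<in>J. \<not> nsets j 2 - F \<subseteq> A)"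
    if "A \<subseteq> nsets V 2" for A
  proof -
    have "clique_hypergraph r ({1..n}, A) = H \<longleftrightarrow> {S\<in>nsets V r. nsets S 2 \<subseteq> A} = edges H"
      using clique_hypergraph_eq[OF fV that, of r] unfolding V_def[symmetric] H by simp
    also have "\<dots> \<longleftrightarrow> (\<forall>S\<in>nsets V r. nsets S 2 \<subseteq> A \<longleftrightarrow> S \<in> edges H)"
      using H_sub by blast
    also have "\<dots> \<longleftrightarrow> F \<subseteq> A \<and> (\<forall>j\<in>J. \<not> nsets j 2 - F \<subseteq> A)"
    proof
      assume *: "\<forall>S\<in>nsets V r. nsets S 2 \<subseteq> A \<longleftrightarrow> S \<in> edges H"
      then have "F \<subseteq> A" unfolding F using H_sub by blast
      moreover have "\<not> nsets j 2 - F \<subseteq> A" if "j \<in> J" for j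
        using * that \<open>F \<subseteq> A\<close> by blast
      ultimately show "F \<subseteq> A \<and> (\<forall>j\<in>J. \<not> nsets j 2 - F \<subseteq> A)" by blast
    next
      assume "F \<subseteq> A \<and> (\<forall>j\<in>J. \<not> nsets j 2 - F \<subseteq> A)"
      then show "\<forall>S\<in>nsets V r. nsets S 2 \<subseteq> A \<longleftrightarrow> S \<in> edges H"
        using H_F by blast
    qed
    finally show ?thesis .
  qed
  have "measure_pmf.prob (random_graph n p) {G. clique_hypergraph r G = H}
      = expec p (nsets V 2) (\<lambda>A. of_bool (clique_hypergraph r ({1..n}, A) = H))"
    unfolding V_def using p by (intro prob_random_graph) auto
  also have "\<dots> = expec p (nsets V 2) (\<lambda>A. of_bool (F \<subseteq> A \<and> (\<forall>j\<in>J. \<not> nsets j 2 - F \<subseteq> A)))"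
    using ev by (intro expec_cong) auto
  also have "\<dots> = p ^ card F * expec p (nsets V 2) (\<lambda>A. of_bool (\<forall>j\<in>J. \<not> nsets j 2 - F \<subseteq> A))"
    using fE FE
  proof (rule expec_superset_eq)
    show "(\<forall>j\<in>J. \<not> nsets j 2 - F \<subseteq> insert e A) \<longleftrightarrow> (\<forall>j\<in>J. \<not> nsets j 2 - F \<subseteq> A)"
      if "e \<in> F" for e A using that by blast
  qed
  also have "expec p (nsets V 2) (\<lambda>A. of_bool (\<forall>j\<in>J. \<not> nsets j 2 - F \<subseteq> A)) = avoid {} J"
    by (simp add: avoid_def)
  finally have prob: "measure_pmf.prob (random_graph n p) {G. clique_hypergraph r G = H}
      = p ^ card F * avoid {} J" .
  obtain \<delta> where \<delta>: "\<bar>\<delta>\<bar> \<le> 7 * (T + p ^ (r - 1) * (U1 + U2) + \<bar>real (card (edges H)) - \<mu>\<bar> * \<kappa>)"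
    "avoid {} J = (1 - q) ^ card J * exp (- \<Lambda> + \<delta>)"
    by (rule avoid_J_estimate)
  have cJ: "card J = (n choose r) - num_edges H"
    using fin_H H_sub by (simp add: card_Diff_subset card_nsets cV num_edges_def)
  have pF: "p ^ card F = q ^ num_edges H * p powi (- edge_overlap r H)"
  proof -
    have "q ^ num_edges H = p powi (int (r choose 2) * int (num_edges H))"
      by (simp only: of_nat_mult[symmetric] power_int_of_nat power_mult)
    then have "q ^ num_edges H * p powi (- edge_overlap r H)
        = p powi (int (r choose 2) * int (num_edges H) + - edge_overlap r H)"
      using p by (simp only:) (rule power_int_add[symmetric], auto)
    also have "\<dots> = p ^ card F"
      by (simp add: edge_overlap_def num_edges_def F_def)
    finally show ?thesis by simp
  qed
  show thesis
  proof (rule that)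
    show "\<bar>\<delta>\<bar> \<le> 7 * (triple_sum V r p F + p ^ (r - 1) * (single_sum V r p F + pair_sum V r p F)
      + \<bar>real (num_edges H) - mu n p r\<bar> * kappa n r p)"
      using \<delta>(1) by (simp add: cV num_edges_def)
    show "measure_pmf.prob (random_graph n p) {G. clique_hypergraph r G = H}
      = (let q = p ^ (r choose 2) in
          q ^ num_edges H * (1 - q) ^ ((n choose r) - num_edges H) * p powi (- edge_overlap r H)
            * exp (- Lambda n r p + \<delta>))"
      unfolding prob pF \<delta>(2) cJ cV by (simp add: Let_def mult_ac)
  qed
qed

section \<open>Vertices against edges in unions of overlapping cliques\<close>

lemma two_choose_two: "2 * (k choose 2) = k * (k - 1)"
proof -
  have "even (k * (k - 1))" by (cases k) auto
  then show ?thesis by (simp add: choose_two)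
qed

lemma int_two_choose_two: "2 * int (k choose 2) = int k * (int k - 1)"
proof -
  have "2 * int (k choose 2) = int (k * (k - 1))"
    using two_choose_two[of k] by (metis of_nat_mult of_nat_numeral)
  then show ?thesis by (cases k) (auto simp: algebra_simps)
qed

text \<open>At \<open>p = n powr (-2/r)\<close> a configuration with \<open>v\<close> vertices and \<open>m\<close> edges has expected
  number of copies about \<open>n powr (v - 2 * m / r)\<close>, whence the inequalities
  \<open>r * v + 1 \<le> 2 * m\<close> below.\<close>

lemma overlap_ineq:
  assumes "2 \<le> s" "s < (r::nat)"
  shows "2 * int r - 2 \<le> int s * (int r + 1 - int s)"
proof -
  \<comment> \<open>This product is the difference of the two sides; equality holds at the smallest
    and the largest overlap.\<close>
  have "0 \<le> (int s - 2) * (int r - 1 - int s)" using assms by simp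
  then show ?thesis by (simp add: algebra_simps)
qed

lemma card_nsets2_Un:
  assumes "i \<in> nsets V r" "j \<in> nsets V r"
  shows "int (card (nsets i 2 \<union> nsets j 2)) = 2 * int (r choose 2) - int (card (i \<inter> j) choose 2)"
    and "int (card (i \<union> j)) = 2 * int r - int (card (i \<inter> j))"
proof -
  have f: "finite i" "finite j" "card i = r" "card j = r" using assms by (auto simp: nsets_def)
  have "card (nsets i 2) + card (nsets j 2) = card (nsets i 2 \<union> nsets j 2) + card (nsets i 2 \<inter> nsets j 2)"
    using f by (intro card_Un_Int) (auto simp: finite_imp_finite_nsets)
  then show "int (card (nsets i 2 \<union> nsets j 2)) = 2 * int (r choose 2) - int (card (i \<inter> j) choose 2)"
    using f by (simp add: nsets2_Int card_nsets)
  have "card i + card j = card (i \<union> j) + card (i \<inter> j)"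
    using f by (intro card_Un_Int)
  then show "int (card (i \<union> j)) = 2 * int r - int (card (i \<inter> j))" using f by simp
qed

text \<open>By \<open>overlap_ineq\<close> two linked cliques alone satisfy only 2m - rv \<ge> -2.
  The \<open>r - 1\<close> additional factors of \<open>p\<close> restore a positive margin.\<close>

lemma pair_density:
  assumes "i \<in> nsets V r" "j \<in> nsets V r" "share_pair i j" "r \<ge> 5"
  shows "r * card (i \<union> j) + 1 \<le> 2 * (card (nsets i 2 \<union> nsets j 2) + (r - 1))"
proof -
  let ?s = "card (i \<inter> j)"
  have s: "2 \<le> ?s" "?s < r" using assms card_Int_less[of i V r j] by (auto simp: share_pair_def)
  have "2 * int (card (nsets i 2 \<union> nsets j 2)) = 2 * (int r * (int r - 1)) - int ?s * (int ?s - 1)"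
    using card_nsets2_Un(1)[OF assms(1,2)] int_two_choose_two[of r] int_two_choose_two[of ?s] by linarith
  moreover have "int r * int (card (i \<union> j)) = 2 * (int r * int r) - int r * int ?s"
    by (simp add: card_nsets2_Un(2)[OF assms(1,2)] algebra_simps)
  moreover have "2 * int r - 2 \<le> int ?s * (int r + 1 - int ?s)" by (rule overlap_ineq[OF s])
  ultimately have "int r * int (card (i \<union> j)) + 1 \<le> 2 * (int (card (nsets i 2 \<union> nsets j 2)) + (int r - 1))"
    using assms(4) by (simp add: algebra_simps)
  then have "int (r * card (i \<union> j) + 1) \<le> int (2 * (card (nsets i 2 \<union> nsets j 2) + (r - 1)))"
    using assms(4) by (simp add: of_nat_diff)
  then show ?thesis by linarith
qed

text \<open>Two distinct \<open>r\<close>-sets already span \<open>r + 1\<close> vertices. The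
  alternative \<open>infinite k\<close> is there because \<open>card\<close> of an infinite union is
  0.\<close>

lemma triple_card_Un_ge:
  assumes "i \<in> nsets V r" "j \<in> nsets V r" "i \<noteq> j"
  shows "r + 1 \<le> card (i \<union> j \<union> k) \<or> infinite k"
proof (cases "finite k")
  case True
  have "card (i \<inter> j) < r" by (rule card_Int_less[OF assms])
  then have "r + 1 \<le> card (i \<union> j)" using card_nsets2_Un(2)[OF assms(1,2)] by linarith
  also have "\<dots> \<le> card (i \<union> j \<union> k)" using assms True by (intro card_mono) (auto simp: nsets_def)
  finally show ?thesis by simp
qed simp

text \<open>Each set misses exactly one of the \<open>r + 1\<close> vertices, and the three missed
  vertices are distinct. A pair cannot contain all three, so it lies inside one of the sets.\<close>

lemma triple_tight:
  assumes N: "i \<in> nsets V r" "j \<in> nsets V r" "k \<in> nsets V r" and d: "i \<noteq> j" "j \<noteq> k" "i \<noteq> k"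
    and c: "card (i \<union> j \<union> k) = r + 1"
  shows "nsets i 2 \<union> nsets j 2 \<union> nsets k 2 = nsets (i \<union> j \<union> k) 2"
proof -
  let ?U = "i \<union> j \<union> k"
  have f: "finite i" "finite j" "finite k" "card i = r" "card j = r" "card k = r"
    using N by (auto simp: nsets_def)
  have one: "card (?U - x) = 1" if "x = i \<or> x = j \<or> x = k" for x
  proof -
    have "card (?U - x) = card ?U - card x" using that f by (intro card_Diff_subset) auto
    then show ?thesis using that f c by auto
  qed
  obtain a b e where abe: "?U - i = {a}" "?U - j = {b}" "?U - k = {e}"
    using one by (metis card_1_singletonE)
  have ij: "i = ?U - {a}" "j = ?U - {b}" "k = ?U - {e}"
    using abe by auto
  have ne: "a \<noteq> b" "b \<noteq> e" "a \<noteq> e"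
    using ij d by metis+
  have "e' \<in> nsets i 2 \<union> nsets j 2 \<union> nsets k 2" if "e' \<in> nsets ?U 2" for e'
  proof -
    have e': "e' \<subseteq> ?U" "card e' = 2" "finite e'" using that by (auto simp: nsets_def)
    have "\<not> {a, b, e} \<subseteq> e'"
    proof
      assume "{a, b, e} \<subseteq> e'"
      then have "card {a, b, e} \<le> card e'" using e' by (intro card_mono)
      then show False using ne e' by simp
    qed
    then have "e' \<subseteq> ?U - {a} \<or> e' \<subseteq> ?U - {b} \<or> e' \<subseteq> ?U - {e}" using e' by blast
    then have "e' \<subseteq> i \<or> e' \<subseteq> j \<or> e' \<subseteq> k" using ij by simp
    then show ?thesis using e' by (auto simp: nsets_def)
  qed
  then show ?thesis by (auto simp: nsets_def)
qed

text \<open>Starting from -r, each attached clique with new vertices raises 2m - rv by at least r -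
  2, for a total of r - 4 \<ge> 1. If \<open>k\<close> lies inside \<open>i \<union> j\<close>, the
  gain must come instead from pairs of \<open>k\<close> covered by neither \<open>i\<close> nor
  \<open>j\<close>.\<close>

lemma triple_density:
  assumes N: "i \<in> nsets V r" "j \<in> nsets V r" "k \<in> nsets V r"
    and sh: "share_pair i j" "share_pair j k" "i \<noteq> k"
    and r: "r \<ge> 5" and c: "r + 2 \<le> card (i \<union> j \<union> k)"
  shows "r * card (i \<union> j \<union> k) + 1 \<le> 2 * card (nsets i 2 \<union> nsets j 2 \<union> nsets k 2)"
proof -
  have f: "finite i" "finite j" "finite k" "card i = r" "card j = r" "card k = r"
    using N by (auto simp: nsets_def)
  define s where "s = card (i \<inter> j)"
  define t where "t = card (k \<inter> (i \<union> j))"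
  define M where "M = card (nsets i 2 \<union> nsets j 2)"
  define m where "m = card (nsets i 2 \<union> nsets j 2 \<union> nsets k 2)"
  define v where "v = card (i \<union> j \<union> k)"
  have s: "2 \<le> s" "s < r" using N sh card_Int_less[of i V r j] by (auto simp: share_pair_def s_def)
  have "card (j \<inter> k) \<le> t" unfolding t_def using f by (intro card_mono) auto
  then have t: "2 \<le> t" using sh by (simp add: share_pair_def)
  have tr: "t \<le> r" unfolding t_def using f by (metis card_mono inf_le1)
  have v: "int v = 3 * int r - int s - int t"
  proof -
    have "card (i \<union> j) + card k = card (i \<union> j \<union> k) + card ((i \<union> j) \<inter> k)"
      using f by (intro card_Un_Int) auto
    then show ?thesis using f card_nsets2_Un(2)[OF N(1,2)]
      by (simp add: v_def s_def t_def Int_commute)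
  qed
  have M: "2 * int M = 2 * (int r * (int r - 1)) - int s * (int s - 1)"
    unfolding M_def s_def using card_nsets2_Un(1)[OF N(1,2)] int_two_choose_two[of r]
      int_two_choose_two[of "card (i \<inter> j)"] by linarith
  have fin: "finite (nsets i 2 \<union> nsets j 2)" "finite (nsets k 2)"
    using f by (auto simp: finite_imp_finite_nsets)
  have mM: "m = M + card (nsets k 2 - (nsets i 2 \<union> nsets j 2))"
  proof -
    have "nsets i 2 \<union> nsets j 2 \<union> nsets k 2
        = (nsets i 2 \<union> nsets j 2) \<union> (nsets k 2 - (nsets i 2 \<union> nsets j 2))" by auto
    then show ?thesis unfolding m_def M_def using fin by (metis Diff_disjoint card_Un_disjoint finite_Diff)
  qed
  have sI: "2 * int r - 2 \<le> int s * (int r + 1 - int s)" by (rule overlap_ineq[OF s])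
  have "int r * int v + 1 \<le> 2 * int m"
  proof (cases "t < r")
    case True
    have "card (nsets k 2 - nsets (k \<inter> (i \<union> j)) 2) \<le> card (nsets k 2 - (nsets i 2 \<union> nsets j 2))"
      using fin by (intro card_mono) (auto simp: nsets_def)
    moreover have "card (nsets k 2 - nsets (k \<inter> (i \<union> j)) 2) = (r choose 2) - (t choose 2)"
      using card_nsets2_diff[OF f(3), of "k \<inter> (i \<union> j)"] f by (simp add: t_def)
    ultimately have "(r choose 2) \<le> (t choose 2) + card (nsets k 2 - (nsets i 2 \<union> nsets j 2))" by linarith
    then have "2 * int m \<ge> 2 * int M + int r * (int r - 1) - int t * (int t - 1)"
      using mM int_two_choose_two[of r] int_two_choose_two[of t] by linarith
    moreover have "2 * int r - 2 \<le> int t * (int r + 1 - int t)" by (rule overlap_ineq[OF t True])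
    moreover have "int r * int v = 3 * (int r * int r) - int r * int s - int r * int t"
      by (simp add: v algebra_simps)
    ultimately show ?thesis using M sI r by (simp add: algebra_simps)
  next
    case False
    then have t: "t = r" using tr by simp
    have ksub: "k \<subseteq> i \<union> j"
    proof -
      have "k \<inter> (i \<union> j) = k" using t f by (intro card_seteq) (auto simp: t_def)
      then show ?thesis by auto
    qed
    have s2: "s \<le> r - 2" using c v t s by (simp add: v_def[symmetric])
    define a where "a = card (k - j)"
    define b where "b = card (k - i)"
    have disj: "(k - j) \<inter> (k - i) = {}" using ksub by auto
    have ne: "k - j \<noteq> {}" "k - i \<noteq> {}"
    proof -
      show "k - j \<noteq> {}"
      proof
        assume "k - j = {}"
        then have "k = j" using f by (intro card_subset_eq) auto
        then show False using sh by (simp add: share_pair_def)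
      qed
      show "k - i \<noteq> {}"
      proof
        assume "k - i = {}"
        then have "k = i" using f by (intro card_subset_eq) auto
        then show False using sh by simp
      qed
    qed
    have ab1: "1 \<le> a" "1 \<le> b" using ne f by (auto simp: a_def b_def Suc_le_eq card_gt_0_iff)
    have abs: "r \<le> s + a + b"
    proof -
      have "k \<subseteq> (i \<inter> j) \<union> ((k - j) \<union> (k - i))" by auto
      then have "card k \<le> card ((i \<inter> j) \<union> ((k - j) \<union> (k - i)))" using f by (intro card_mono) auto
      also have "\<dots> \<le> card (i \<inter> j) + (card (k - j) + card (k - i))"
        by (meson add_left_mono card_Un_le order_trans)
      finally show ?thesis using f by (simp add: s_def a_def b_def)
    qed
    \<comment> \<open>A vertex of \<open>k - j\<close> and a vertex of \<open>k - i\<close> form a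
      pair contained in neither \<open>i\<close> nor \<open>j\<close>.\<close>
    have cross: "a * b \<le> card (nsets k 2 - (nsets i 2 \<union> nsets j 2))"
    proof -
      have "(\<lambda>(x, y). {x, y}) ` ((k - j) \<times> (k - i)) \<subseteq> nsets k 2 - (nsets i 2 \<union> nsets j 2)"
        using disj by auto
      moreover have "inj_on (\<lambda>(x, y). {x, y}) ((k - j) \<times> (k - i))"
        using disj by (auto simp: inj_on_def doubleton_eq_iff)
      ultimately have "card ((k - j) \<times> (k - i)) \<le> card (nsets k 2 - (nsets i 2 \<union> nsets j 2))"
        using fin by (intro card_inj_on_le) auto
      then show ?thesis by (simp add: a_def b_def card_cartesian_product)
    qed
    have rv: "int r * int v = 2 * (int r * int r) - int r * int s"
    proof -
      have "int v = 2 * int r - int s" using v t by simp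
      then show ?thesis by (simp only: right_diff_distrib mult.left_commute)
    qed
    have m2: "2 * int m \<ge> 2 * int M + 2 * int (a * b)" using mM cross by linarith
    \<comment> \<open>Two cross pairs add 4, which beats the possible deficit 2 of \<open>i\<close>
      and \<open>j\<close>. A single one forces \<open>s = r - 2\<close>, where the overlap
      expression rises to 3 * r - 6 and the excess is again at least r - 4.\<close>
    show ?thesis
    proof (cases "2 \<le> a * b")
      case True
      then have "2 * int m \<ge> 2 * int M + 4" using m2 by linarith
      then show ?thesis using M sI rv r by (simp add: algebra_simps)
    next
      case False
      then have "a * b = 1" using ab1 by (metis One_nat_def Suc_1 Suc_leI le_antisym mult_le_mono nat_mult_1 not_less_eq_eq)
      then have "a = 1" "b = 1" by auto
      then have "s = r - 2" using abs s2 by linarith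
      then have "int s = int r - 2" using r by simp
      moreover from this have "int r + 1 - int s = 3" by simp
      ultimately have "int s * (int r + 1 - int s) = 3 * int r - 6" by (simp only:) simp
      then show ?thesis using M rv m2 \<open>a * b = 1\<close> r by (simp add: algebra_simps)
    qed
  qed
  then have "int (r * v + 1) \<le> int (2 * m)" by simp
  then show ?thesis unfolding v_def m_def by linarith
qed

lemma triple_edges_le:
  assumes "i \<in> nsets V r" "j \<in> nsets V r" "k \<in> nsets V r"
  shows "card (nsets i 2 \<union> nsets j 2 \<union> nsets k 2) \<le> 3 * (r choose 2)"
proof -
  have "card (nsets x 2) = r choose 2" if "x \<in> nsets V r" for x
    using that by (auto simp: nsets_def card_nsets[unfolded nsets_def])
  then show ?thesis
    using assms card_Un_le[of "nsets i 2 \<union> nsets j 2" "nsets k 2"] card_Un_le[of "nsets i 2" "nsets j 2"]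
    by fastforce
qed

section \<open>Expected overlaps\<close>

text \<open>The solution \<open>g\<close> of \<open>1 / r - 2 * r\<^sup>2 * g = 3 * g\<close>; configurations have at most
  \<open>2 * r\<^sup>2\<close> edges, and Markov's inequality needs room below \<open>n powr (- g)\<close>.\<close>

definition gamma_exponent :: "nat \<Rightarrow> real" where
  "gamma_exponent r = 1 / (real r * (2 * (real r)\<^sup>2 + 3))"

lemma gamma_exponent_pos: "0 < r \<Longrightarrow> 0 < gamma_exponent r"
  unfolding gamma_exponent_def by (intro divide_pos_pos mult_pos_pos add_nonneg_pos) auto

text \<open>With g = \<open>gamma_exponent r\<close> the exponent of n is at most - 2m/r + 2 * r^2 *
  g \<le> - v - 1/r + 2 * r^2 * g, which equals - v - 3g by the choice of g.\<close>

lemma power_bound: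
  fixes n r v m :: nat and p :: real
  assumes r: "0 < r" and n: "1 \<le> n" and p: "0 \<le> p" "p \<le> real n powr (- 2 / real r + gamma_exponent r)"
    and m: "m \<le> 2 * r\<^sup>2" "r * v + 1 \<le> 2 * m"
  shows "p ^ m \<le> (1 / real n) ^ v * real n powr (- 3 * gamma_exponent r)"
proof -
  let ?g = "gamma_exponent r"
  have g: "0 < ?g" using r by (rule gamma_exponent_pos)
  have n0: "0 < real n" using n by simp
  have gr: "?g * (2 * (real r)\<^sup>2 + 3) = 1 / real r"
  proof -
    have "2 * (real r)\<^sup>2 + 3 \<noteq> 0" using zero_le_power2[of "real r"] by linarith
    then show ?thesis using r by (simp add: gamma_exponent_def)
  qed
  have "real m \<le> real (2 * r\<^sup>2)" using m(1) by (simp only: of_nat_le_iff)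
  then have "?g * real m \<le> ?g * (2 * (real r)\<^sup>2)" using g by (intro mult_left_mono) auto
  moreover have "real (r * v + 1) \<le> real (2 * m)" using m(2) by (simp only: of_nat_le_iff)
  then have "(real r * real v + 1) / real r \<le> (2 * real m) / real r"
    by (intro divide_right_mono) auto
  then have "real v + 1 / real r \<le> 2 / real r * real m"
    using r by (simp add: add_divide_distrib)
  moreover have "?g * (2 * (real r)\<^sup>2 + 3) = ?g * (2 * (real r)\<^sup>2) + 3 * ?g" by (simp add: algebra_simps)
  ultimately have e: "(- 2 / real r + ?g) * real m \<le> - real v + (- 3 * ?g)"
    using gr by (simp add: algebra_simps)
  have "p ^ m \<le> (real n powr (- 2 / real r + ?g)) ^ m" using p by (intro power_mono)
  also have "\<dots> = real n powr ((- 2 / real r + ?g) * real m)"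
    using n0 by (simp add: powr_powr powr_realpow[symmetric])
  also have "\<dots> \<le> real n powr (- real v + (- 3 * ?g))" using n e by (intro powr_mono) auto
  also have "\<dots> = real n powr (- real v) * real n powr (- 3 * ?g)" by (rule powr_add)
  also have "real n powr (- real v) = (1 / real n) ^ v"
    using n0 by (simp add: powr_minus powr_realpow power_one_over inverse_eq_divide)
  finally show ?thesis .
qed

text \<open>Triples are grouped by their union \<open>U\<close>. Each entry is one of the 2 ^ card U
  subsets of \<open>U\<close>, so a union arises from at most 8 ^ card U triples.\<close>

lemma triple_count:
  fixes g :: "nat \<Rightarrow> real"
  assumes V: "finite V" and g: "\<And>v. 0 \<le> g v"
  shows "(\<Sum>i\<in>nsets V r. \<Sum>j\<in>nsets V r. \<Sum>k\<in>nsets V r. g (card (i \<union> j \<union> k)))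
    \<le> (\<Sum>v\<le>3 * r. real (card V choose v) * 8 ^ v * g v)"
proof -
  let ?N = "nsets V r"
  let ?u = "\<lambda>(i, j, k). i \<union> j \<union> k"
  let ?W = "{U. U \<subseteq> V \<and> card U \<le> 3 * r}"
  have fN: "finite ?N" using V by (simp add: finite_imp_finite_nsets)
  have fW: "finite ?W" using V by auto
  have uW: "?u ` (?N \<times> ?N \<times> ?N) \<subseteq> ?W"
  proof clarsimp
    fix i j k assume a: "i \<in> ?N" "j \<in> ?N" "k \<in> ?N"
    have "card (i \<union> j \<union> k) \<le> card i + card j + card k"
      by (meson add_mono card_Un_le le_refl order_trans)
    then show "i \<subseteq> V \<and> j \<subseteq> V \<and> k \<subseteq> V \<and> card (i \<union> j \<union> k) \<le> 3 * r"
      using a by (auto simp: nsets_def)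
  qed
  have "(\<Sum>i\<in>?N. \<Sum>j\<in>?N. \<Sum>k\<in>?N. g (card (i \<union> j \<union> k))) = (\<Sum>x\<in>?N \<times> ?N \<times> ?N. g (card (?u x)))"
    using fN by (simp add: sum.cartesian_product case_prod_beta)
  also have "\<dots> = (\<Sum>U\<in>?W. \<Sum>x\<in>{x\<in>?N \<times> ?N \<times> ?N. ?u x = U}. g (card (?u x)))"
    using fN fW uW by (intro sum.group[symmetric]) auto
  also have "\<dots> \<le> (\<Sum>U\<in>?W. 8 ^ card U * g (card U))"
  proof (rule sum_mono)
    fix U assume U: "U \<in> ?W"
    then have fU: "finite U" using V finite_subset by auto
    let ?X = "{x\<in>?N \<times> ?N \<times> ?N. ?u x = U}"
    have "?X \<subseteq> Pow U \<times> Pow U \<times> Pow U" by auto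
    then have "card ?X \<le> card (Pow U \<times> Pow U \<times> Pow U)" using fU by (intro card_mono) auto
    also have "\<dots> = 2 ^ card U * (2 ^ card U * 2 ^ card U)"
      using fU by (simp add: card_cartesian_product card_Pow)
    also have "\<dots> = (2 * (2 * 2)) ^ card U" by (simp only: power_mult_distrib)
    also have "\<dots> = 8 ^ card U" by simp
    finally have "real (card ?X) \<le> real (8 ^ card U)" by (simp only: of_nat_le_iff)
    then have "real (card ?X) \<le> 8 ^ card U" by simp
    moreover have "(\<Sum>x\<in>?X. g (card (?u x))) = (\<Sum>x\<in>?X. g (card U))"
      by (rule sum.cong) auto
    then have "(\<Sum>x\<in>?X. g (card (?u x))) = real (card ?X) * g (card U)" by simp
    ultimately show "(\<Sum>x\<in>?X. g (card (?u x))) \<le> 8 ^ card U * g (card U)"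
      using g by (simp add: mult_right_mono)
  qed
  also have "\<dots> = (\<Sum>v\<in>{..3 * r}. \<Sum>U\<in>{U\<in>?W. card U = v}. 8 ^ card U * g (card U))"
    using fW by (intro sum.group[symmetric]) auto
  also have "\<dots> = (\<Sum>v\<le>3 * r. real (card V choose v) * 8 ^ v * g v)"
  proof (rule sum.cong[OF refl])
    fix v assume v: "v \<in> {..3 * r}"
    have "{U\<in>?W. card U = v} = nsets V v"
      using v V by (auto simp: nsets_def intro: finite_subset)
    then show "(\<Sum>U\<in>{U\<in>?W. card U = v}. 8 ^ card U * g (card U)) = real (card V choose v) * 8 ^ v * g v"
      using card_nsets[of V v] by (simp add: nsets_def)
  qed
  finally show ?thesis .
qed

text \<open>The weight cancels the number of vertex sets of each size, leaving a constant that
  depends on \<open>r\<close> only.\<close>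

lemma inverse_power_triple_sum:
  assumes V: "finite V" "1 \<le> card V"
  shows "(\<Sum>i\<in>nsets V r. \<Sum>j\<in>nsets V r. \<Sum>k\<in>nsets V r. (1 / real (card V)) ^ card (i \<union> j \<union> k))
    \<le> (\<Sum>v\<le>3 * r. 8 ^ v)"
proof -
  let ?n = "card V"
  have "real (?n choose v) * 8 ^ v * (1 / real ?n) ^ v \<le> 8 ^ v" for v
  proof (cases "v \<le> ?n")
    case True
    then have "real (?n choose v) \<le> real (?n ^ v)" using binomial_le_pow by (simp only: of_nat_le_iff)
    then have "real (?n choose v) * (1 / real ?n) ^ v \<le> real ?n ^ v * (1 / real ?n) ^ v"
      by (intro mult_right_mono) auto
    also have "\<dots> = (real ?n * (1 / real ?n)) ^ v" by (rule power_mult_distrib[symmetric])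
    also have "real ?n * (1 / real ?n) = 1" 
    proof -
      have "real ?n \<noteq> 0" using V(2) by linarith
      then show ?thesis by (metis times_divide_eq_right mult_1_right divide_self)
    qed
    also have "(1::real) ^ v = 1" by simp
    finally have "8 ^ v * (real (?n choose v) * (1 / real ?n) ^ v) \<le> 8 ^ v * 1"
      by (intro mult_left_mono) auto
    then show ?thesis by (simp only: mult_ac)
  next
    case False
    then show ?thesis by (simp add: binomial_eq_0)
  qed
  then have "(\<Sum>v\<le>3 * r. real (?n choose v) * 8 ^ v * (1 / real ?n) ^ v) \<le> (\<Sum>v\<le>3 * r. 8 ^ v)"
    by (intro sum_mono)
  with triple_count[OF V(1), of "\<lambda>v. (1 / real ?n) ^ v" r] show ?thesis by simp
qed

text \<open>The part in which the three cliques together form a K_{r+1}. Nonzero terms of the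
  complementary sum span at least \<open>r + 2\<close> vertices, as \<open>triple_density\<close>
  demands.\<close>

definition tight_sum :: "'a set \<Rightarrow> nat \<Rightarrow> real \<Rightarrow> 'a set set \<Rightarrow> real" where
  "tight_sum V r p F = (\<Sum>i\<in>nsets V r. \<Sum>j\<in>nsets V r. \<Sum>k\<in>nsets V r.
     of_bool (card (i \<union> j \<union> k) = r + 1) * triple_weight p F i j k)"

definition loose_sum :: "'a set \<Rightarrow> nat \<Rightarrow> real \<Rightarrow> 'a set set \<Rightarrow> real" where
  "loose_sum V r p F = (\<Sum>i\<in>nsets V r. \<Sum>j\<in>nsets V r. \<Sum>k\<in>nsets V r.
     of_bool (card (i \<union> j \<union> k) \<noteq> r + 1) * triple_weight p F i j k)"

lemma triple_sum_split: "triple_sum V r p F = tight_sum V r p F + loose_sum V r p F"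
  unfolding triple_sum_def tight_sum_def loose_sum_def sum.distrib[symmetric]
  by (intro sum.cong refl) auto

context
  fixes V :: "'a set" and r :: nat and p :: real
  assumes V: "finite V" "1 \<le> card V" and r: "5 \<le> r" and p: "0 \<le> p" "p \<le> 1"
    and p_small: "p \<le> real (card V) powr (- 2 / real r + gamma_exponent r)"
begin

abbreviation (input) "EV \<equiv> nsets V 2"
abbreviation (input) "small \<equiv> real (card V) powr (- 3 * gamma_exponent r)"
abbreviation (input) "S8 \<equiv> (\<Sum>v\<le>3 * r. 8 ^ v :: real)"

lemma expec_cover_le:
  "Y \<subseteq> EV \<Longrightarrow> expec p EV (\<lambda>A. p ^ card (Y - A)) \<le> (2 * p) ^ card Y"
  using V p by (intro expec_power_card_diff_le) (auto simp: finite_imp_finite_nsets)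

lemma nsets2_subset: "i \<in> nsets V r \<Longrightarrow> nsets i 2 \<subseteq> EV"
  by (auto simp: nsets_def)

text \<open>Three cliques together with \<open>r - 1\<close> extra factors stay within the edge
  budget for which \<open>gamma_exponent\<close> was chosen.\<close>

lemma edge_bound: "3 * (r choose 2) + (r - 1) \<le> 2 * r\<^sup>2"
proof -
  have "2 * (r choose 2) = r * (r - 1)" by (rule two_choose_two)
  moreover have "r * (r - 1) + r = r\<^sup>2" using r by (cases r) (auto simp: power2_eq_square)
  ultimately have "6 * (r choose 2) + 3 * r = 3 * r\<^sup>2" by linarith
  then show ?thesis using r by linarith
qed

text \<open>By \<open>triple_tight\<close> the cover is a whole K_{r+1}; the vertex sets number
  \<open>card V choose (r + 1)\<close>, so \<open>mu\<close> at \<open>r + 1\<close> appears, with a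
  factor 2 per pair from \<open>expec_cover_le\<close>.\<close>

lemma expec_tight_sum_le:
  "expec p EV (tight_sum V r p) \<le> 8 ^ (r + 1) * 2 ^ ((r + 1) choose 2) * mu (card V) p (r + 1)"
proof -
  let ?N = "nsets V r"
  let ?c = "(2 * p) ^ ((r + 1) choose 2)"
  have "expec p EV (tight_sum V r p) = (\<Sum>i\<in>?N. \<Sum>j\<in>?N. \<Sum>k\<in>?N.
      expec p EV (\<lambda>A. of_bool (card (i \<union> j \<union> k) = r + 1) * triple_weight p A i j k))"
    unfolding tight_sum_def by (simp only: expec_sum)
  also have "\<dots> \<le> (\<Sum>i\<in>?N. \<Sum>j\<in>?N. \<Sum>k\<in>?N. of_bool (card (i \<union> j \<union> k) = r + 1) * ?c)"
  proof (intro sum_mono)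
    fix i j k assume N: "i \<in> ?N" "j \<in> ?N" "k \<in> ?N"
    let ?b = "card (i \<union> j \<union> k) = r + 1 \<and> share_pair i j \<and> share_pair j k \<and> i \<noteq> k"
    let ?Y = "nsets i 2 \<union> nsets j 2 \<union> nsets k 2"
    have "expec p EV (\<lambda>A. of_bool (card (i \<union> j \<union> k) = r + 1) * triple_weight p A i j k)
        = of_bool ?b * expec p EV (\<lambda>A. p ^ card (?Y - A))"
      unfolding expec_cmult[symmetric] by (rule expec_cong) (auto simp: triple_weight_def)
    also have "\<dots> \<le> of_bool (card (i \<union> j \<union> k) = r + 1) * ?c"
    proof (cases ?b)
      case True
      then have Y: "?Y = nsets (i \<union> j \<union> k) 2"
        using N by (intro triple_tight) (auto simp: share_pair_def)
      have "finite (i \<union> j \<union> k)" using N by (auto simp: nsets_def)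
      then have "card ?Y = (r + 1) choose 2" unfolding Y card_nsets using True by simp
      moreover have "expec p EV (\<lambda>A. p ^ card (?Y - A)) \<le> (2 * p) ^ card ?Y"
        using N nsets2_subset by (intro expec_cover_le) blast
      ultimately show ?thesis using True by simp
    next
      case False
      then have z: "of_bool ?b = (0::real)" by (simp only: False of_bool_eq)
      show ?thesis unfolding z using p by simp
    qed
    finally show "expec p EV (\<lambda>A. of_bool (card (i \<union> j \<union> k) = r + 1) * triple_weight p A i j k)
      \<le> of_bool (card (i \<union> j \<union> k) = r + 1) * ?c" .
  qed
  also have "\<dots> \<le> (\<Sum>v\<le>3 * r. real (card V choose v) * 8 ^ v * (of_bool (v = r + 1) * ?c))"
    using p by (intro triple_count[OF V(1)]) auto
  also have "\<dots> = (\<Sum>v\<in>{r + 1}. real (card V choose v) * 8 ^ v * (of_bool (v = r + 1) * ?c))"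
    using r by (intro sum.mono_neutral_right) auto
  also have "\<dots> = 8 ^ (r + 1) * 2 ^ ((r + 1) choose 2) * mu (card V) p (r + 1)"
    by (simp add: mu_def power_mult_distrib)
  finally show ?thesis .
qed

text \<open>\<open>d\<close> counts the extra factors of \<open>p\<close> outside the expectation:
  none for triples, \<open>r - 1\<close> for pairs and single sets.\<close>

lemma weight_le:
  assumes "m + d \<le> 3 * (r choose 2) + (r - 1)" "r * v + 1 \<le> 2 * (m + d)"
  shows "p ^ d * (2 * p) ^ m \<le> 2 ^ (3 * (r choose 2) + (r - 1)) * (small * (1 / real (card V)) ^ v)"
proof -
  have "p ^ d * (2 * p) ^ m = 2 ^ m * p ^ (m + d)" by (simp add: power_mult_distrib power_add)
  also have "\<dots> \<le> 2 ^ (3 * (r choose 2) + (r - 1)) * ((1 / real (card V)) ^ v * small)"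
  proof (rule mult_mono)
    show "p ^ (m + d) \<le> (1 / real (card V)) ^ v * small"
      using assms edge_bound r V p p_small by (intro power_bound) auto
    show "(2::real) ^ m \<le> 2 ^ (3 * (r choose 2) + (r - 1))" using assms(1) by (intro power_increasing) auto
  qed (use p in auto)
  finally show ?thesis by (simp add: mult_ac)
qed

lemma expec_loose_sum_le:
  "expec p EV (loose_sum V r p) \<le> 2 ^ (3 * (r choose 2) + (r - 1)) * S8 * small"
proof -
  let ?N = "nsets V r"
  let ?c = "2 ^ (3 * (r choose 2) + (r - 1)) * small"
  have "expec p EV (loose_sum V r p) = (\<Sum>i\<in>?N. \<Sum>j\<in>?N. \<Sum>k\<in>?N.
      expec p EV (\<lambda>A. of_bool (card (i \<union> j \<union> k) \<noteq> r + 1) * triple_weight p A i j k))"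
    unfolding loose_sum_def by (simp only: expec_sum)
  also have "\<dots> \<le> (\<Sum>i\<in>?N. \<Sum>j\<in>?N. \<Sum>k\<in>?N. ?c * (1 / real (card V)) ^ card (i \<union> j \<union> k))"
  proof (intro sum_mono)
    fix i j k assume N: "i \<in> ?N" "j \<in> ?N" "k \<in> ?N"
    let ?b = "card (i \<union> j \<union> k) \<noteq> r + 1 \<and> share_pair i j \<and> share_pair j k \<and> i \<noteq> k"
    let ?Y = "nsets i 2 \<union> nsets j 2 \<union> nsets k 2"
    have "expec p EV (\<lambda>A. of_bool (card (i \<union> j \<union> k) \<noteq> r + 1) * triple_weight p A i j k)
        = of_bool ?b * expec p EV (\<lambda>A. p ^ card (?Y - A))"
      unfolding expec_cmult[symmetric] by (rule expec_cong) (auto simp: triple_weight_def)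
    also have "\<dots> \<le> ?c * (1 / real (card V)) ^ card (i \<union> j \<union> k)"
    proof (cases ?b)
      case True
      then have "r + 1 \<le> card (i \<union> j \<union> k)"
        using triple_card_Un_ge[OF N(1,2), of k] N by (auto simp: nsets_def share_pair_def)
      then have "r * card (i \<union> j \<union> k) + 1 \<le> 2 * card ?Y"
        using True N r by (intro triple_density) auto
      moreover have "card ?Y \<le> 3 * (r choose 2)" using N by (rule triple_edges_le)
      ultimately have "(2 * p) ^ card ?Y \<le> ?c * (1 / real (card V)) ^ card (i \<union> j \<union> k)"
        using weight_le[of "card ?Y" 0 "card (i \<union> j \<union> k)"] by (simp add: mult_ac)
      moreover have "expec p EV (\<lambda>A. p ^ card (?Y - A)) \<le> (2 * p) ^ card ?Y"
        using N nsets2_subset by (intro expec_cover_le) blast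
      ultimately show ?thesis using True by simp
    next
      case False
      then have z: "of_bool ?b = (0::real)" by (simp only: False of_bool_eq)
      show ?thesis unfolding z by simp
    qed
    finally show "expec p EV (\<lambda>A. of_bool (card (i \<union> j \<union> k) \<noteq> r + 1) * triple_weight p A i j k)
      \<le> ?c * (1 / real (card V)) ^ card (i \<union> j \<union> k)" .
  qed
  also have "\<dots> = ?c * (\<Sum>i\<in>?N. \<Sum>j\<in>?N. \<Sum>k\<in>?N. (1 / real (card V)) ^ card (i \<union> j \<union> k))"
    by (simp only: sum_distrib_left)
  also have "\<dots> \<le> ?c * S8"
    using inverse_power_triple_sum[OF V] by (intro mult_left_mono) auto
  finally show ?thesis by (simp add: mult_ac)
qed

lemma expec_pair_sum_le:
  "p ^ (r - 1) * expec p EV (pair_sum V r p) \<le> 2 ^ (3 * (r choose 2) + (r - 1)) * S8 * small"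
proof -
  let ?N = "nsets V r"
  let ?c = "2 ^ (3 * (r choose 2) + (r - 1)) * small"
  let ?g = "\<lambda>i j k. (1 / real (card V)) ^ card (i \<union> j \<union> k)"
  have fN: "finite ?N" using V by (simp add: finite_imp_finite_nsets)
  have "p ^ (r - 1) * expec p EV (pair_sum V r p) = (\<Sum>i\<in>?N. \<Sum>j\<in>?N. p ^ (r - 1) * expec p EV (\<lambda>A. pair_weight p A i j))"
    unfolding pair_sum_def by (simp only: expec_sum sum_distrib_left)
  also have "\<dots> \<le> (\<Sum>i\<in>?N. \<Sum>j\<in>?N. \<Sum>k\<in>?N. ?c * ?g i j k)"
  proof (intro sum_mono)
    fix i j assume N: "i \<in> ?N" "j \<in> ?N"
    let ?Y = "nsets i 2 \<union> nsets j 2"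
    have "expec p EV (\<lambda>A. pair_weight p A i j) = of_bool (share_pair i j) * expec p EV (\<lambda>A. p ^ card (?Y - A))"
      unfolding expec_cmult[symmetric] by (rule expec_cong) (auto simp: pair_weight_def)
    \<comment> \<open>A pair is charged to the degenerate triple \<open>(i, j, j)\<close>, so that
      the count of triples applies.\<close>
    also have "p ^ (r - 1) * \<dots> \<le> ?c * ?g i j j"
    proof (cases "share_pair i j")
      case True
      have "r * card (i \<union> j) + 1 \<le> 2 * (card ?Y + (r - 1))"
        using True N r by (intro pair_density) auto
      moreover have "card ?Y \<le> 3 * (r choose 2)" using triple_edges_le[OF N N(2)] by (simp add: Un_assoc)
      ultimately have "p ^ (r - 1) * (2 * p) ^ card ?Y \<le> ?c * ?g i j j"
        using weight_le[of "card ?Y" "r - 1" "card (i \<union> j)"] by (simp add: mult_ac Un_assoc)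
      moreover have "p ^ (r - 1) * expec p EV (\<lambda>A. p ^ card (?Y - A)) \<le> p ^ (r - 1) * (2 * p) ^ card ?Y"
        using N nsets2_subset p by (intro mult_left_mono expec_cover_le) (blast, simp)
      ultimately show ?thesis using True by simp
    next
      case False
      then show ?thesis by simp
    qed
    also have "\<dots> \<le> (\<Sum>k\<in>?N. ?c * ?g i j k)"
      using N fN by (intro member_le_sum) auto
    finally show "p ^ (r - 1) * expec p EV (\<lambda>A. pair_weight p A i j) \<le> (\<Sum>k\<in>?N. ?c * ?g i j k)" .
  qed
  also have "\<dots> = ?c * (\<Sum>i\<in>?N. \<Sum>j\<in>?N. \<Sum>k\<in>?N. ?g i j k)"
    by (simp only: sum_distrib_left)
  also have "\<dots> \<le> ?c * S8"
    using inverse_power_triple_sum[OF V] by (intro mult_left_mono) auto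
  finally show ?thesis by (simp add: mult_ac)
qed

lemma expec_single_sum_le:
  "p ^ (r - 1) * expec p EV (single_sum V r p) \<le> 2 ^ (3 * (r choose 2) + (r - 1)) * S8 * small"
proof -
  let ?N = "nsets V r"
  let ?c = "2 ^ (3 * (r choose 2) + (r - 1)) * small"
  let ?g = "\<lambda>i j k. (1 / real (card V)) ^ card (i \<union> j \<union> k)"
  have fN: "finite ?N" using V by (simp add: finite_imp_finite_nsets)
  have "p ^ (r - 1) * expec p EV (single_sum V r p) = (\<Sum>i\<in>?N. p ^ (r - 1) * expec p EV (\<lambda>A. p ^ card (nsets i 2 - A)))"
    unfolding single_sum_def by (simp only: expec_sum sum_distrib_left)
  also have "\<dots> \<le> (\<Sum>i\<in>?N. \<Sum>j\<in>?N. \<Sum>k\<in>?N. ?c * ?g i j k)"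
  proof (intro sum_mono)
    fix i assume N: "i \<in> ?N"
    have ci: "card (nsets i 2) = r choose 2" "card i = r" using N card_nsets[of i 2] by (auto simp: nsets_def)
    have "p ^ (r - 1) * expec p EV (\<lambda>A. p ^ card (nsets i 2 - A)) \<le> p ^ (r - 1) * (2 * p) ^ (r choose 2)"
      using N nsets2_subset p expec_cover_le[of "nsets i 2"] ci by (intro mult_left_mono) auto
    \<comment> \<open>The degenerate triple is \<open>(i, i, i)\<close>; the excess -r of one clique
      is lifted to r - 2 by the \<open>r - 1\<close> extra factors.\<close>
    also have "\<dots> \<le> ?c * ?g i i i"
    proof -
      have "r * r + 1 \<le> 2 * ((r choose 2) + (r - 1))"
        using two_choose_two[of r] r by (cases r) auto
      then show ?thesis using weight_le[of "r choose 2" "r - 1" r] ci by (simp add: mult_ac)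
    qed
    also have "\<dots> \<le> (\<Sum>k\<in>?N. ?c * ?g i i k)"
      using N fN by (intro member_le_sum) auto
    also have "\<dots> \<le> (\<Sum>j\<in>?N. \<Sum>k\<in>?N. ?c * ?g i j k)"
      using N fN by (intro member_le_sum[of i ?N "\<lambda>j. \<Sum>k\<in>?N. ?c * ?g i j k"]) (auto intro!: sum_nonneg)
    finally show "p ^ (r - 1) * expec p EV (\<lambda>A. p ^ card (nsets i 2 - A)) \<le> (\<Sum>j\<in>?N. \<Sum>k\<in>?N. ?c * ?g i j k)" .
  qed
  also have "\<dots> = ?c * (\<Sum>i\<in>?N. \<Sum>j\<in>?N. \<Sum>k\<in>?N. ?g i j k)"
    by (simp only: sum_distrib_left)
  also have "\<dots> \<le> ?c * S8"
    using inverse_power_triple_sum[OF V] by (intro mult_left_mono) auto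
  finally show ?thesis by (simp add: mult_ac)
qed

section \<open>Conditional excess and variance of the number of cliques\<close>

lemma kappa_nonneg: "0 \<le> kappa n r p"
  unfolding kappa_def using p by (intro sum_nonneg mult_nonneg_nonneg) (auto intro!: power_decreasing)

lemma kappa_le_sum:
  "kappa (card V) r p \<le> 2 ^ r * (\<Sum>s = 2..r - 1. real (card V) ^ (r - s) * p ^ ((r choose 2) - (s choose 2)))"
  unfolding kappa_def sum_distrib_left
proof (rule sum_mono)
  fix s assume s: "s \<in> {2..r - 1}"
  have c1: "real (r choose s) \<le> 2 ^ r" using binomial_le_pow2[of r s] by (metis of_nat_le_iff of_nat_numeral of_nat_power)
  have c2: "real ((card V - r) choose (r - s)) \<le> real (card V) ^ (r - s)"
  proof (cases "r - s \<le> card V - r")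
    case True
    then have "(card V - r) choose (r - s) \<le> (card V - r) ^ (r - s)" by (rule binomial_le_pow)
    also have "\<dots> \<le> card V ^ (r - s)" by (intro power_mono) auto
    finally show ?thesis by (metis of_nat_le_iff of_nat_power)
  next
    case False
    then show ?thesis by (simp add: binomial_eq_0)
  qed
  have "real (r choose s) * real ((card V - r) choose (r - s)) * (p ^ ((r choose 2) - (s choose 2)) - p ^ (r choose 2))
    \<le> (2 ^ r * real (card V) ^ (r - s)) * p ^ ((r choose 2) - (s choose 2))"
    using c1 c2 p by (intro mult_mono) (auto intro!: power_decreasing)
  then show "real (r choose s) * real ((card V - r) choose (r - s)) * (p ^ ((r choose 2) - (s choose 2)) - p ^ (r choose 2))
    \<le> 2 ^ r * (real (card V) ^ (r - s) * p ^ ((r choose 2) - (s choose 2)))"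
    by (simp add: mult_ac)
qed

lemma card_power_le:
  assumes "m \<le> 2 * r\<^sup>2" "r * v + 1 \<le> 2 * m"
  shows "real (card V) ^ v * p ^ m \<le> small"
proof -
  have "real (card V) ^ v * p ^ m \<le> real (card V) ^ v * ((1 / real (card V)) ^ v * small)"
    using r V p p_small assms by (intro mult_left_mono power_bound) auto
  also have "\<dots> = (real (card V) * (1 / real (card V))) ^ v * small"
    by (simp only: power_mult_distrib mult.assoc)
  also have "\<dots> = small" using V by simp
  finally show ?thesis .
qed

text \<open>Relative to a fixed clique, one attached clique gains s(r + 1 - s) - r, at least r - 2
  by \<open>overlap_ineq\<close>.\<close>

lemma excess_density:
  assumes "s \<in> {2..r - 1}"
  shows "int r * int (r - s) + int r - 2 \<le> 2 * int ((r choose 2) - (s choose 2))"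
proof -
  have s: "2 \<le> s" "s < r" using assms r by auto
  have "s choose 2 \<le> r choose 2" using s by (intro choose_two_mono) auto
  then have "2 * int ((r choose 2) - (s choose 2)) = int r * (int r - 1) - int s * (int s - 1)"
    using int_two_choose_two[of r] int_two_choose_two[of s] by (simp add: of_nat_diff)
  moreover have "int r * int (r - s) = int r * int r - int r * int s"
    using s by (simp add: of_nat_diff right_diff_distrib)
  ultimately show ?thesis using overlap_ineq[OF s] by (simp add: algebra_simps)
qed

lemma kappa_le: "kappa (card V) r p \<le> 2 ^ r * real r"
proof -
  have sm: "small \<le> 1" using powr_mono[of "- 3 * gamma_exponent r" 0 "real (card V)"] V gamma_exponent_pos[of r] r
    by (auto split: if_splits)
  have "real (card V) ^ (r - s) * p ^ ((r choose 2) - (s choose 2)) \<le> 1" if "s \<in> {2..r - 1}" for s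
  proof -
    have "int (r * (r - s) + 1) \<le> int (2 * ((r choose 2) - (s choose 2)))"
      using excess_density[OF that] r by simp
    then have "r * (r - s) + 1 \<le> 2 * ((r choose 2) - (s choose 2))" by (simp only: of_nat_le_iff)
    moreover have "(r choose 2) - (s choose 2) \<le> 2 * r\<^sup>2" using edge_bound by linarith
    ultimately show ?thesis using card_power_le sm by fastforce
  qed
  then have "(\<Sum>s = 2..r - 1. real (card V) ^ (r - s) * p ^ ((r choose 2) - (s choose 2))) \<le> (\<Sum>s = 2..r - 1. 1)"
    by (intro sum_mono)
  also have "\<dots> \<le> real r" using r by simp
  finally have "2 ^ r * (\<Sum>s = 2..r - 1. real (card V) ^ (r - s) * p ^ ((r choose 2) - (s choose 2))) \<le> 2 ^ r * real r"
    by (intro mult_left_mono) auto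
  then show ?thesis using kappa_le_sum by linarith
qed

lemma mu_le: "mu (card V) p r \<le> real (card V) ^ r * p ^ (r choose 2)"
proof -
  have "real (card V choose r) \<le> real (card V) ^ r"
  proof (cases "r \<le> card V")
    case True
    then show ?thesis using binomial_le_pow by (metis of_nat_le_iff of_nat_power)
  next
    case False
    then show ?thesis by (simp add: binomial_eq_0)
  qed
  then show ?thesis unfolding mu_def using p by (intro mult_right_mono) auto
qed

text \<open>Expanding the square gives one base clique with two cliques attached; the excess is at
  least -r + 2(r - 2) = r - 4, as for chained triples.\<close>

lemma mu_kappa_sq_le: "mu (card V) p r * (kappa (card V) r p)\<^sup>2 \<le> 4 ^ r * (real r)\<^sup>2 * small"
proof -
  let ?S = "{2..r - 1}"
  let ?x = "\<lambda>s. real (card V) ^ (r - s) * p ^ ((r choose 2) - (s choose 2))"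
  let ?m = "real (card V) ^ r * p ^ (r choose 2)"
  have "(kappa (card V) r p)\<^sup>2 \<le> (2 ^ r * (\<Sum>s\<in>?S. ?x s))\<^sup>2"
    using kappa_le_sum kappa_nonneg by (intro power_mono) auto
  also have "\<dots> = 4 ^ r * (\<Sum>s\<in>?S. \<Sum>t\<in>?S. ?x s * ?x t)"
  proof -
    have "(2 ^ r)\<^sup>2 = (4::real) ^ r" by (simp add: power_mult[symmetric] mult.commute[of r] power_mult)
    then show ?thesis by (simp only: power_mult_distrib power2_eq_square[of "\<Sum>s\<in>?S. ?x s"] sum_product)
  qed
  finally have k: "(kappa (card V) r p)\<^sup>2 \<le> 4 ^ r * (\<Sum>s\<in>?S. \<Sum>t\<in>?S. ?x s * ?x t)" .
  have "mu (card V) p r * (kappa (card V) r p)\<^sup>2 \<le> ?m * (4 ^ r * (\<Sum>s\<in>?S. \<Sum>t\<in>?S. ?x s * ?x t))"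
    using mu_le k p by (intro mult_mono) auto
  also have "\<dots> = 4 ^ r * (\<Sum>s\<in>?S. \<Sum>t\<in>?S. ?m * (?x s * ?x t))"
    by (simp only: sum_distrib_left mult.left_commute)
  also have "\<dots> \<le> 4 ^ r * (\<Sum>s\<in>?S. \<Sum>t\<in>?S. small)"
  proof (intro mult_left_mono sum_mono)
    fix s t assume st: "s \<in> ?S" "t \<in> ?S"
    let ?v = "r + (r - s) + (r - t)"
    let ?e = "(r choose 2) + ((r choose 2) - (s choose 2)) + ((r choose 2) - (t choose 2))"
    have "int r * int ?v = int r * int r + int r * int (r - s) + int r * int (r - t)"
      by (simp only: of_nat_add distrib_left)
    moreover have "2 * int ?e = int r * (int r - 1) + 2 * int ((r choose 2) - (s choose 2)) + 2 * int ((r choose 2) - (t choose 2))"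
      using int_two_choose_two[of r] by simp
    moreover have "int r * (int r - 1) = int r * int r - int r" by (simp add: algebra_simps)
    ultimately have "int r * int ?v + 1 \<le> 2 * int ?e"
      using excess_density[OF st(1)] excess_density[OF st(2)] r by linarith
    then have "int (r * ?v + 1) \<le> int (2 * ?e)" by simp
    then have "r * ?v + 1 \<le> 2 * ?e" by (simp only: of_nat_le_iff)
    moreover have "?e \<le> 2 * r\<^sup>2" using edge_bound by linarith
    ultimately have "real (card V) ^ ?v * p ^ ?e \<le> small" by (intro card_power_le)
    then show "?m * (?x s * ?x t) \<le> small" by (simp add: power_add mult_ac)
  qed auto
  also have "\<dots> = 4 ^ r * ((real (r - 2))\<^sup>2 * small)" using r by (simp add: power2_eq_square)
  also have "\<dots> \<le> 4 ^ r * ((real r)\<^sup>2 * small)"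
    by (intro mult_left_mono mult_right_mono power_mono) auto
  finally show ?thesis by (simp add: mult_ac)
qed

text \<open>The unconditioned model is \<open>clique_config\<close> with \<open>\<H>\<close> and
  \<open>F\<close> empty, so \<open>Lambda_eq_sum\<close> evaluates the covariances of linked
  cliques as \<open>mu\<close> times \<open>kappa\<close>. Unlinked ones vanish, and the diagonal
  adds at most \<open>mu\<close>.\<close>

lemma variance_le:
  assumes p': "0 < p" "p \<le> 1 / 2"
  shows "expec p EV (\<lambda>A. (real (card {i\<in>nsets V r. nsets i 2 \<subseteq> A}) - mu (card V) p r)\<^sup>2)
    \<le> mu (card V) p r * (1 + kappa (card V) r p)"
proof -
  interpret clique_config V r p "{}" "{}"
  proof
    fix i assume i: "i \<in> nsets V r" "nsets i 2 \<subseteq> {}"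
    then have "card (nsets i 2) = 0" by (simp only: subset_empty card.empty)
    then have "r choose 2 = 0" using i card_nsets[of i 2] by (simp add: nsets_def)
    then show "i \<in> {}" using r by simp
  qed (use V r p' in auto)
  let ?X = "\<lambda>i A. of_bool (nsets i 2 \<subseteq> A) :: real"
  have fE: "finite EV" using V by (simp add: finite_imp_finite_nsets)
  have cover: "expec p EV (\<lambda>A. of_bool (Y \<subseteq> A)) = p ^ card Y" if "Y \<subseteq> EV" for Y
    using expec_superset_eq[OF fE that, of "\<lambda>_. True" p] fE by (simp add: expec_const)
  have e1: "expec p EV (?X i) = q" if "i \<in> N" for i
    using cover[of "nsets i 2"] nsets2_subset that card_pairs by auto
  have e2: "expec p EV (\<lambda>A. ?X i A * ?X j A) = p ^ card (nsets i 2 \<union> nsets j 2)" if "i \<in> N" "j \<in> N" for i j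
  proof -
    have "expec p EV (\<lambda>A. ?X i A * ?X j A) = expec p EV (\<lambda>A. of_bool (nsets i 2 \<union> nsets j 2 \<subseteq> A))"
      by (intro expec_cong) auto
    also have "\<dots> = p ^ card (nsets i 2 \<union> nsets j 2)"
      using that nsets2_subset by (intro cover) blast
    finally show ?thesis .
  qed
  have count: "real (card {i\<in>N. nsets i 2 \<subseteq> A}) = (\<Sum>i\<in>N. ?X i A)" for A
    using fin_N by (simp add: Int_def)
  have mu: "\<mu> = (\<Sum>i\<in>N. q)" by (simp add: mu_def card_nsets)
  have "expec p EV (\<lambda>A. (real (card {i\<in>N. nsets i 2 \<subseteq> A}) - \<mu>)\<^sup>2)
      = expec p EV (\<lambda>A. \<Sum>i\<in>N. \<Sum>j\<in>N. (?X i A - q) * (?X j A - q))"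
    unfolding count mu power2_eq_square sum_subtractf[symmetric] sum_product ..
  also have "\<dots> = (\<Sum>i\<in>N. \<Sum>j\<in>N. expec p EV (\<lambda>A. (?X i A - q) * (?X j A - q)))"
    by (simp only: expec_sum)
  also have "\<dots> = (\<Sum>i\<in>N. \<Sum>j\<in>N. p ^ card (nsets i 2 \<union> nsets j 2) - q\<^sup>2)"
  proof (intro sum.cong refl)
    fix i j assume ij: "i \<in> N" "j \<in> N"
    have "expec p EV (\<lambda>A. (?X i A - q) * (?X j A - q))
        = expec p EV (\<lambda>A. (?X i A * ?X j A - q * ?X i A) - (q * ?X j A - q * q))"
      by (intro expec_cong) (simp add: algebra_simps)
    also have "\<dots> = p ^ card (nsets i 2 \<union> nsets j 2) - q\<^sup>2"
      unfolding expec_diff expec_cmult using ij fE by (simp only: e1 e2 expec_const) (simp add: power2_eq_square)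
    finally show "expec p EV (\<lambda>A. (?X i A - q) * (?X j A - q)) = p ^ card (nsets i 2 \<union> nsets j 2) - q\<^sup>2" .
  qed
  also have "\<dots> \<le> (\<Sum>i\<in>N. \<Sum>j\<in>N. of_bool (i = j) * q
      + of_bool (share_pair i j) * (p ^ card (nsets i 2 \<union> nsets j 2) - q\<^sup>2))"
  proof (intro sum_mono)
    fix i j assume ij: "i \<in> N" "j \<in> N"
    consider "i = j" | "i \<noteq> j" "share_pair i j" | "i \<noteq> j" "\<not> share_pair i j" by blast
    then show "p ^ card (nsets i 2 \<union> nsets j 2) - q\<^sup>2 \<le> of_bool (i = j) * q
      + of_bool (share_pair i j) * (p ^ card (nsets i 2 \<union> nsets j 2) - q\<^sup>2)"
    proof cases
      case 1
      then show ?thesis using card_pairs ij by (simp add: share_pair_def)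
    next
      case 3
      then have "nsets i 2 \<inter> nsets j 2 = {}" using not_share_disjoint ij by blast
      then have "card (nsets i 2 \<union> nsets j 2) = 2 * (r choose 2)"
        using fin_pairs card_pairs ij by (simp add: card_Un_disjoint)
      then have "p ^ card (nsets i 2 \<union> nsets j 2) = q\<^sup>2" by (simp add: power_mult mult.commute[of 2])
      then show ?thesis using 3 by simp
    qed simp
  qed
  also have "\<dots> = \<mu> + 2 * \<Lambda>"
    unfolding Lambda_eq_sum sum.distrib mu using fin_N by simp
  also have "\<dots> = \<mu> * (1 + \<kappa>)" using Lambda_eq_kappa[OF p'(1), of "card V" r] by (simp add: distrib_left)
  finally show ?thesis .
qed

end

section \<open>The typical hypergraphs\<close>

text \<open>All sums are evaluated at the covered pairs, so membership depends on \<open>H\<close>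
  alone. The existence clause keeps only hypergraphs that occur as clique hypergraphs, as
  \<open>prob_clique_hypergraph_eq\<close> requires.\<close>

definition typical :: "nat \<Rightarrow> nat \<Rightarrow> real \<Rightarrow> real \<Rightarrow> nat hypergraph set" where
  "typical r n p w = {H.
    (\<exists>A \<subseteq> nsets {1..n} 2. H = clique_hypergraph r ({1..n}, A)) \<and>
    tight_sum {1..n} r p (edges (shadow_graph H)) \<le> w * mu n p (r + 1) \<and>
    loose_sum {1..n} r p (edges (shadow_graph H)) \<le> real n powr (- gamma_exponent r) \<and>
    p ^ (r - 1) * single_sum {1..n} r p (edges (shadow_graph H)) \<le> real n powr (- gamma_exponent r) \<and>
    p ^ (r - 1) * pair_sum {1..n} r p (edges (shadow_graph H)) \<le> real n powr (- gamma_exponent r) \<and>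
    \<bar>real (num_edges H) - mu n p r\<bar> * kappa n r p \<le> real n powr (- gamma_exponent r)}"

lemma typicalD:
  assumes "H \<in> typical r n p w"
  shows "verts H = {1..n}" "uniform_hypergraph r H"
  using assms by (auto simp: typical_def clique_hypergraph_def uniform_hypergraph_def)

lemma power_card_diff_antimono:
  fixes p :: real
  assumes "0 \<le> p" "p \<le> 1" "F \<subseteq> A" "finite Y"
  shows "p ^ card (Y - F) \<le> p ^ card (Y - A)"
  using assms by (intro power_decreasing card_mono) auto

text \<open>A larger second set lowers the exponents of \<open>p \<le> 1\<close>. Bounds for the
  random edge set thus pass to the covered pairs inside it.\<close>

lemma overlap_sums_antimono:
  assumes "0 \<le> p" "p \<le> 1" "F \<subseteq> A"
  shows "tight_sum V r p F \<le> tight_sum V r p A" "loose_sum V r p F \<le> loose_sum V r p A"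
    "pair_sum V r p F \<le> pair_sum V r p A" "single_sum V r p F \<le> single_sum V r p A"
proof -
  have fin: "finite (nsets i 2)" if "i \<in> nsets V r" for i
    using that by (simp add: nsets_def finite_imp_finite_nsets[unfolded nsets_def])
  have t: "triple_weight p F i j k \<le> triple_weight p A i j k"
    if "i \<in> nsets V r" "j \<in> nsets V r" "k \<in> nsets V r" for i j k
    unfolding triple_weight_def using assms fin that
    by (intro mult_left_mono power_card_diff_antimono) auto
  show "tight_sum V r p F \<le> tight_sum V r p A" "loose_sum V r p F \<le> loose_sum V r p A"
    unfolding tight_sum_def loose_sum_def by (intro sum_mono mult_left_mono t; simp)+
  show "pair_sum V r p F \<le> pair_sum V r p A"
    unfolding pair_sum_def pair_weight_def using assms fin
    by (intro sum_mono mult_left_mono power_card_diff_antimono) auto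
  show "single_sum V r p F \<le> single_sum V r p A"
    unfolding single_sum_def using assms fin
    by (intro sum_mono power_card_diff_antimono) auto
qed

lemma clique_hypergraph_in_typical:
  assumes A: "A \<subseteq> nsets {1..n} 2" and p: "0 \<le> p" "p \<le> 1"
    and "tight_sum {1..n} r p A \<le> w * mu n p (r + 1)"
    and "loose_sum {1..n} r p A \<le> real n powr (- gamma_exponent r)"
    and "p ^ (r - 1) * single_sum {1..n} r p A \<le> real n powr (- gamma_exponent r)"
    and "p ^ (r - 1) * pair_sum {1..n} r p A \<le> real n powr (- gamma_exponent r)"
    and "\<bar>real (card {i\<in>nsets {1..n} r. nsets i 2 \<subseteq> A}) - mu n p r\<bar> * kappa n r p \<le> real n powr (- gamma_exponent r)"
  shows "clique_hypergraph r ({1..n}, A) \<in> typical r n p w"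
proof -
  define V where "V = {1..n}"
  define H where "H = clique_hypergraph r (V, A)"
  have H: "H = (V, {S\<in>nsets V r. nsets S 2 \<subseteq> A})"
    unfolding H_def using A by (intro clique_hypergraph_eq) (auto simp: V_def)
  have "uniform_hypergraph r H" by (auto simp: H uniform_hypergraph_def)
  then have "edges (shadow_graph H) = (\<Union>h\<in>edges H. nsets h 2)" by (rule edges_shadow_graph)
  then have sub: "edges (shadow_graph H) \<subseteq> A" by (auto simp: H)
  have ne: "num_edges H = card {i\<in>nsets V r. nsets i 2 \<subseteq> A}" by (simp add: H num_edges_def)
  note mono = overlap_sums_antimono[OF p sub, where V = V and r = r]
  have pr: "0 \<le> p ^ (r - 1)" using p by simp
  have "H \<in> typical r n p w"
    unfolding typical_def V_def[symmetric]
  proof (intro CollectI conjI)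
    show "\<exists>A\<subseteq>nsets V 2. H = clique_hypergraph r (V, A)" using A by (auto simp: V_def H_def)
  qed (use assms(4-) mono mult_left_mono[OF mono(3) pr] mult_left_mono[OF mono(4) pr] ne
      in \<open>auto simp: V_def intro: order_trans\<close>)
  then show ?thesis by (simp add: H_def V_def)
qed

text \<open>A union bound over five failures, four by Markov. The fifth is squared as in Chebyshev's
  inequality: mean of order n^(-3g) against threshold n^(-2g) leaves n^(-g), which is where all
  three multiples of g are used.\<close>

lemma prob_typical_ge:
  assumes r: "5 \<le> r" and n: "r + 1 \<le> n" and p: "0 < p" "p \<le> 1 / 2"
    and p_small: "p \<le> real n powr (- 2 / real r + gamma_exponent r)" and w: "0 < w"
  defines "c1 \<equiv> 8 ^ (r + 1) * 2 ^ ((r + 1) choose 2)"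
    and "c2 \<equiv> 2 ^ (3 * (r choose 2) + (r - 1)) * (\<Sum>v\<le>3 * r. 8 ^ v)"
    and "c3 \<equiv> 4 ^ r * (real r)\<^sup>2 * (1 + 2 ^ r * real r)"
  shows "1 - (c1 / w + (3 * c2 + c3) * real n powr (- gamma_exponent r))
    \<le> measure_pmf.prob (random_graph n p) {G. clique_hypergraph r G \<in> typical r n p w}"
proof -
  define V where "V = {1..n}"
  let ?E = "nsets V 2"
  let ?g = "gamma_exponent r"
  let ?z = "real n powr (- ?g)"
  let ?small = "real n powr (- 3 * ?g)"
  let ?e = "\<lambda>A. real (card {i\<in>nsets V r. nsets i 2 \<subseteq> A})"
  have V: "finite V" "1 \<le> card V" and cV: "card V = n" using n by (auto simp: V_def)
  have p01: "0 \<le> p" "p \<le> 1" using p by auto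
  have ps: "p \<le> real (card V) powr (- 2 / real r + ?g)" using p_small cV by simp
  have g: "0 < ?g" using r by (intro gamma_exponent_pos) auto
  have n1: "1 \<le> real n" "0 < real n" using n by auto
  have z: "0 < ?z" "?z\<^sup>2 = real n powr (- 2 * ?g)"
    using n1 by (auto simp: power2_eq_square powr_add[symmetric])
  \<comment> \<open>Positivity, guaranteed by \<open>r + 1 \<le> n\<close>, lets \<open>mu\<close>
    cancel in the Markov quotient, leaving \<open>c1 / w\<close> whatever the size of
    \<open>mu\<close>.\<close>
  have mu_pos: "0 < mu n p (r + 1)" unfolding mu_def using p n by (simp add: zero_less_binomial)
  have fE: "finite ?E" using V by (simp add: finite_imp_finite_nsets)
  have sz: "?small / ?z \<le> ?z"
  proof -
    have "?small \<le> real n powr (- 2 * ?g)" using n1 g by (intro powr_mono) auto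
    then show ?thesis using z by (simp add: pos_divide_le_eq power2_eq_square)
  qed
  have c2: "0 \<le> c2" unfolding c2_def by (intro mult_nonneg_nonneg sum_nonneg) auto
  have ktop: "0 \<le> kappa n r p" "kappa n r p \<le> 2 ^ r * real r"
    using kappa_nonneg[OF V r p01 ps] kappa_le[OF V r p01 ps] cV by auto
  have pr: "0 \<le> p ^ (r - 1)" using p by simp

  define b1 where "b1 = (\<lambda>A. of_bool (w * mu n p (r + 1) < tight_sum V r p A) :: real)"
  define b2 where "b2 = (\<lambda>A. of_bool (?z < loose_sum V r p A) :: real)"
  define b3 where "b3 = (\<lambda>A. of_bool (?z < p ^ (r - 1) * single_sum V r p A) :: real)"
  define b4 where "b4 = (\<lambda>A. of_bool (?z < p ^ (r - 1) * pair_sum V r p A) :: real)"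
  define b5 where "b5 = (\<lambda>A. of_bool (?z\<^sup>2 < (kappa n r p)\<^sup>2 * (?e A - mu n p r)\<^sup>2) :: real)"

  have nn: "0 \<le> tight_sum V r p A" "0 \<le> loose_sum V r p A" "0 \<le> single_sum V r p A" "0 \<le> pair_sum V r p A" for A
    unfolding tight_sum_def loose_sum_def single_sum_def pair_sum_def triple_weight_def pair_weight_def
    using p01 by (auto intro!: sum_nonneg)

  have m1: "expec p ?E b1 \<le> c1 / w"
  proof -
    have "expec p ?E b1 \<le> expec p ?E (tight_sum V r p) / (w * mu n p (r + 1))"
      unfolding b1_def using p01 w mu_pos nn by (intro markov_expec) auto
    also have "\<dots> \<le> (c1 * mu n p (r + 1)) / (w * mu n p (r + 1))"
      using expec_tight_sum_le[OF V r p01 ps] w mu_pos cV by (intro divide_right_mono) (auto simp: c1_def)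
    also have "\<dots> = c1 / w" using mu_pos by simp
    finally show ?thesis .
  qed
  have small_markov: "expec p ?E (\<lambda>A. of_bool (?z < \<phi> A)) \<le> c2 * ?z"
    if "\<And>A. 0 \<le> \<phi> A" "expec p ?E \<phi> \<le> c2 * ?small" for \<phi>
  proof -
    have "expec p ?E (\<lambda>A. of_bool (?z < \<phi> A)) \<le> expec p ?E \<phi> / ?z"
      using p01 z that by (intro markov_expec) auto
    also have "\<dots> \<le> (c2 * ?small) / ?z" using that z by (intro divide_right_mono) auto
    also have "\<dots> = c2 * (?small / ?z)" by simp
    also have "\<dots> \<le> c2 * ?z" using sz c2 by (intro mult_left_mono)
    finally show ?thesis .
  qed
  have m2: "expec p ?E b2 \<le> c2 * ?z"
    unfolding b2_def using nn expec_loose_sum_le[OF V r p01 ps] cV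
    by (intro small_markov) (auto simp: c2_def)
  have m3: "expec p ?E b3 \<le> c2 * ?z"
    unfolding b3_def using nn expec_single_sum_le[OF V r p01 ps] cV p01
    by (intro small_markov) (auto simp: c2_def expec_cmult)
  have m4: "expec p ?E b4 \<le> c2 * ?z"
    unfolding b4_def using nn expec_pair_sum_le[OF V r p01 ps] cV p01
    by (intro small_markov) (auto simp: c2_def expec_cmult)
  have m5: "expec p ?E b5 \<le> c3 * ?z"
  proof -
    have "expec p ?E b5 \<le> expec p ?E (\<lambda>A. (kappa n r p)\<^sup>2 * (?e A - mu n p r)\<^sup>2) / ?z\<^sup>2"
      unfolding b5_def using p01 z by (intro markov_expec) auto
    also have "expec p ?E (\<lambda>A. (kappa n r p)\<^sup>2 * (?e A - mu n p r)\<^sup>2)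
        = (kappa n r p)\<^sup>2 * expec p ?E (\<lambda>A. (?e A - mu n p r)\<^sup>2)" by (rule expec_cmult)
    also have "\<dots> \<le> (kappa n r p)\<^sup>2 * (mu n p r * (1 + kappa n r p))"
      using variance_le[OF V r p01 ps p] cV by (intro mult_left_mono) auto
    also have "\<dots> = (mu n p r * (kappa n r p)\<^sup>2) * (1 + kappa n r p)" by (simp add: mult_ac)
    also have "\<dots> \<le> (4 ^ r * (real r)\<^sup>2 * ?small) * (1 + 2 ^ r * real r)"
    proof (rule mult_mono)
      show "mu n p r * (kappa n r p)\<^sup>2 \<le> 4 ^ r * (real r)\<^sup>2 * ?small"
        using mu_kappa_sq_le[OF V r p01 ps] cV by simp
    qed (use ktop in auto)
    also have "\<dots> = c3 * ?small" by (simp add: c3_def mult_ac)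
    finally have "expec p ?E b5 \<le> c3 * ?small / ?z\<^sup>2" using z by (simp add: divide_right_mono)
    also have "?small = ?z * ?z\<^sup>2" unfolding z(2) powr_add[symmetric] by simp
    also have "c3 * (?z * ?z\<^sup>2) / ?z\<^sup>2 = c3 * ?z" using z(1) by simp
    finally show ?thesis .
  qed

  have "1 - (c1 / w + (3 * c2 + c3) * ?z) \<le> 1 - expec p ?E b1 - expec p ?E b2 - expec p ?E b3 - expec p ?E b4 - expec p ?E b5"
    using m1 m2 m3 m4 m5 by (simp add: algebra_simps)
  also have "\<dots> = expec p ?E (\<lambda>A. 1 - b1 A - b2 A - b3 A - b4 A - b5 A)"
    by (simp only: expec_diff expec_const[OF fE])
  also have "\<dots> \<le> expec p ?E (\<lambda>A. of_bool (clique_hypergraph r ({1..n}, A) \<in> typical r n p w))"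
  proof (rule expec_mono[OF p01])
    fix A assume A: "A \<subseteq> ?E"
    \<comment> \<open>The left side is 1 if no failure occurs and at most 0 otherwise.\<close>
    show "1 - b1 A - b2 A - b3 A - b4 A - b5 A \<le> of_bool (clique_hypergraph r ({1..n}, A) \<in> typical r n p w)"
    proof (cases "b1 A = 0 \<and> b2 A = 0 \<and> b3 A = 0 \<and> b4 A = 0 \<and> b5 A = 0")
      case True
      then have b5: "(kappa n r p)\<^sup>2 * (?e A - mu n p r)\<^sup>2 \<le> ?z\<^sup>2"
        by (auto simp: b5_def)
      have "(\<bar>?e A - mu n p r\<bar> * kappa n r p)\<^sup>2 \<le> ?z\<^sup>2"
        using b5 by (simp only: power_mult_distrib power2_abs mult.commute)
      then have "\<bar>?e A - mu n p r\<bar> * kappa n r p \<le> ?z"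
        by (rule power2_le_imp_le[OF _ less_imp_le[OF z(1)]])
      then have "clique_hypergraph r ({1..n}, A) \<in> typical r n p w"
        unfolding V_def using True A p01
        by (intro clique_hypergraph_in_typical) (simp_all add: b1_def b2_def b3_def b4_def V_def)
      then show ?thesis using True by simp
    next
      case False
      then show ?thesis by (auto simp: b1_def b2_def b3_def b4_def b5_def)
    qed
  qed
  also have "\<dots> = measure_pmf.prob (random_graph n p) {G. clique_hypergraph r G \<in> typical r n p w}"
    unfolding V_def by (rule prob_random_graph[OF p01, symmetric])
  finally show ?thesis .
qed

text \<open>The constant 28 is 7 * 4: of the five errors limited in \<open>typical\<close>, four are
  bounded by the power of \<open>n\<close> and one by \<open>w\<close> times
  \<open>mu\<close>.\<close>

lemma prob_eq_of_typical:
  assumes H: "H \<in> typical r n p w" and r: "3 \<le> r" and p: "0 < p" "p \<le> 1 / 2" and w: "0 \<le> w"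
  shows "\<exists>\<delta>. \<bar>\<delta>\<bar> \<le> 28 * (w * mu n p (r + 1) + real n powr (- gamma_exponent r)) \<and>
    measure_pmf.prob (random_graph n p) {G. clique_hypergraph r G = H} =
      (let q = p ^ (r choose 2) in
        q ^ num_edges H * (1 - q) ^ ((n choose r) - num_edges H) * p powi (- edge_overlap r H)
          * exp (- Lambda n r p + \<delta>))"
proof -
  let ?F = "edges (shadow_graph H)"
  obtain A where "A \<subseteq> nsets {1..n} 2" "H = clique_hypergraph r ({1..n}, A)"
    using H by (auto simp: typical_def)
  then obtain \<delta> where \<delta>: "\<bar>\<delta>\<bar> \<le> 7 * (triple_sum {1..n} r p ?F
      + p ^ (r - 1) * (single_sum {1..n} r p ?F + pair_sum {1..n} r p ?F)
      + \<bar>real (num_edges H) - mu n p r\<bar> * kappa n r p)"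
    "measure_pmf.prob (random_graph n p) {G. clique_hypergraph r G = H}
      = (let q = p ^ (r choose 2) in
          q ^ num_edges H * (1 - q) ^ ((n choose r) - num_edges H) * p powi (- edge_overlap r H)
            * exp (- Lambda n r p + \<delta>))"
    by (rule prob_clique_hypergraph_eq[OF p r])
  have "0 \<le> w * mu n p (r + 1)" using w p by (simp add: mu_def)
  then have "\<bar>\<delta>\<bar> \<le> 28 * (w * mu n p (r + 1) + real n powr (- gamma_exponent r))"
    using \<delta>(1) H unfolding typical_def mem_Collect_eq triple_sum_split distrib_left by linarith
  then show ?thesis using \<delta>(2) by blast
qed

theorem theorem1p1:
  fixes r :: nat
  assumes "r \<ge> 5"
  shows "\<exists>\<gamma>::real. \<gamma> > 0 \<and>
    (\<forall>p :: nat \<Rightarrow> real.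
      (\<forall>n. 0 \<le> p n \<and> p n \<le> 1) \<longrightarrow>
      (\<forall>n\<ge>1. p n \<le> real n powr (- 2 / real r + \<gamma>)) \<longrightarrow>
      filterlim (\<lambda>n. mu n (p n) r) at_top sequentially \<longrightarrow>
      (\<exists>C::real. \<forall>\<omega> :: nat \<Rightarrow> real. filterlim \<omega> at_top sequentially \<longrightarrow>
        (\<exists>\<G> :: nat \<Rightarrow> nat hypergraph set.
          (\<forall>n. \<forall>H\<in>\<G> n. verts H = {1..n} \<and> uniform_hypergraph r H) \<and>
          (\<lambda>n. measure_pmf.prob (random_graph n (p n)) {G. clique_hypergraph r G \<in> \<G> n})
            \<longlonglongrightarrow> 1 \<and>
          (\<forall>n\<ge>1. \<forall>H\<in>\<G> n. \<exists>\<delta>::real.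
            \<bar>\<delta>\<bar> \<le> C * (\<omega> n * mu n (p n) (r + 1) + real n powr (- \<gamma>)) \<and>
            measure_pmf.prob (random_graph n (p n)) {G. clique_hypergraph r G = H} =
              (let q = p n ^ (r choose 2) in
                q ^ num_edges H * (1 - q) ^ ((n choose r) - num_edges H)
                * p n powi (- edge_overlap r H)
                * exp (- Lambda n r (p n) + \<delta>))))))"
proof (rule exI[of _ "gamma_exponent r"], intro conjI allI impI)
  let ?g = "gamma_exponent r"
  show g: "0 < ?g" using assms by (intro gamma_exponent_pos) auto
  fix p :: "nat \<Rightarrow> real"
  assume p01: "\<forall>n. 0 \<le> p n \<and> p n \<le> 1" and ps: "\<forall>n\<ge>1. p n \<le> real n powr (- 2 / real r + ?g)"
    and mu: "filterlim (\<lambda>n. mu n (p n) r) at_top sequentially"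
  have "?g \<le> 1 / real r"
    unfolding gamma_exponent_def using assms by (intro divide_left_mono) (auto intro!: mult_pos_pos add_nonneg_pos)
  also have "\<dots> < 2 / real r" using assms by (intro divide_strict_right_mono) auto
  finally have neg: "- 2 / real r + ?g < 0" by simp
  have nat_top: "filterlim real at_top sequentially" by (rule filterlim_real_sequentially)
  have "(\<lambda>n. real n powr (- 2 / real r + ?g)) \<longlonglongrightarrow> 0"
    using neg nat_top by (rule tendsto_neg_powr)
  then have "\<forall>\<^sub>F n in sequentially. real n powr (- 2 / real r + ?g) < 1 / 2"
    by (rule order_tendstoD) simp
  then have ev_half: "\<forall>\<^sub>F n in sequentially. p n \<le> 1 / 2"
    using eventually_ge_at_top[of 1] by eventually_elim (use ps in \<open>meson less_imp_le order_trans\<close>)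
  have "\<forall>\<^sub>F n in sequentially. 0 < mu n (p n) r"
    using mu by (simp add: filterlim_at_top_dense)
  \<comment> \<open>\<open>p n = 0\<close> would make \<open>mu\<close> vanish, because its exponent
    \<open>r choose 2\<close> is positive.\<close>
  then have ev_pos: "\<forall>\<^sub>F n in sequentially. 0 < p n"
  proof eventually_elim
    case (elim n)
    have "0 < r choose 2" using assms by (simp add: zero_less_binomial)
    then have "p n \<noteq> 0" using elim by (auto simp: mu_def power_0_left)
    then show ?case using p01 by (simp add: order_less_le)
  qed
  show "\<exists>C::real. \<forall>\<omega> :: nat \<Rightarrow> real. filterlim \<omega> at_top sequentially \<longrightarrow>
        (\<exists>\<G> :: nat \<Rightarrow> nat hypergraph set.
          (\<forall>n. \<forall>H\<in>\<G> n. verts H = {1..n} \<and> uniform_hypergraph r H) \<and>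
          (\<lambda>n. measure_pmf.prob (random_graph n (p n)) {G. clique_hypergraph r G \<in> \<G> n})
            \<longlonglongrightarrow> 1 \<and>
          (\<forall>n\<ge>1. \<forall>H\<in>\<G> n. \<exists>\<delta>::real.
            \<bar>\<delta>\<bar> \<le> C * (\<omega> n * mu n (p n) (r + 1) + real n powr (- ?g)) \<and>
            measure_pmf.prob (random_graph n (p n)) {G. clique_hypergraph r G = H} =
              (let q = p n ^ (r choose 2) in
                q ^ num_edges H * (1 - q) ^ ((n choose r) - num_edges H)
                * p n powi (- edge_overlap r H)
                * exp (- Lambda n r (p n) + \<delta>))))"
  proof (intro exI[of _ 28] allI impI)
    fix \<omega> :: "nat \<Rightarrow> real"
    assume \<omega>: "filterlim \<omega> at_top sequentially"
    define good where "good = (\<lambda>n. r + 1 \<le> n \<and> 0 < p n \<and> p n \<le> 1 / 2 \<and> 0 < \<omega> n)"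
    \<comment> \<open>For the finitely many \<open>n\<close> that are not good the collection is
      empty, so the estimate required for every \<open>n \<ge> 1\<close> is vacuous there.\<close>
    define \<G> where "\<G> = (\<lambda>n. if good n then typical r n (p n) (\<omega> n) else {})"
    let ?P = "\<lambda>n. measure_pmf.prob (random_graph n (p n)) {G. clique_hypergraph r G \<in> \<G> n}"
    have "\<forall>\<^sub>F n in sequentially. 0 < \<omega> n" using \<omega> by (simp add: filterlim_at_top_dense)
    then have ev_good: "\<forall>\<^sub>F n in sequentially. good n"
      using ev_half ev_pos eventually_ge_at_top[of "r + 1"]
      by eventually_elim (simp add: good_def)
    obtain c1 c2 :: real where lower:
      "\<And>n. good n \<Longrightarrow> 1 - (c1 / \<omega> n + c2 * real n powr (- ?g)) \<le> ?P n"
    proof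
      show "1 - (8 ^ (r + 1) * 2 ^ ((r + 1) choose 2) / \<omega> n
          + (3 * (2 ^ (3 * (r choose 2) + (r - 1)) * (\<Sum>v\<le>3 * r. 8 ^ v)) + 4 ^ r * (real r)\<^sup>2 * (1 + 2 ^ r * real r))
            * real n powr (- ?g)) \<le> ?P n" if "good n" for n
        using prob_typical_ge[of r n "p n" "\<omega> n"] that assms ps by (simp add: good_def \<G>_def)
    qed
    have lim: "?P \<longlonglongrightarrow> 1"
    proof (rule tendsto_sandwich)
      show "\<forall>\<^sub>F n in sequentially. 1 - (c1 / \<omega> n + c2 * real n powr (- ?g)) \<le> ?P n"
        using ev_good lower by (rule eventually_mono)
      show "\<forall>\<^sub>F n in sequentially. ?P n \<le> 1" by simp
      have "(\<lambda>n. c1 / \<omega> n) \<longlonglongrightarrow> 0"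
        using tendsto_const \<omega> by (intro tendsto_divide_0[OF _ filterlim_at_top_imp_at_infinity])
      moreover have "(\<lambda>n. c2 * real n powr (- ?g)) \<longlonglongrightarrow> c2 * 0"
        using g nat_top by (intro tendsto_mult tendsto_const tendsto_neg_powr) auto
      ultimately have "(\<lambda>n. 1 - (c1 / \<omega> n + c2 * real n powr (- ?g))) \<longlonglongrightarrow> 1 - (0 + c2 * 0)"
        by (intro tendsto_diff tendsto_add tendsto_const)
      then show "(\<lambda>n. 1 - (c1 / \<omega> n + c2 * real n powr (- ?g))) \<longlonglongrightarrow> 1" by simp
    qed simp
    have unif: "verts H = {1..n}" "uniform_hypergraph r H" if "H \<in> \<G> n" for n H
      using that typicalD by (auto simp: \<G>_def split: if_splits)
    have est: "\<exists>\<delta>::real.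
            \<bar>\<delta>\<bar> \<le> 28 * (\<omega> n * mu n (p n) (r + 1) + real n powr (- ?g)) \<and>
            measure_pmf.prob (random_graph n (p n)) {G. clique_hypergraph r G = H} =
              (let q = p n ^ (r choose 2) in
                q ^ num_edges H * (1 - q) ^ ((n choose r) - num_edges H)
                * p n powi (- edge_overlap r H)
                * exp (- Lambda n r (p n) + \<delta>))" if "H \<in> \<G> n" for n H
    proof (rule prob_eq_of_typical)
      show "H \<in> typical r n (p n) (\<omega> n)" "3 \<le> r" "0 < p n" "p n \<le> 1 / 2" "0 \<le> \<omega> n"
        using that assms by (auto simp: \<G>_def good_def split: if_splits)
    qed
    show "\<exists>\<G> :: nat \<Rightarrow> nat hypergraph set.
          (\<forall>n. \<forall>H\<in>\<G> n. verts H = {1..n} \<and> uniform_hypergraph r H) \<and>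
          (\<lambda>n. measure_pmf.prob (random_graph n (p n)) {G. clique_hypergraph r G \<in> \<G> n})
            \<longlonglongrightarrow> 1 \<and>
          (\<forall>n\<ge>1. \<forall>H\<in>\<G> n. \<exists>\<delta>::real.
            \<bar>\<delta>\<bar> \<le> 28 * (\<omega> n * mu n (p n) (r + 1) + real n powr (- ?g)) \<and>
            measure_pmf.prob (random_graph n (p n)) {G. clique_hypergraph r G = H} =
              (let q = p n ^ (r choose 2) in
                q ^ num_edges H * (1 - q) ^ ((n choose r) - num_edges H)
                * p n powi (- edge_overlap r H)
                * exp (- Lambda n r (p n) + \<delta>)))"
      by (intro exI[of _ \<G>] conjI allI ballI impI; (rule lim | erule unif | erule est))
  qed
qed

end
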